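(* Let $H_0=-\overline{\Delta}$ act in $L^2(\mathbb{R}^d)$ and let $V=W+X$ be a sum of (possibly complex-valued) potentials on $\mathbb{R}^d$. Let $a>0$ and $R_0=(aI+H_0)^{-1}$. Suppose that $V$ and $W$ lie in $\mathcal{V}_{R_0}$ and that $\|V\|_{R_0}<1$, $\|W\|_{R_0}<1$. Suppose that $W$ is periodic in the $x_1$ direction. Let $S=\{x\in\mathbb{R}^d:|x_1|<1\}$, so that $S(n)=\{x\in\mathbb{R}^d:|x_1|<n+1\}$ for all $n\ge1$, and suppose that $X$ has support in $S(c)$ for some $c\ge1$. Put $H=H_0+V$. Then $$\sigma(H_0+W)=\sigma_{\rm ess}(H_0+W)=\sigma_S(H_0+W)=\sigma_S(H)\subseteq\sigma_{\rm ess}(H)\subseteq\sigma(H).$$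
   Context: Potentials are (possibly unbounded) measurable functions $V:\mathbb{R}^d\to\mathbb{C}$, identified with multiplication operators. For a positive (i.e. positivity preserving) operator $A$ on $L^2$, $\|V\|_A=\sup\{\|V(A\phi)\|:\|\phi\|\le1\}$, $\tilde{\mathcal{V}}_A$ is the space of potentials with $\|V\|_A<\infty$, and $\mathcal{V}_A$ is the closure of $L^\infty$ in $\tilde{\mathcal{V}}_A$ with respect to $\|\cdot\|_A$. $W$ is periodic in the $x_1$ direction if $W(x_1+k,x_2,\dots,x_d)=W(x)$ for some $k>0$ and almost all $x$. The operators $H_0+W$ and $H=H_0+V$ are the closed operators with domain $\mathrm{Dom}(H_0)$, with $(aI+H_0+W)^{-1}=R_0(I+WR_0)^{-1}$ and $(aI+H)^{-1}=R_0(I+VR_0)^{-1}$. The standard $C^*$-algebra $\mathcal{A}\subseteq\mathcal{L}(\mathcal{H})$, $\mathcal{H}=L^2(\mathbb{R}^d)$: for measurable $E$ let $P_E$ be multiplication by the characteristic function of $E$, and $P_{a,r}=P_{B(a,r)}$ for the open ball $B(a,r)$. $\mathcal{A}_m$ is the set of $A\in\mathcal{L}(\mathcal{H})$ such that $P_{a,r}AP_{b,s}\ne0$ implies $|a-b|\le r+s+m$ (for all points $a,b$ and radii $r,s>0$); $\mathcal{A}$ is the norm closure of $\bigcup_{m\ge0}\mathcal{A}_m$. For the open set $S$ and $r>0$, $S(r)=\{x:d(x,S)<r\}$ (Euclidean distance), and $\mathcal{J}_S$ is the norm closure of $\bigcup_{n\ge1}\{A\in\mathcal{A}:A=P_{S(n)}AP_{S(n)}\}$,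 a closed two-sided ideal of $\mathcal{A}$ containing the compact operators $\mathcal{K}(\mathcal{H})$. For a bounded $A\in\mathcal{A}$, $\sigma_S(A)$ is the spectrum of the image of $A$ in $\mathcal{A}/\mathcal{J}_S$, and $\sigma_{\rm ess}(A)$ is the spectrum of the image of $A$ in $\mathcal{L}(\mathcal{H})/\mathcal{K}(\mathcal{H})$. For a closed unbounded operator $T$ whose resolvents $R(z,T)=(zI-T)^{-1}$ lie in $\mathcal{A}$ (as is the case for $H_0+W$ and $H$), $\sigma_S(T)$ is the spectrum of the pseudo-resolvent $z\mapsto\pi(R(z,T))$ where $\pi:\mathcal{A}\to\mathcal{A}/\mathcal{J}_S$ is the quotient map, i.e. $\sigma_S(T)=\{z\in\mathbb{C}:1+(z-\alpha)\pi(R(\alpha,T))\text{ is not invertible in }\mathcal{A}/\mathcal{J}_S\}$ for any (equivalently every) $\alpha\notin\sigma(T)$; $\sigma_{\rm ess}(T)$ is defined in the same way using the Calkin algebra $\mathcal{L}(\mathcal{H})/\mathcal{K}(\mathcal{H})$. *)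

theory Defs
  imports "HOL-Analysis.Analysis" "HOL-Algebra.QuotRing"
begin

section \<open>The Hilbert space of square integrable functions\<close>

definition sq_integrable :: "('a::euclidean_space \<Rightarrow> complex) \<Rightarrow> bool" where
  "sq_integrable f \<longleftrightarrow>
     f \<in> borel_measurable lebesgue \<and> integrable lebesgue (\<lambda>x. (norm (f x))\<^sup>2)"

lemma sq_integrable_zero: "sq_integrable (\<lambda>x. 0)"
  by (simp add: sq_integrable_def)

lemma sq_integrable_bound:
  assumes "sq_integrable f" "g \<in> borel_measurable lebesgue"
    and "\<And>x. norm (g x) \<le> c * norm (f x)"
  shows "sq_integrable g"
proof -
  have "integrable lebesgue (\<lambda>x. c\<^sup>2 * (norm (f x))\<^sup>2)"
    using assms(1) by (simp add: sq_integrable_def)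
  then have "integrable lebesgue (\<lambda>x. (norm (g x))\<^sup>2)"
  proof (rule Bochner_Integration.integrable_bound)
    show "AE x in lebesgue. norm ((norm (g x))\<^sup>2) \<le> norm (c\<^sup>2 * (norm (f x))\<^sup>2)"
      using power_mono[OF assms(3) norm_ge_zero, of _ 2]
      by (simp add: power_mult_distrib)
  qed (use assms(2) in measurable)
  with assms(2) show ?thesis
    by (simp add: sq_integrable_def)
qed

lemma sq_integrable_scaleC: "sq_integrable f \<Longrightarrow> sq_integrable (\<lambda>x. c * f x)"
  by (rule sq_integrable_bound[where c = "norm c" and f = f])
    (auto simp: sq_integrable_def norm_mult intro!: borel_measurable_times)

lemma sq_integrable_add:
  assumes "sq_integrable f" "sq_integrable g"
  shows "sq_integrable (\<lambda>x. f x + g x)"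
proof -
  have [measurable]: "f \<in> borel_measurable lebesgue" "g \<in> borel_measurable lebesgue"
    using assms by (auto simp: sq_integrable_def)
  have "integrable lebesgue (\<lambda>x. 2 * (norm (f x))\<^sup>2 + 2 * (norm (g x))\<^sup>2)"
    using assms by (simp add: sq_integrable_def)
  then have "integrable lebesgue (\<lambda>x. (norm (f x + g x))\<^sup>2)"
  proof (rule Bochner_Integration.integrable_bound)
    have "(norm (u + v))\<^sup>2 \<le> 2 * (norm u)\<^sup>2 + 2 * (norm v)\<^sup>2" for u v :: complex
    proof -
      have "(norm (u + v))\<^sup>2 \<le> (norm u + norm v)\<^sup>2"
        by (intro power_mono norm_triangle_ineq norm_ge_zero)
      also have "\<dots> \<le> 2 * (norm u)\<^sup>2 + 2 * (norm v)\<^sup>2"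
        using sum_squares_bound[of "norm u" "norm v"] by (simp add: power2_sum)
      finally show ?thesis .
    qed
    then show "AE x in lebesgue. norm ((norm (f x + g x))\<^sup>2)
        \<le> norm (2 * (norm (f x))\<^sup>2 + 2 * (norm (g x))\<^sup>2)"
      by auto
  qed measurable
  then show ?thesis
    by (simp add: sq_integrable_def)
qed

lemma sq_integrable_inner:
  assumes "sq_integrable f" "sq_integrable g"
  shows "integrable lebesgue (\<lambda>x. f x \<bullet> g x)"
proof -
  have [measurable]: "f \<in> borel_measurable lebesgue" "g \<in> borel_measurable lebesgue"
    using assms by (auto simp: sq_integrable_def)
  have "integrable lebesgue (\<lambda>x. (norm (f x))\<^sup>2 + (norm (g x))\<^sup>2)"
    using assms by (simp add: sq_integrable_def)
  then show ?thesis
  proof (rule Bochner_Integration.integrable_bound)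
    have "\<bar>u \<bullet> v\<bar> \<le> (norm u)\<^sup>2 + (norm v)\<^sup>2" for u v :: complex
    proof -
      have "\<bar>u \<bullet> v\<bar> \<le> norm u * norm v"
        by (rule Cauchy_Schwarz_ineq2)
      also have "\<dots> \<le> (norm u)\<^sup>2 + (norm v)\<^sup>2"
      proof -
        have "2 * (norm u * norm v) \<le> (norm u)\<^sup>2 + (norm v)\<^sup>2"
          using sum_squares_bound[of "norm u" "norm v"] by (simp add: mult.assoc)
        moreover have "0 \<le> norm u * norm v" by simp
        ultimately show ?thesis by linarith
      qed
      finally show ?thesis .
    qed
    then show "AE x in lebesgue. norm (f x \<bullet> g x) \<le> norm ((norm (f x))\<^sup>2 + (norm (g x))\<^sup>2)"
      by auto
  qed measurable
qed

definition L2_rel :: "('a::euclidean_space \<Rightarrow> complex) \<Rightarrow> ('a \<Rightarrow> complex) \<Rightarrow> bool" where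
  "L2_rel f g \<longleftrightarrow> sq_integrable f \<and> sq_integrable g \<and> (AE x in lebesgue. f x = g x)"

quotient_type (overloaded) 'a L2 = "'a::euclidean_space \<Rightarrow> complex" / partial: L2_rel
proof (rule part_equivpI)
  show "\<exists>f :: 'a \<Rightarrow> complex. L2_rel f f"
    using sq_integrable_zero by (auto simp: L2_rel_def)
  show "symp (L2_rel :: ('a \<Rightarrow> complex) \<Rightarrow> _)"
    by (auto simp: symp_def L2_rel_def)
  show "transp (L2_rel :: ('a \<Rightarrow> complex) \<Rightarrow> _)"
    unfolding transp_def L2_rel_def by (auto elim: AE_mp)
qed

instantiation L2 :: (euclidean_space) real_vector
begin

lift_definition zero_L2 :: "'a L2" is "\<lambda>x. 0"
  by (simp add: L2_rel_def sq_integrable_zero)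

lift_definition plus_L2 :: "'a L2 \<Rightarrow> 'a L2 \<Rightarrow> 'a L2" is "\<lambda>f g x. f x + g x"
  unfolding L2_rel_def by (auto intro: sq_integrable_add)

lift_definition uminus_L2 :: "'a L2 \<Rightarrow> 'a L2" is "\<lambda>f x. - f x"
  unfolding L2_rel_def using sq_integrable_scaleC[of _ "-1"] by auto

definition minus_L2 :: "'a L2 \<Rightarrow> 'a L2 \<Rightarrow> 'a L2" where
  "minus_L2 f g = f + - g"

lift_definition scaleR_L2 :: "real \<Rightarrow> 'a L2 \<Rightarrow> 'a L2" is "\<lambda>c f x. c *\<^sub>R f x"
  unfolding L2_rel_def scaleR_conv_of_real by (auto intro: sq_integrable_scaleC)

instance
proof
  fix f g h :: "'a L2" and a b :: real
  show "f + g + h = f + (g + h)"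
    by transfer (auto simp: L2_rel_def add.assoc intro!: sq_integrable_add)
  show "f + g = g + f"
    by transfer (auto simp: L2_rel_def add.commute intro!: sq_integrable_add)
  show "0 + f = f"
    by transfer (auto simp: L2_rel_def)
  show "- f + f = 0"
    by transfer (auto simp: L2_rel_def sq_integrable_zero)
  show "f - g = f + - g"
    by (rule minus_L2_def)
  show "a *\<^sub>R (f + g) = a *\<^sub>R f + a *\<^sub>R g"
    by transfer
      (auto simp: L2_rel_def scaleR_conv_of_real distrib_left
        intro!: sq_integrable_add sq_integrable_scaleC simp flip: distrib_left)
  show "(a + b) *\<^sub>R f = a *\<^sub>R f + b *\<^sub>R f"
    by transfer
      (auto simp: L2_rel_def scaleR_conv_of_real distrib_right
        intro!: sq_integrable_add sq_integrable_scaleC)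
  show "a *\<^sub>R b *\<^sub>R f = (a * b) *\<^sub>R f"
    by transfer
      (auto simp: L2_rel_def scaleR_conv_of_real mult.assoc
        intro!: sq_integrable_scaleC)
  show "1 *\<^sub>R f = f"
    by transfer (auto simp: L2_rel_def)
qed

end

instantiation L2 :: (euclidean_space) real_inner
begin

text \<open>The real part of the complex inner product; it induces the usual norm.\<close>

lift_definition inner_L2 :: "'a L2 \<Rightarrow> 'a L2 \<Rightarrow> real" is
  "\<lambda>f g. \<integral>x. f x \<bullet> g x \<partial>lebesgue"
  unfolding L2_rel_def
  by (intro integral_cong_AE)
    (auto simp: sq_integrable_def intro!: borel_measurable_inner)

definition norm_L2 :: "'a L2 \<Rightarrow> real" where
  "norm_L2 f = sqrt (f \<bullet> f)"

definition dist_L2 :: "'a L2 \<Rightarrow> 'a L2 \<Rightarrow> real" where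
  "dist_L2 f g = norm (f - g)"

definition sgn_L2 :: "'a L2 \<Rightarrow> 'a L2" where
  "sgn_L2 f = f /\<^sub>R norm f"

definition uniformity_L2 :: "('a L2 \<times> 'a L2) filter" where
  "uniformity_L2 = (INF e\<in>{0<..}. principal {(f, g). dist f g < e})"

definition open_L2 :: "'a L2 set \<Rightarrow> bool" where
  "open_L2 U \<longleftrightarrow> (\<forall>f\<in>U. eventually (\<lambda>(f', g). f' = f \<longrightarrow> g \<in> U) uniformity)"

instance
proof
  fix f g h :: "'a L2" and a b :: real
  show "dist f g = norm (f - g)"
    by (rule dist_L2_def)
  show "sgn f = f /\<^sub>R norm f"
    by (rule sgn_L2_def)
  show "uniformity = (INF e\<in>{0<..}. principal {(f, g :: 'a L2). dist f g < e})"
    by (rule uniformity_L2_def)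
  show "open U \<longleftrightarrow> (\<forall>f\<in>U. eventually (\<lambda>(f', g). f' = f \<longrightarrow> g \<in> U) uniformity)"
    for U :: "'a L2 set"
    by (rule open_L2_def)
  show "f \<bullet> g = g \<bullet> f"
    by transfer (simp add: inner_commute)
  show "(f + g) \<bullet> h = f \<bullet> h + g \<bullet> h"
    by transfer
      (simp add: L2_rel_def inner_add_left Bochner_Integration.integral_add sq_integrable_inner)
  show "a *\<^sub>R f \<bullet> g = a * (f \<bullet> g)"
    by transfer simp
  show "0 \<le> f \<bullet> f"
    by transfer simp
  show "f \<bullet> f = 0 \<longleftrightarrow> f = 0"
  proof transfer
    fix f :: "'a \<Rightarrow> complex"
    assume "L2_rel f f"
    then have f: "sq_integrable f" by (simp add: L2_rel_def)
    have "(\<integral>x. f x \<bullet> f x \<partial>lebesgue) = 0 \<longleftrightarrow> (AE x in lebesgue. f x \<bullet> f x = 0)"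
      by (rule integral_nonneg_eq_0_iff_AE) (use sq_integrable_inner[OF f f] in auto)
    then show "(\<integral>x. f x \<bullet> f x \<partial>lebesgue) = 0 \<longleftrightarrow> L2_rel f (\<lambda>x. 0)"
      using f by (simp add: L2_rel_def sq_integrable_zero)
  qed
  show "norm f = sqrt (f \<bullet> f)"
    by (rule norm_L2_def)
qed

end

lift_definition scaleC_L2 :: "complex \<Rightarrow> 'a::euclidean_space L2 \<Rightarrow> 'a L2" (infixr \<open>*\<^sub>C\<close> 75)
  is "\<lambda>c f x. c * f x"
  unfolding L2_rel_def by (auto intro: sq_integrable_scaleC)

text \<open>The class of a square integrable function; junk value \<open>0\<close> on other functions.\<close>

lift_definition L2_of :: "('a::euclidean_space \<Rightarrow> complex) \<Rightarrow> 'a L2"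
  is "\<lambda>f. if sq_integrable f then f else (\<lambda>x. 0)"
  by (simp add: L2_rel_def sq_integrable_zero)

text \<open>\<open>rep_L2\<close> picks a representative, so it is meaningful only up to null sets.\<close>

lemma sq_integrable_rep_L2: "sq_integrable (rep_L2 f)"
  using Quotient_rep_reflp[OF Quotient_L2, of f] by (simp add: L2_rel_def)

lemma L2_of_rep_L2: "L2_of (rep_L2 f) = f"
  by (simp add: L2_of_def sq_integrable_rep_L2 Quotient_abs_rep[OF Quotient_L2])

lemma rep_L2_of:
  assumes "sq_integrable f"
  shows "AE x in lebesgue. rep_L2 (L2_of f) x = f x"
proof -
  have "L2_rel (rep_L2 (abs_L2 f)) f"
    by (rule Quotient_rep_abs[OF Quotient_L2]) (simp add: L2_rel_def assms)
  then show ?thesis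
    by (simp add: L2_rel_def L2_of_def assms)
qed

lemma norm_L2_of:
  "sq_integrable f \<Longrightarrow> norm (L2_of f) = sqrt (\<integral>x. (norm (f x))\<^sup>2 \<partial>lebesgue)"
  unfolding norm_L2_def by transfer (simp add: power2_norm_eq_inner)

section \<open>Bounded operators\<close>

type_synonym 'a op = "'a L2 \<Rightarrow>\<^sub>L 'a L2"

definition bounded_ops :: "'a::euclidean_space op set" where
  "bounded_ops = {A. \<forall>c f. blinfun_apply A (c *\<^sub>C f) = c *\<^sub>C blinfun_apply A f}"

lemma norm_scaleC_L2: "norm (c *\<^sub>C f) = norm c * norm f" for f :: "'a::euclidean_space L2"
proof -
  have "(c *\<^sub>C f) \<bullet> (c *\<^sub>C f) = (norm c)\<^sup>2 * (f \<bullet> f)"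
    by transfer (simp add: power_mult_distrib norm_mult flip: power2_norm_eq_inner)
  then show ?thesis
    by (simp add: norm_eq_sqrt_inner real_sqrt_mult)
qed

lift_definition scalar_op :: "complex \<Rightarrow> 'a::euclidean_space op" is "\<lambda>c f. c *\<^sub>C f"
proof (rule bounded_linear_intro)
  fix c :: complex and f g :: "'a L2" and r :: real
  show "c *\<^sub>C (f + g) = c *\<^sub>C f + c *\<^sub>C g"
    by transfer
      (auto simp: L2_rel_def distrib_left intro!: sq_integrable_add sq_integrable_scaleC
        simp flip: distrib_left)
  show "c *\<^sub>C r *\<^sub>R f = r *\<^sub>R c *\<^sub>C f"
    by transfer
      (auto simp: L2_rel_def scaleR_conv_of_real mult.left_commute intro!: sq_integrable_scaleC)
  show "norm (c *\<^sub>C f) \<le> norm f * norm c"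
    by (simp add: norm_scaleC_L2)
qed

lemma sq_integrable_restrict:
  assumes "sq_integrable f"
  shows "sq_integrable (\<lambda>x. if E \<in> sets lebesgue then indicator E x * f x else 0)"
proof (cases "E \<in> sets lebesgue")
  case True
  have "sq_integrable (\<lambda>x. indicator E x * f x)"
    by (rule sq_integrable_bound[OF assms, where c = 1])
      (use assms True in \<open>auto simp: sq_integrable_def norm_mult indicator_def
        intro!: borel_measurable_times borel_measurable_indicator\<close>)
  with True show ?thesis by simp
qed (simp add: sq_integrable_zero)

lift_definition restrict_L2 :: "'a set \<Rightarrow> 'a::euclidean_space L2 \<Rightarrow> 'a L2"
  is "\<lambda>E f x. if E \<in> sets lebesgue then indicator E x * f x else 0"
  unfolding L2_rel_def by (intro conjI sq_integrable_restrict) auto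

text \<open>Multiplication by the characteristic function of \<open>E\<close>, for measurable \<open>E\<close>.\<close>

lift_definition proj :: "'a set \<Rightarrow> 'a::euclidean_space op" is restrict_L2
proof (rule bounded_linear_intro)
  fix E :: "'a set" and f g :: "'a L2" and r :: real
  show "restrict_L2 E (f + g) = restrict_L2 E f + restrict_L2 E g"
    by transfer
      (unfold L2_rel_def, intro conjI sq_integrable_restrict sq_integrable_add AE_I2,
        simp_all add: distrib_left)
  show "restrict_L2 E (r *\<^sub>R f) = r *\<^sub>R restrict_L2 E f"
    by transfer
      (unfold L2_rel_def scaleR_conv_of_real,
        intro conjI sq_integrable_restrict sq_integrable_scaleC AE_I2, simp_all)
  have "restrict_L2 E f \<bullet> restrict_L2 E f \<le> f \<bullet> f"
  proof transfer
    fix E :: "'a set" and f :: "'a \<Rightarrow> complex"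
    let ?g = "\<lambda>x. if E \<in> sets lebesgue then indicator E x * f x else 0"
    assume "L2_rel f f"
    then have f: "sq_integrable f" by (simp add: L2_rel_def)
    then have g: "sq_integrable ?g" by (rule sq_integrable_restrict)
    show "(\<integral>x. ?g x \<bullet> ?g x \<partial>lebesgue) \<le> (\<integral>x. f x \<bullet> f x \<partial>lebesgue)"
      by (intro integral_mono sq_integrable_inner f g) (auto simp: indicator_def)
  qed
  then show "norm (restrict_L2 E f) \<le> norm f * 1"
    by (simp add: norm_eq_sqrt_inner)
qed

definition compact_ops :: "'a::euclidean_space op set" where
  "compact_ops = {A \<in> bounded_ops. compact (closure (blinfun_apply A ` cball 0 1))}"

section \<open>Unbounded operators\<close>

text \<open>An unbounded operator is represented by its graph.\<close>

type_synonym 'a unbounded_op = "('a L2 \<times> 'a L2) set"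

definition op_graph :: "'a::euclidean_space op \<Rightarrow> 'a unbounded_op" where
  "op_graph A = {(f, blinfun_apply A f) |f. True}"

definition op_plus ::
    "'a::euclidean_space unbounded_op \<Rightarrow> 'a unbounded_op \<Rightarrow> 'a unbounded_op" where
  "op_plus T U = {(f, g + h) |f g h. (f, g) \<in> T \<and> (f, h) \<in> U}"

definition op_uminus :: "'a::euclidean_space unbounded_op \<Rightarrow> 'a unbounded_op" where
  "op_uminus T = {(f, - g) |f g. (f, g) \<in> T}"

definition is_bounded_inverse ::
    "'a::euclidean_space unbounded_op \<Rightarrow> 'a op \<Rightarrow> bool" where
  "is_bounded_inverse T A \<longleftrightarrow> A \<in> bounded_ops \<and> op_graph A = T\<inverse>"

definition bounded_inverse :: "'a::euclidean_space unbounded_op \<Rightarrow> 'a op" where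
  "bounded_inverse T = (THE A. is_bounded_inverse T A)"

lemma bounded_inverse_eq: "is_bounded_inverse T A \<Longrightarrow> bounded_inverse T = A"
  unfolding bounded_inverse_def
proof (rule the_equality)
  fix B assume "is_bounded_inverse T A" "is_bounded_inverse T B"
  then have "op_graph B = op_graph A"
    by (simp add: is_bounded_inverse_def)
  then have "blinfun_apply B f = blinfun_apply A f" for f
    by (auto simp: op_graph_def)
  then show "B = A"
    by (simp add: blinfun_eqI)
qed

definition resolvent_set :: "'a::euclidean_space unbounded_op \<Rightarrow> complex set" where
  "resolvent_set T =
     {z. \<exists>A. is_bounded_inverse (op_plus (op_graph (scalar_op z)) (op_uminus T)) A}"

definition resolvent :: "complex \<Rightarrow> 'a::euclidean_space unbounded_op \<Rightarrow> 'a op" where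
  "resolvent z T = bounded_inverse (op_plus (op_graph (scalar_op z)) (op_uminus T))"

definition spectrum :: "'a::euclidean_space unbounded_op \<Rightarrow> complex set" where
  "spectrum T = - resolvent_set T"

section \<open>Spectra relative to an ideal\<close>

definition op_ring :: "'a::euclidean_space op set \<Rightarrow> 'a op ring" where
  "op_ring C = \<lparr>carrier = C, mult = (o\<^sub>L), one = id_blinfun, zero = 0, add = (+)\<rparr>"

text \<open>
  The spectrum of the pseudo-resolvent \<open>z \<mapsto> \<pi> (resolvent z T)\<close> in the quotient of the
  algebra \<open>C\<close> by the ideal \<open>J\<close>, where \<open>\<pi> A\<close> is the coset \<open>J + A\<close>. When the resolvents
  of \<open>T\<close> lie in \<open>C\<close>, the condition does not depend on \<open>\<alpha>\<close> by the resolvent identity.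
\<close>

definition quot_spectrum ::
    "'a::euclidean_space op set \<Rightarrow> 'a op set \<Rightarrow> 'a unbounded_op \<Rightarrow> complex set" where
  "quot_spectrum C J T =
     {z. \<forall>\<alpha>\<in>resolvent_set T.
        \<one>\<^bsub>op_ring C Quot J\<^esub> \<oplus>\<^bsub>op_ring C Quot J\<^esub>
          (J +>\<^bsub>op_ring C\<^esub> (scalar_op (z - \<alpha>) o\<^sub>L resolvent \<alpha> T))
        \<notin> Units (op_ring C Quot J)}"

definition ess_spectrum :: "'a::euclidean_space unbounded_op \<Rightarrow> complex set" where
  "ess_spectrum T = quot_spectrum bounded_ops compact_ops T"

definition finite_range_ops :: "real \<Rightarrow> 'a::euclidean_space op set" where
  "finite_range_ops m =
     {A \<in> bounded_ops. \<forall>a b r s. r > 0 \<longrightarrow> s > 0 \<longrightarrow>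
        proj (ball a r) o\<^sub>L A o\<^sub>L proj (ball b s) \<noteq> 0 \<longrightarrow> dist a b \<le> r + s + m}"

definition std_algebra :: "'a::euclidean_space op set" where
  "std_algebra = closure (\<Union>m\<in>{0..}. finite_range_ops m)"

text \<open>\<open>infdist x {} = 0\<close>, so the next two definitions are meant for nonempty \<open>S\<close> only.\<close>

definition nbhd :: "'a::euclidean_space set \<Rightarrow> real \<Rightarrow> 'a set" where
  "nbhd S r = {x. infdist x S < r}"

definition std_ideal :: "'a::euclidean_space set \<Rightarrow> 'a op set" where
  "std_ideal S = closure (\<Union>n\<in>{1::nat..}.
     {A \<in> std_algebra. A = proj (nbhd S (real n)) o\<^sub>L A o\<^sub>L proj (nbhd S (real n))})"

definition S_spectrum ::
    "'a::euclidean_space set \<Rightarrow> 'a unbounded_op \<Rightarrow> complex set" where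
  "S_spectrum S T = quot_spectrum std_algebra (std_ideal S) T"

section \<open>Schroedinger operators\<close>

definition partial_deriv ::
    "'a::euclidean_space \<Rightarrow> ('a \<Rightarrow> complex) \<Rightarrow> 'a \<Rightarrow> complex" where
  "partial_deriv b f x = frechet_derivative f (at x) b"

primrec C_k :: "nat \<Rightarrow> ('a::euclidean_space \<Rightarrow> complex) \<Rightarrow> bool" where
  "C_k 0 f \<longleftrightarrow> continuous_on UNIV f"
| "C_k (Suc k) f \<longleftrightarrow> f differentiable_on UNIV \<and> (\<forall>b\<in>Basis. C_k k (partial_deriv b f))"

definition test_function :: "('a::euclidean_space \<Rightarrow> complex) \<Rightarrow> bool" where
  "test_function f \<longleftrightarrow> (\<forall>k. C_k k f) \<and> compact (closure (support_on UNIV f))"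

definition laplacian :: "('a::euclidean_space \<Rightarrow> complex) \<Rightarrow> 'a \<Rightarrow> complex" where
  "laplacian f x = (\<Sum>b\<in>Basis. partial_deriv b (partial_deriv b f) x)"

definition free_hamiltonian :: "'a::euclidean_space unbounded_op" where
  "free_hamiltonian =
     op_uminus (closure {(L2_of f, L2_of (laplacian f)) |f. test_function f})"

definition free_resolvent :: "real \<Rightarrow> 'a::euclidean_space op" where
  "free_resolvent a =
     bounded_inverse (op_plus (op_graph (scalar_op (of_real a))) free_hamiltonian)"

text \<open>Multiplication by \<open>V\<close>, on the maximal domain of all \<open>f\<close> with \<open>V f\<close> square integrable.\<close>

definition mult_op :: "('a::euclidean_space \<Rightarrow> complex) \<Rightarrow> 'a unbounded_op" where
  "mult_op V = {(f, g). AE x in lebesgue. rep_L2 g x = V x * rep_L2 f x}"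

section \<open>Potentials\<close>

definition L2_enorm :: "('a::euclidean_space \<Rightarrow> complex) \<Rightarrow> ennreal" where
  "L2_enorm f = (if sq_integrable f then ennreal (norm (L2_of f)) else \<infinity>)"

definition pot_norm :: "'a::euclidean_space op \<Rightarrow> ('a \<Rightarrow> complex) \<Rightarrow> ennreal" where
  "pot_norm A V = (SUP \<phi>\<in>cball 0 1. L2_enorm (\<lambda>x. V x * rep_L2 (blinfun_apply A \<phi>) x))"

definition pot_space :: "'a::euclidean_space op \<Rightarrow> ('a \<Rightarrow> complex) set" where
  "pot_space A = {V \<in> borel_measurable lebesgue. pot_norm A V < \<infinity>}"

definition ess_bounded :: "('a::euclidean_space \<Rightarrow> complex) \<Rightarrow> bool" where
  "ess_bounded V \<longleftrightarrow>
     V \<in> borel_measurable lebesgue \<and> (\<exists>K. AE x in lebesgue. norm (V x) \<le> K)"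

definition pot_space_closure :: "'a::euclidean_space op \<Rightarrow> ('a \<Rightarrow> complex) set" where
  "pot_space_closure A =
     {V \<in> pot_space A. \<forall>\<epsilon>>0. \<exists>B. ess_bounded B \<and> pot_norm A (\<lambda>x. V x - B x) < ennreal \<epsilon>}"

definition periodic_along ::
    "'a::euclidean_space \<Rightarrow> ('a \<Rightarrow> complex) \<Rightarrow> bool" where
  "periodic_along e W \<longleftrightarrow> (\<exists>k>0. AE x in lebesgue. W (x + k *\<^sub>R e) = W x)"

end

theory Submission
  imports Defs
begin

text \<open>
  Everything is decided by the resolvents at \<open>- a\<close>, which belong to the standard algebra \<open>\<A>\<close> of norm
  limits of operators of finite range.

  The spectra of a fixed operator are compared first. Suppose that one resolvent of \<open>T\<close> lies in \<open>\<A>\<close>.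
  A point \<open>z\<close> is outside a quotient spectrum exactly if \<open>1 + (z - \<alpha>) R(\<alpha>, T)\<close> is invertible modulo the
  ideal in question (\<open>quot_spectrum_eq\<close>). Invertibility in the large algebra implies invertibility
  modulo compact operators, and this implies invertibility in \<open>\<A>\<close> modulo the ideal \<open>\<J>\<^sub>S\<close>: the compact
  operators lie in \<open>\<J>\<^sub>S\<close>, and an inverse modulo compact operators of an element \<open>B\<close> of \<open>\<A>\<close> may be chosen
  in \<open>\<A>\<close>, because \<open>B\<^sup>* B + K\<^sup>* K\<close> is bounded below for a suitable compact \<open>K\<close> and Neumann series
  stay in \<open>\<A>\<close> (\<open>left_parametrix_in_subalgebra\<close>). This yields
  \<open>\<sigma>\<^sub>S(T) \<subseteq> \<sigma>\<^sub>e\<^sub>s\<^sub>s(T) \<subseteq> \<sigma>(T)\<close>.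

  For the periodic operator the circle closes by \<open>\<sigma>(T) \<subseteq> \<sigma>\<^sub>S(T)\<close> (\<open>spectrum_subset_S_spectrum\<close>). Its
  resolvent commutes with the translation by one period. The powers of this translation carry every
  function away from all neighbourhoods of the slab \<open>S\<close>, so that conjugation with them makes elements
  of \<open>\<J>\<^sub>S\<close> tend strongly to zero; an inverse modulo \<open>\<J>\<^sub>S\<close> then gives a lower bound and dense range,
  hence a true inverse. Finally the resolvents of \<open>H\<^sub>0 + W\<close> and \<open>H\<close> at \<open>- a\<close> differ by
  a product in \<open>\<A>\<close> with the factor \<open>X R\<^sub>0\<close>. This factor is supported near \<open>S\<close> on one side,
  which for elements of \<open>\<A>\<close> implies that it is in \<open>\<J>\<^sub>S\<close> (\<open>one_sided_support_std_ideal\<close>). So the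
  two operators have the same spectrum relative to \<open>S\<close>.

  It remains to see that the resolvents are in \<open>\<A>\<close>. Since \<open>V\<close> is a limit of bounded functions in the
  potential norm, \<open>V R\<^sub>0\<close> is in \<open>\<A>\<close> as soon as \<open>R\<^sub>0\<close> is, and \<open>R\<^sub>0 (1 + V R\<^sub>0)\<^sup>-\<^sup>1\<close> is given by a Neumann
  series (\<open>perturbed_resolvent\<close>). The free resolvent itself is obtained from the discrete
  Laplacians \<open>\<Delta>\<^sub>h\<close>, which are finite combinations of translations: \<open>a - \<Delta>\<^sub>h\<close> is a multiple of \<open>1 - E\<close>
  with \<open>\<parallel>E\<parallel> < 1\<close>, so its inverse \<open>R\<^sub>h\<close> is in \<open>\<A>\<close>, bounded by \<open>1 / a\<close> and commutes with translations.
  On test functions \<open>\<Delta>\<^sub>h\<close> converges uniformly to \<open>\<Delta>\<close>. Consequently \<open>a - \<Delta>\<close> is bounded below and has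
  dense range on test functions, its closure has the bounded inverse \<open>R\<^sub>0\<close>, and \<open>R\<^sub>h\<close> converges
  strongly to \<open>R\<^sub>0\<close> (\<open>free_resolvent\<close>, \<open>discrete_resolvent_tendsto\<close>). After convolution with a test function
  the convergence is in norm, so that \<open>R\<^sub>0\<close> times a convolution is in \<open>\<A>\<close>. A discrete
  energy estimate shows that translations are Lipschitz continuous after \<open>R\<^sub>0\<close>; therefore
  convolution with a mollifier changes \<open>R\<^sub>0\<close> little in norm, and \<open>R\<^sub>0\<close> is in \<open>\<A>\<close> too
  (\<open>free_resolvent_std_algebra\<close>).
\<close>

section \<open>Representatives and completeness of the space of square integrable functions\<close>

lemma L2_of_eqI:
  assumes "sq_integrable f" "sq_integrable g" "AE x in lebesgue. f x = g x"
  shows "L2_of f = L2_of g"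
proof -
  have "L2_rel f g" using assms by (simp add: L2_rel_def)
  then have "abs_L2 f = abs_L2 g" by (rule Quotient_rel_abs[OF Quotient_L2])
  then show ?thesis by (simp add: L2_of_def assms)
qed

lemma L2_eq_iff: "f = g \<longleftrightarrow> (AE x in lebesgue. rep_L2 f x = rep_L2 g x)"
proof
  assume "AE x in lebesgue. rep_L2 f x = rep_L2 g x"
  then have "L2_of (rep_L2 f) = L2_of (rep_L2 g)"
    by (intro L2_of_eqI sq_integrable_rep_L2)
  then show "f = g" by (simp add: L2_of_rep_L2)
qed simp

lemma L2_eqI: "(AE x in lebesgue. rep_L2 f x = rep_L2 g x) \<Longrightarrow> f = g"
  by (simp add: L2_eq_iff)

lemma rep_L2_measurable [measurable]: "rep_L2 f \<in> borel_measurable lebesgue"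
  using sq_integrable_rep_L2[of f] by (simp add: sq_integrable_def)

lemma L2_of_add: "sq_integrable f \<Longrightarrow> sq_integrable g \<Longrightarrow> L2_of (\<lambda>x. f x + g x) = L2_of f + L2_of g"
  by transfer (auto simp: L2_rel_def intro!: sq_integrable_add)

lemma L2_of_zero: "L2_of (\<lambda>x. 0) = 0"
  by transfer (auto simp: L2_rel_def sq_integrable_zero)

lemma L2_of_scaleC: "sq_integrable f \<Longrightarrow> L2_of (\<lambda>x. k * f x) = k *\<^sub>C L2_of f"
  by transfer (auto simp: L2_rel_def intro!: sq_integrable_scaleC)

lemma L2_of_uminus: "sq_integrable f \<Longrightarrow> L2_of (\<lambda>x. - f x) = - L2_of f"
  using sq_integrable_scaleC[of f "-1"]
  by transfer (auto simp: L2_rel_def)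

lemma sq_integrable_uminus: "sq_integrable f \<Longrightarrow> sq_integrable (\<lambda>x. - f x)"
  using sq_integrable_scaleC[of f "-1"] by simp

lemma sq_integrable_diff:
  "sq_integrable f \<Longrightarrow> sq_integrable g \<Longrightarrow> sq_integrable (\<lambda>x. f x - g x)"
  using sq_integrable_add[of f "\<lambda>x. - g x"] by (simp add: sq_integrable_uminus)

lemma L2_of_diff: "sq_integrable f \<Longrightarrow> sq_integrable g \<Longrightarrow> L2_of (\<lambda>x. f x - g x) = L2_of f - L2_of g"
  using L2_of_add[of f "\<lambda>x. - g x"] by (simp add: sq_integrable_uminus L2_of_uminus)

lemma sq_integrable_sum:
  "(\<And>i. i \<in> I \<Longrightarrow> sq_integrable (f i)) \<Longrightarrow> sq_integrable (\<lambda>x. \<Sum>i\<in>I. f i x)"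
  by (induction I rule: infinite_finite_induct) (auto intro: sq_integrable_zero sq_integrable_add)

lemma L2_of_sum:
  "(\<And>i. i \<in> I \<Longrightarrow> sq_integrable (f i)) \<Longrightarrow> L2_of (\<lambda>x. \<Sum>i\<in>I. f i x) = (\<Sum>i\<in>I. L2_of (f i))"
  by (induction I rule: infinite_finite_induct)
    (simp_all add: L2_of_zero L2_of_add sq_integrable_sum)

lemma rep_add: "AE x in lebesgue. rep_L2 (f + g) x = rep_L2 f x + rep_L2 g x"
  using rep_L2_of[OF sq_integrable_add[OF sq_integrable_rep_L2 sq_integrable_rep_L2, of f g]]
  by (simp add: L2_of_add sq_integrable_rep_L2 L2_of_rep_L2)

lemma rep_diff: "AE x in lebesgue. rep_L2 (f - g) x = rep_L2 f x - rep_L2 g x"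
  using rep_L2_of[OF sq_integrable_diff[OF sq_integrable_rep_L2 sq_integrable_rep_L2, of f g]]
  by (simp add: L2_of_diff sq_integrable_rep_L2 L2_of_rep_L2)

lemma rep_scaleC: "AE x in lebesgue. rep_L2 (k *\<^sub>C f) x = k * rep_L2 f x"
  using rep_L2_of[OF sq_integrable_scaleC[OF sq_integrable_rep_L2, of k f]]
  by (simp add: L2_of_scaleC sq_integrable_rep_L2 L2_of_rep_L2)

lemma rep_zero: "AE x in lebesgue. rep_L2 0 x = 0"
  using rep_L2_of[OF sq_integrable_zero] by (simp add: L2_of_zero)

lemma norm_L2_of_sq: "sq_integrable f \<Longrightarrow> (norm (L2_of f))\<^sup>2 = (\<integral>x. (norm (f x))\<^sup>2 \<partial>lebesgue)"
  using norm_L2_of[of f] by simp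

lemma inner_L2_of:
  "sq_integrable f \<Longrightarrow> sq_integrable g \<Longrightarrow> L2_of f \<bullet> L2_of g = (\<integral>x. f x \<bullet> g x \<partial>lebesgue)"
  by transfer simp

lemma norm_L2_of_mono:
  assumes "sq_integrable f" "sq_integrable g" "AE x in lebesgue. norm (f x) \<le> norm (g x)"
  shows "norm (L2_of f) \<le> norm (L2_of g)"
proof -
  have "(norm (L2_of f))\<^sup>2 \<le> (norm (L2_of g))\<^sup>2"
    unfolding norm_L2_of_sq[OF assms(1)] norm_L2_of_sq[OF assms(2)]
    by (intro integral_mono_AE) (use assms in \<open>auto simp: sq_integrable_def elim!: AE_mp intro!: AE_I2 power_mono\<close>)
  then show ?thesis by (rule power2_le_imp_le) simp
qed

text \<open>
  The majorant bounds the squared distance to the limit, which is how both the completeness proof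
  and the strong convergence of spatial projections provide it.
\<close>

lemma dominated_convergence_L2:
  fixes g :: "'a::euclidean_space \<Rightarrow> complex"
  assumes f: "\<And>n::nat. sq_integrable (f n)" and g: "sq_integrable g" and w: "integrable lebesgue w"
    and lim: "AE x in lebesgue. (\<lambda>n. f n x) \<longlonglongrightarrow> g x"
    and dom: "\<And>n. AE x in lebesgue. (norm (f n x - g x))\<^sup>2 \<le> w x"
  shows "(\<lambda>n. L2_of (f n)) \<longlonglongrightarrow> L2_of g"
proof -
  have [measurable]: "f n \<in> borel_measurable lebesgue" "g \<in> borel_measurable lebesgue" for n
    using f g by (auto simp: sq_integrable_def)
  have "(\<lambda>n. \<integral>x. (norm (f n x - g x))\<^sup>2 \<partial>lebesgue) \<longlonglongrightarrow> integral\<^sup>L lebesgue (\<lambda>x::'a. 0::real)"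
  proof (rule integral_dominated_convergence[where f = "\<lambda>x. 0" and M = lebesgue and w = w])
    show "AE x in lebesgue. (\<lambda>n. (norm (f n x - g x))\<^sup>2) \<longlonglongrightarrow> 0"
      using lim
    proof (rule AE_mp, intro AE_I2 impI)
      fix x assume "(\<lambda>n. f n x) \<longlonglongrightarrow> g x"
      then have "(\<lambda>n. (norm (f n x - g x))\<^sup>2) \<longlonglongrightarrow> (norm (g x - g x))\<^sup>2"
        by (intro tendsto_intros)
      then show "(\<lambda>n. (norm (f n x - g x))\<^sup>2) \<longlonglongrightarrow> 0" by simp
    qed
  qed (use dom w in auto)
  moreover have "(norm (L2_of (f n) - L2_of g))\<^sup>2 = (\<integral>x. (norm (f n x - g x))\<^sup>2 \<partial>lebesgue)" for n
    by (simp add: L2_of_diff[symmetric] f g norm_L2_of_sq sq_integrable_diff)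
  ultimately have "(\<lambda>n. (norm (L2_of (f n) - L2_of g))\<^sup>2) \<longlonglongrightarrow> 0" by simp
  from tendsto_real_sqrt[OF this] have "(\<lambda>n. norm (L2_of (f n) - L2_of g)) \<longlonglongrightarrow> 0" by simp
  then show ?thesis by (simp add: LIM_zero_iff tendsto_norm_zero_iff)
qed

text \<open>
  Riesz--Fischer. A Cauchy sequence has a subsequence whose successive distances are bounded by a
  geometric series. By monotone convergence the series of the pointwise distances has a square
  integrable sum. Hence the subsequence converges almost everywhere, and the square of this sum is
  the majorant that turns this into convergence in norm.
\<close>

instance L2 :: (euclidean_space) banach
proof
  fix X :: "nat \<Rightarrow> 'a L2"
  assume C: "Cauchy X"
  have "\<exists>r::nat\<Rightarrow>nat. strict_mono r \<and> (\<forall>n. norm (X (r (Suc n)) - X (r n)) < (1/2)^n)"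
  proof -
    have "\<exists>N. \<forall>m\<ge>N. \<forall>k\<ge>N. norm (X m - X k) < (1/2)^n" for n
      using C by (intro CauchyD) auto
    then obtain N where N: "\<And>n m k. m \<ge> N n \<Longrightarrow> k \<ge> N n \<Longrightarrow> norm (X m - X k) < (1/2)^n"
      by metis
    \<comment> \<open>the sum is strictly increasing and dominates every \<open>N n\<close>\<close>
    define r where "r n = (\<Sum>j\<le>n. Suc (N j))" for n
    have "strict_mono r" by (rule strict_monoI_Suc) (simp add: r_def)
    moreover have "r n \<ge> N n" for n
      using member_le_sum[of n "{..n}" "\<lambda>j. Suc (N j)"] by (simp add: r_def)
    moreover have "r (Suc n) \<ge> r n" for n by (simp add: r_def)
    ultimately show ?thesis using N by (meson order_trans)
  qed
  then obtain r where r: "strict_mono r" "\<And>n. norm (X (r (Suc n)) - X (r n)) < (1/2)^n" by blast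
  define f where "f n = rep_L2 (X (r n))" for n
  have f: "sq_integrable (f n)" for n by (simp add: f_def sq_integrable_rep_L2)
  have [measurable]: "f n \<in> borel_measurable lebesgue" for n by (simp add: f_def)
  define d where "d n x = norm (f (Suc n) x - f n x)" for n x
  have [measurable]: "d n \<in> borel_measurable lebesgue" for n unfolding d_def by measurable
  have d0: "d n x \<ge> 0" for n x by (simp add: d_def)
  have sd_meas: "(\<lambda>x. complex_of_real (d n x)) \<in> borel_measurable lebesgue" for n by measurable
  have sd: "sq_integrable (\<lambda>x. of_real (d n x))" for n
    by (rule sq_integrable_bound[OF sq_integrable_diff[OF f[of "Suc n"] f[of n]], where c=1])
      (use sd_meas[of n] in \<open>auto simp: d_def\<close>)
  have nd: "norm (L2_of (\<lambda>x. of_real (d n x))) \<le> (1/2)^n" for n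
  proof -
    have "norm (L2_of (\<lambda>x. of_real (d n x))) \<le> norm (L2_of (\<lambda>x. f (Suc n) x - f n x))"
      by (rule norm_L2_of_mono[OF sd sq_integrable_diff[OF f f]]) (simp add: d_def)
    also have "\<dots> = norm (X (r (Suc n)) - X (r n))"
      by (simp add: L2_of_diff f) (simp add: f_def L2_of_rep_L2)
    finally show ?thesis using r(2)[of n] by simp
  qed
  define G where "G N x = (\<Sum>n<N. d n x)" for N x
  have G0: "G N x \<ge> 0" for N x by (simp add: G_def sum_nonneg d0)
  have sG: "sq_integrable (\<lambda>x. of_real (G N x))" for N
    unfolding G_def of_real_sum by (rule sq_integrable_sum) (rule sd)
  have iG: "integrable lebesgue (\<lambda>x. (G N x)\<^sup>2)" for N
    using sG[of N] by (simp add: sq_integrable_def)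
  have GI: "(\<integral>x. (G N x)\<^sup>2 \<partial>lebesgue) \<le> 4" for N
  proof -
    have "norm (L2_of (\<lambda>x. of_real (G N x))) \<le> (\<Sum>n<N. norm (L2_of (\<lambda>x. of_real (d n x))))"
      unfolding G_def of_real_sum by (subst L2_of_sum) (auto intro: sd norm_sum)
    also have "\<dots> \<le> (\<Sum>n<N. (1/2)^n)" by (intro sum_mono nd)
    also have "\<dots> \<le> 2" by (simp add: geometric_sum)
    finally have "(norm (L2_of (\<lambda>x. of_real (G N x))))\<^sup>2 \<le> 2\<^sup>2" by (intro power_mono) auto
    then show ?thesis by (simp add: norm_L2_of_sq sG)
  qed
  have inc: "incseq (\<lambda>N x. ennreal ((G N x)\<^sup>2))"
  proof (rule incseq_SucI, rule le_funI)
    fix N x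
    have "G N x \<le> G (Suc N) x" by (simp add: G_def d0)
    then show "ennreal ((G N x)\<^sup>2) \<le> ennreal ((G (Suc N) x)\<^sup>2)"
      by (intro ennreal_leI power_mono G0)
  qed
  have [measurable]: "G N \<in> borel_measurable lebesgue" for N unfolding G_def by measurable
  have "(\<integral>\<^sup>+x. (SUP N. ennreal ((G N x)\<^sup>2)) \<partial>lebesgue) = (SUP N. \<integral>\<^sup>+x. ennreal ((G N x)\<^sup>2) \<partial>lebesgue)"
    by (rule nn_integral_monotone_convergence_SUP[OF inc]) auto
  also have "\<dots> \<le> ennreal 4"
    by (rule SUP_least) (use ennreal_leI[OF GI] in \<open>auto simp: nn_integral_eq_integral iG\<close>)
  finally have fin: "(\<integral>\<^sup>+x. (SUP N. ennreal ((G N x)\<^sup>2)) \<partial>lebesgue) \<le> ennreal 4" .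
  have AEfin: "AE x in lebesgue. (SUP N. ennreal ((G N x)\<^sup>2)) \<noteq> \<infinity>"
    by (rule nn_integral_noteq_infinite) (use fin in \<open>auto simp: top_unique\<close>)
  define w where "w x = enn2real (SUP N. ennreal ((G N x)\<^sup>2))" for x
  have w_meas [measurable]: "w \<in> borel_measurable lebesgue" unfolding w_def by measurable
  have w0: "w x \<ge> 0" for x by (simp add: w_def)
  have wint: "integrable lebesgue w"
  proof (rule integrableI_nonneg)
    have "(\<integral>\<^sup>+x. ennreal (w x) \<partial>lebesgue) \<le> (\<integral>\<^sup>+x. (SUP N. ennreal ((G N x)\<^sup>2)) \<partial>lebesgue)"
      by (rule nn_integral_mono) (simp add: w_def ennreal_enn2real_if)
    from le_less_trans[OF order_trans[OF this fin] ennreal_less_top]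
    show "(\<integral>\<^sup>+x. ennreal (w x) \<partial>lebesgue) < \<infinity>" by simp
  qed (auto simp: w0)
  have Gw: "AE x in lebesgue. \<forall>N. (G N x)\<^sup>2 \<le> w x"
    using AEfin
  proof (rule AE_mp, intro AE_I2 impI allI)
    fix x N assume "(SUP N. ennreal ((G N x)\<^sup>2)) \<noteq> \<infinity>"
    then have "(SUP N. ennreal ((G N x)\<^sup>2)) < top_class.top"
      unfolding infinity_ennreal_def by (rule top.not_eq_extremum[THEN iffD1])
    then have "ennreal (w x) = (SUP N. ennreal ((G N x)\<^sup>2))"
      unfolding w_def by (rule ennreal_enn2real)
    then have "ennreal ((G N x)\<^sup>2) \<le> ennreal (w x)" by (simp only:) (rule SUP_upper, simp)
    then show "(G N x)\<^sup>2 \<le> w x" by (simp add: w0)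
  qed
  have dist_f: "norm (f m x - f n x) \<le> sqrt (w x)" if "\<forall>N. (G N x)\<^sup>2 \<le> w x" for m n x
  proof -
    have *: "norm (f (n + k) x - f n x) \<le> (\<Sum>j=n..<n+k. d j x)" for n k
    proof (induction k)
      case (Suc k)
      have "norm (f (n + Suc k) x - f n x) \<le> norm (f (n+k) x - f n x) + d (n+k) x"
        using norm_triangle_ineq[of "f (n+k) x - f n x" "f (Suc (n+k)) x - f (n+k) x"] by (simp add: d_def)
      with Suc show ?case by simp
    qed simp
    have **: "norm (f (n + k) x - f n x) \<le> sqrt (w x)" for n k
    proof -
      have "(\<Sum>j=n..<n+k. d j x) \<le> G (n+k) x" unfolding G_def by (rule sum_mono2) (auto simp: d0)
      also have "\<dots> \<le> sqrt (w x)" using that G0 by (intro real_le_rsqrt) auto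
      finally show ?thesis using *[of n k] by simp
    qed
    show ?thesis
      using **[of n "m-n"] **[of m "n-m"] by (cases "n \<le> m") (auto simp: norm_minus_commute)
  qed
  have conv: "convergent (\<lambda>n. f n x)" if "\<forall>N. (G N x)\<^sup>2 \<le> w x" for x
  proof -
    have "summable (\<lambda>n. d n x)"
    proof (rule summableI_nonneg_bounded)
      show "sum (\<lambda>n. d n x) {..<N} \<le> sqrt (w x)" for N
        using that G0 unfolding G_def[symmetric] by (intro real_le_rsqrt) auto
    qed (rule d0)
    then have "summable (\<lambda>n. f (Suc n) x - f n x)" unfolding d_def by (rule summable_norm_cancel)
    then have "convergent (\<lambda>n. \<Sum>i<n. f (Suc i) x - f i x)" by (simp only: summable_iff_convergent)
    then have "convergent (\<lambda>n. f n x - f 0 x)" by (simp only: sum_lessThan_telescope[of "\<lambda>n. f n x"])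
    then have "convergent (\<lambda>n. (f n x - f 0 x) + f 0 x)" by (rule convergent_add) (rule convergent_const)
    then show ?thesis by simp
  qed
  define g where "g x = lim (\<lambda>n. f n x)" for x
  have [measurable]: "g \<in> borel_measurable lebesgue" unfolding g_def by (rule borel_measurable_lim_metric) simp
  have AEconv: "AE x in lebesgue. (\<lambda>n. f n x) \<longlonglongrightarrow> g x"
    using Gw
  proof (rule AE_mp, intro AE_I2 impI)
    fix x assume "\<forall>N. (G N x)\<^sup>2 \<le> w x"
    from conv[OF this] show "(\<lambda>n. f n x) \<longlonglongrightarrow> g x" unfolding g_def convergent_LIMSEQ_iff .
  qed
  have dom: "AE x in lebesgue. \<forall>n. (norm (f n x - g x))\<^sup>2 \<le> w x"
    using Gw
  proof (rule AE_mp, intro AE_I2 impI allI)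
    fix x n assume *: "\<forall>N. (G N x)\<^sup>2 \<le> w x"
    have "(\<lambda>m. f m x) \<longlonglongrightarrow> g x" using conv[OF *] unfolding g_def convergent_LIMSEQ_iff .
    then have "(\<lambda>m. norm (f n x - f m x)) \<longlonglongrightarrow> norm (f n x - g x)" by (intro tendsto_intros)
    then have "norm (f n x - g x) \<le> sqrt (w x)"
      by (rule LIMSEQ_le_const2) (use dist_f[OF *] in auto)
    then have "(norm (f n x - g x))\<^sup>2 \<le> (sqrt (w x))\<^sup>2" by (intro power_mono) auto
    then show "(norm (f n x - g x))\<^sup>2 \<le> w x" by (simp add: w0)
  qed
  have "sq_integrable (\<lambda>x. g x - f 0 x)"
    unfolding sq_integrable_def
  proof
    show "integrable lebesgue (\<lambda>x. (norm (g x - f 0 x))\<^sup>2)"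
    proof (rule Bochner_Integration.integrable_bound[OF wint])
      show "AE x in lebesgue. norm ((norm (g x - f 0 x))\<^sup>2) \<le> norm (w x)"
        using dom by eventually_elim (auto simp: norm_minus_commute w0)
    qed measurable
  qed measurable
  from sq_integrable_add[OF this f[of 0]] have g: "sq_integrable g" by simp
  have "(\<lambda>n. L2_of (f n)) \<longlonglongrightarrow> L2_of g"
    by (rule dominated_convergence_L2[OF f g wint AEconv]) (use dom in \<open>auto elim: AE_mp\<close>)
  then have "(X \<circ> r) \<longlonglongrightarrow> L2_of g" by (simp add: f_def L2_of_rep_L2 o_def)
  then show "convergent X"
    using Cauchy_converges_subseq[OF C r(1)] unfolding convergent_def by blast
qed

section \<open>Orthogonal projection and adjoints\<close>

text \<open>
  A minimizing sequence for the distance to \<open>M\<close> is Cauchy by the parallelogram law, and moving its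
  limit in the direction \<open>u\<close> cannot decrease the distance.
\<close>

lemma exists_orthogonal_projection:
  fixes x :: "'h::{real_inner,complete_space}"
  assumes M: "subspace M" "closed M"
  obtains m where "m \<in> M" "\<And>u. u \<in> M \<Longrightarrow> (x - m) \<bullet> u = 0"
proof -
  have ne: "M \<noteq> {}" using subspace_0[OF M(1)] by auto
  define d where "d = infdist x M"
  have d0: "d \<ge> 0" by (simp add: d_def infdist_nonneg)
  have dle: "d \<le> norm (x - y)" if "y \<in> M" for y
    using infdist_le[OF that, of x] by (simp add: d_def dist_norm)
  have "\<exists>y\<in>M. norm (x - y) < d + inverse (real (Suc n))" for n
  proof (rule ccontr)
    assume "\<not> ?thesis"
    then have "d + inverse (real (Suc n)) \<le> infdist x M"
      unfolding infdist_notempty[OF ne] by (intro cINF_greatest ne) (auto simp: dist_norm not_less)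
    then show False by (simp add: d_def)
  qed
  then obtain Y where Y: "\<And>n. Y n \<in> M" "\<And>n. norm (x - Y n) < d + inverse (real (Suc n))"
    by metis
  have par: "(norm (Y m - Y n))\<^sup>2 \<le> 2 * (norm (x - Y m))\<^sup>2 + 2 * (norm (x - Y n))\<^sup>2 - 4 * d\<^sup>2" for m n
  proof -
    have "(1/2) *\<^sub>R (Y m + Y n) \<in> M" by (intro subspace_scale subspace_add M Y)
    from dle[OF this] have "4 * d\<^sup>2 \<le> 4 * (norm (x - (1/2) *\<^sub>R (Y m + Y n)))\<^sup>2"
      using d0 by (simp add: power_mono)
    also have "\<dots> = 2 * (norm (x - Y m))\<^sup>2 + 2 * (norm (x - Y n))\<^sup>2 - (norm (Y m - Y n))\<^sup>2"
      by (simp add: power2_norm_eq_inner algebra_simps inner_commute)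
    finally show ?thesis by simp
  qed
  have lim: "(\<lambda>n. norm (x - Y n)) \<longlonglongrightarrow> d"
  proof (rule tendsto_sandwich[where f = "\<lambda>_. d" and h = "\<lambda>n. d + inverse (real (Suc n))"])
    show "(\<lambda>n. d + inverse (real (Suc n))) \<longlonglongrightarrow> d"
      using tendsto_add[OF tendsto_const LIMSEQ_inverse_real_of_nat, of d] by simp
  qed (use Y dle in \<open>auto intro!: always_eventually less_imp_le\<close>)
  have "Cauchy Y"
  proof (rule CauchyI)
    fix e :: real assume e: "e > 0"
    have "(\<lambda>n. 4 * (norm (x - Y n))\<^sup>2 - 4 * d\<^sup>2) \<longlonglongrightarrow> 4 * d\<^sup>2 - 4 * d\<^sup>2"
      by (intro tendsto_intros lim)
    then have "\<forall>\<^sub>F n in sequentially. 4 * (norm (x - Y n))\<^sup>2 - 4 * d\<^sup>2 < e\<^sup>2"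
      using e by (intro order_tendstoD) auto
    then obtain N where N: "\<And>n. n \<ge> N \<Longrightarrow> 4 * (norm (x - Y n))\<^sup>2 - 4 * d\<^sup>2 < e\<^sup>2"
      by (auto simp: eventually_sequentially)
    have "norm (Y m - Y n) < e" if "m \<ge> N" "n \<ge> N" for m n
    proof -
      have "(norm (Y m - Y n))\<^sup>2 < e\<^sup>2" using par[of m n] N[OF that(1)] N[OF that(2)] by simp
      then show ?thesis using e by (simp add: power_less_imp_less_base)
    qed
    then show "\<exists>N. \<forall>m\<ge>N. \<forall>n\<ge>N. norm (Y m - Y n) < e" by blast
  qed
  then obtain m where m: "Y \<longlonglongrightarrow> m" using Cauchy_convergent convergent_def by blast
  have mM: "m \<in> M" using closed_sequentially[OF M(2) Y(1) m] .
  have "(\<lambda>n. norm (x - Y n)) \<longlonglongrightarrow> norm (x - m)" by (intro tendsto_intros m)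
  then have nd: "norm (x - m) = d" using lim LIMSEQ_unique by blast
  have "(x - m) \<bullet> u = 0" if u: "u \<in> M" for u
  proof (cases "u = 0")
    case False
    define t where "t = ((x - m) \<bullet> u) / (u \<bullet> u)"
    have uu: "u \<bullet> u > 0" using False by simp
    have "m + t *\<^sub>R u \<in> M" by (intro subspace_add subspace_scale M mM u)
    then have "(norm (x - m))\<^sup>2 \<le> (norm (x - (m + t *\<^sub>R u)))\<^sup>2"
      unfolding nd by (intro power_mono dle d0)
    also have "\<dots> = (norm (x - m))\<^sup>2 - 2 * t * ((x - m) \<bullet> u) + t\<^sup>2 * (u \<bullet> u)"
      unfolding power2_norm_eq_inner by (simp add: algebra_simps inner_commute power2_eq_square)
    also have "\<dots> = (norm (x - m))\<^sup>2 - ((x - m) \<bullet> u)\<^sup>2 / (u \<bullet> u)"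
      using uu by (simp add: t_def field_simps power2_eq_square)
    finally have "((x - m) \<bullet> u)\<^sup>2 / (u \<bullet> u) \<le> 0" by simp
    with uu have "((x - m) \<bullet> u)\<^sup>2 \<le> 0" by (simp add: field_simps)
    then show ?thesis by simp
  qed simp
  with mM show thesis by (rule that)
qed

lemma subspace_dense_of_orthogonal:
  fixes M :: "'h::{real_inner,complete_space} set"
  assumes "subspace M" "closed M" and "\<And>x. (\<And>u. u \<in> M \<Longrightarrow> x \<bullet> u = 0) \<Longrightarrow> x = 0"
  shows "M = UNIV"
proof -
  have "x \<in> M" for x
  proof -
    obtain m where m: "m \<in> M" "\<And>u. u \<in> M \<Longrightarrow> (x - m) \<bullet> u = 0"
      using exists_orthogonal_projection[OF assms(1,2), of x] by blast
    have "x - m = 0" by (rule assms(3)) (rule m(2))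
    with m(1) show ?thesis by simp
  qed
  then show ?thesis by auto
qed

text \<open>
  The vector is a multiple of the component of some \<open>x0\<close>, outside the kernel, that is orthogonal to
  the kernel.
\<close>

lemma Riesz_representation:
  fixes \<phi> :: "'h::{real_inner,complete_space} \<Rightarrow> real"
  assumes "bounded_linear \<phi>"
  shows "\<exists>y. \<forall>x. \<phi> x = x \<bullet> y"
proof (cases "\<forall>x. \<phi> x = 0")
  case False
  interpret bounded_linear \<phi> by fact
  define M where "M = {x. \<phi> x = 0}"
  have M: "subspace M" by (auto simp: M_def subspace_def add scaleR zero)
  have "closed M" unfolding M_def
    by (intro closed_Collect_eq linear_continuous_on assms continuous_on_const)
  from False obtain x0 where x0: "\<phi> x0 \<noteq> 0" by auto
  obtain m where m: "m \<in> M" "\<And>u. u \<in> M \<Longrightarrow> (x0 - m) \<bullet> u = 0"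
    using exists_orthogonal_projection[OF M \<open>closed M\<close>] by blast
  define z where "z = x0 - m"
  have z: "\<phi> z \<noteq> 0" using x0 m(1) by (simp add: z_def diff M_def)
  then have zz: "z \<bullet> z \<noteq> 0" using zero by auto
  have "\<phi> x = x \<bullet> ((\<phi> z / (z \<bullet> z)) *\<^sub>R z)" for x
  proof -
    have "x - (\<phi> x / \<phi> z) *\<^sub>R z \<in> M" using z by (simp add: M_def diff scaleR)
    from m(2)[OF this] have "z \<bullet> x = (\<phi> x / \<phi> z) * (z \<bullet> z)"
      by (simp add: z_def[symmetric] inner_diff_right)
    then show ?thesis using z zz by (simp add: inner_commute field_simps)
  qed
  then show ?thesis by blast
qed (auto intro: exI[of _ 0])

text \<open>
  The adjoint for the real inner product. On complex linear operators it is the usual adjoint,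
  because the real inner product is the real part of the complex one.
\<close>

definition adj :: "('h::{real_inner,complete_space} \<Rightarrow>\<^sub>L 'h) \<Rightarrow> ('h \<Rightarrow>\<^sub>L 'h)" where
  "adj A = Blinfun (adjoint (blinfun_apply A))"

lemma inner_adj: "blinfun_apply A f \<bullet> g = f \<bullet> blinfun_apply (adj A) g"
proof -
  have "\<exists>y. \<forall>f. blinfun_apply A f \<bullet> g = f \<bullet> y" for g
    by (rule Riesz_representation) (intro bounded_linear_intros)
  then have "\<exists>B. \<forall>f g. blinfun_apply A f \<bullet> g = f \<bullet> B g" by metis
  then have B: "blinfun_apply A f \<bullet> g = f \<bullet> adjoint (blinfun_apply A) g" for f g
    unfolding adjoint_def by (rule someI2_ex) auto
  have "bounded_linear (adjoint (blinfun_apply A))"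
  proof (rule bounded_linear_intro)
    fix g h :: 'a and r :: real
    show "adjoint (blinfun_apply A) (g + h) = adjoint (blinfun_apply A) g + adjoint (blinfun_apply A) h"
      by (rule vector_eq_ldot[THEN iffD1]) (simp add: B[symmetric] inner_add_right)
    show "adjoint (blinfun_apply A) (r *\<^sub>R g) = r *\<^sub>R adjoint (blinfun_apply A) g"
      by (rule vector_eq_ldot[THEN iffD1]) (simp add: B[symmetric])
    let ?y = "adjoint (blinfun_apply A) g"
    have "norm ?y * norm ?y = blinfun_apply A ?y \<bullet> g"
      unfolding B by (simp add: norm_eq_sqrt_inner)
    also have "\<dots> \<le> norm (blinfun_apply A ?y) * norm g" by (rule norm_cauchy_schwarz)
    also have "\<dots> \<le> norm A * norm ?y * norm g" by (intro mult_right_mono norm_blinfun) auto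
    finally have "norm ?y * norm ?y \<le> norm ?y * (norm g * norm A)" by (simp add: mult_ac)
    then show "norm ?y \<le> norm g * norm A"
      by (cases "?y = 0") auto
  qed
  then show ?thesis by (simp add: adj_def bounded_linear_Blinfun_apply B)
qed

lemma adj_eqI: "(\<And>f g. blinfun_apply A f \<bullet> g = f \<bullet> blinfun_apply B g) \<Longrightarrow> adj A = B"
  by (rule blinfun_eqI, rule vector_eq_ldot[THEN iffD1]) (simp flip: inner_adj)

lemma adj_adj [simp]: "adj (adj A) = A"
  by (rule adj_eqI) (subst inner_commute, subst inner_adj[symmetric], rule inner_commute)

lemma adj_zero [simp]: "adj 0 = 0"
  by (rule adj_eqI) simp

lemma adj_compose: "adj (A o\<^sub>L B) = adj B o\<^sub>L adj A"
  by (rule adj_eqI) (simp add: inner_adj)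

lemma norm_adj_le: "norm (adj A) \<le> norm A"
proof (rule norm_blinfun_bound)
  fix g
  let ?y = "blinfun_apply (adj A) g"
  have "norm ?y * norm ?y = blinfun_apply A ?y \<bullet> g"
    using inner_adj[of A ?y g] by (simp add: norm_eq_sqrt_inner)
  also have "\<dots> \<le> norm (blinfun_apply A ?y) * norm g" by (rule norm_cauchy_schwarz)
  also have "\<dots> \<le> norm A * norm ?y * norm g" by (intro mult_right_mono norm_blinfun) auto
  finally have "norm ?y * norm ?y \<le> norm ?y * (norm A * norm g)" by (simp add: mult_ac)
  then show "norm ?y \<le> norm A * norm g" by (cases "?y = 0") auto
qed simp

lemma norm_adj [simp]: "norm (adj A) = norm A"
  using norm_adj_le[of A] norm_adj_le[of "adj A"] by simp

section \<open>Bounded complex linear operators\<close>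

lemma scaleC_add_right: "k *\<^sub>C (f + g) = k *\<^sub>C f + k *\<^sub>C g"
  using blinfun.add_right[of "scalar_op k" f g] by (simp add: scalar_op.rep_eq)

lemma scaleC_diff_right: "k *\<^sub>C (f - g) = k *\<^sub>C f - k *\<^sub>C g"
  using blinfun.diff_right[of "scalar_op k" f g] by (simp add: scalar_op.rep_eq)

lemma scaleC_add_left: "(k + l) *\<^sub>C f = k *\<^sub>C f + l *\<^sub>C f"
  by transfer
    (auto simp: L2_rel_def distrib_right simp flip: distrib_right
      intro!: sq_integrable_add sq_integrable_scaleC)

lemma scaleC_scaleC: "k *\<^sub>C l *\<^sub>C f = (k * l) *\<^sub>C f"
  by transfer (auto simp: L2_rel_def mult.assoc intro!: sq_integrable_scaleC)

lemma scaleC_of_real: "of_real r *\<^sub>C f = r *\<^sub>R f"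
  by transfer (auto simp: L2_rel_def scaleR_conv_of_real intro!: sq_integrable_scaleC)

lemma scaleC_simps [simp]: "1 *\<^sub>C f = f" "0 *\<^sub>C f = 0" "k *\<^sub>C 0 = 0"
  using scaleC_of_real[of 1 f] scaleC_of_real[of 0 f] blinfun.zero_right[of "scalar_op k"]
  by (auto simp: scalar_op.rep_eq)

lemma scaleC_uminus_left: "(- k) *\<^sub>C f = - (k *\<^sub>C f)"
  using scaleC_add_left[of "-k" k f] by (simp add: eq_neg_iff_add_eq_0)

lemma scaleC_diff_left: "(k - l) *\<^sub>C f = k *\<^sub>C f - l *\<^sub>C f"
  using scaleC_add_left[of k "-l" f] by (simp add: scaleC_uminus_left)

lemma bounded_bilinear_scaleC: "bounded_bilinear scaleC_L2"
proof
  show "(r *\<^sub>R k) *\<^sub>C f = r *\<^sub>R k *\<^sub>C f" for r k and f :: "'a L2"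
    by (simp add: scaleC_scaleC scaleR_conv_of_real flip: scaleC_of_real)
  show "k *\<^sub>C r *\<^sub>R f = r *\<^sub>R k *\<^sub>C f" for r k and f :: "'a L2"
    by (simp add: scaleC_scaleC mult.commute flip: scaleC_of_real)
  show "\<exists>K. \<forall>k (f :: 'a L2). norm (k *\<^sub>C f) \<le> norm k * norm f * K"
    by (rule exI[of _ 1]) (simp add: norm_scaleC_L2)
qed (rule scaleC_add_left scaleC_add_right)+

lemma inner_scaleC_left: "(k *\<^sub>C f) \<bullet> g = f \<bullet> (cnj k *\<^sub>C g)"
proof transfer
  fix k :: complex and f g :: "'a \<Rightarrow> complex"
  have "(k * u) \<bullet> v = u \<bullet> (cnj k * v)" for u v by (simp add: inner_complex_def algebra_simps)
  then show "(\<integral>x. (k * f x) \<bullet> g x \<partial>lebesgue) = (\<integral>x. f x \<bullet> (cnj k * g x) \<partial>lebesgue)" by simp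
qed

lemma scalar_op_apply [simp]: "blinfun_apply (scalar_op k) f = k *\<^sub>C f"
  by (simp add: scalar_op.rep_eq)

lemma bounded_opsD: "A \<in> bounded_ops \<Longrightarrow> blinfun_apply A (k *\<^sub>C f) = k *\<^sub>C blinfun_apply A f"
  by (simp add: bounded_ops_def)

lemma bounded_opsI:
  "(\<And>k f. blinfun_apply A (k *\<^sub>C f) = k *\<^sub>C blinfun_apply A f) \<Longrightarrow> A \<in> bounded_ops"
  by (simp add: bounded_ops_def)

lemma bounded_ops_intros [intro]:
  "0 \<in> bounded_ops" "id_blinfun \<in> bounded_ops" "scalar_op k \<in> bounded_ops"
  "A \<in> bounded_ops \<Longrightarrow> B \<in> bounded_ops \<Longrightarrow> A + B \<in> bounded_ops"
  "A \<in> bounded_ops \<Longrightarrow> B \<in> bounded_ops \<Longrightarrow> A - B \<in> bounded_ops"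
  "A \<in> bounded_ops \<Longrightarrow> - A \<in> bounded_ops"
  "A \<in> bounded_ops \<Longrightarrow> B \<in> bounded_ops \<Longrightarrow> A o\<^sub>L B \<in> bounded_ops"
  "A \<in> bounded_ops \<Longrightarrow> r *\<^sub>R A \<in> bounded_ops"
  "A \<in> bounded_ops \<Longrightarrow> adj A \<in> bounded_ops"
proof -
  assume A: "A \<in> bounded_ops"
  show "- A \<in> bounded_ops" using A by (auto simp: bounded_ops_def blinfun.bilinear_simps simp flip: scaleC_uminus_left)
      (metis mult_minus1 mult_minus1_right scaleC_scaleC scaleC_simps(1) scaleC_uminus_left)
  show "r *\<^sub>R A \<in> bounded_ops" 
    using A by (simp add: bounded_ops_def blinfun.bilinear_simps scaleC_scaleC mult.commute flip: scaleC_of_real)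
  show "adj A \<in> bounded_ops"
  proof (rule bounded_opsI)
    fix k f
    have "g \<bullet> blinfun_apply (adj A) (k *\<^sub>C f) = g \<bullet> (k *\<^sub>C blinfun_apply (adj A) f)" for g
    proof -
      have "g \<bullet> blinfun_apply (adj A) (k *\<^sub>C f) = blinfun_apply A (cnj k *\<^sub>C g) \<bullet> f"
        using inner_scaleC_left[of "cnj k" "blinfun_apply A g" f]
        by (simp add: inner_adj[symmetric] bounded_opsD[OF A])
      also have "\<dots> = g \<bullet> (k *\<^sub>C blinfun_apply (adj A) f)"
        by (simp add: inner_adj inner_scaleC_left)
      finally show ?thesis .
    qed
    then show "blinfun_apply (adj A) (k *\<^sub>C f) = k *\<^sub>C blinfun_apply (adj A) f"
      by (rule vector_eq_ldot[THEN iffD1, OF allI])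
  qed
qed (auto simp: bounded_ops_def blinfun.bilinear_simps scaleC_add_right scaleC_diff_right scaleC_scaleC mult.commute)

lemma scalar_op_commute: "A \<in> bounded_ops \<Longrightarrow> A o\<^sub>L scalar_op k = scalar_op k o\<^sub>L A"
  by (rule blinfun_eqI) (simp add: bounded_opsD)

lemma scalar_op_of_real: "scalar_op (of_real r) = r *\<^sub>R id_blinfun"
  by (rule blinfun_eqI) (simp add: scaleC_of_real blinfun.bilinear_simps)

lemma closed_bounded_ops: "closed (bounded_ops :: 'a::euclidean_space op set)"
proof -
  have eq: "bounded_ops = (\<Inter>k. \<Inter>f. {A :: 'a op. blinfun_apply A (k *\<^sub>C f) = k *\<^sub>C blinfun_apply A f})"
    by (auto simp: bounded_ops_def)
  have "closed {A :: 'a op. blinfun_apply A (k *\<^sub>C f) = k *\<^sub>C blinfun_apply A f}" for k f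
    by (intro closed_Collect_eq continuous_intros
        bounded_linear.continuous_on[OF bounded_bilinear.bounded_linear_right[OF bounded_bilinear_scaleC]])
  then show ?thesis unfolding eq by (intro closed_INT ballI)
qed

section \<open>Neumann series in closed subalgebras\<close>

lemma blinfun_compose_diff_left: "(A - B) o\<^sub>L C = (A o\<^sub>L C) - (B o\<^sub>L C)"
  by (rule blinfun_eqI) (simp add: blinfun.bilinear_simps)
lemma blinfun_compose_diff_right: "A o\<^sub>L (B - C) = (A o\<^sub>L B) - (A o\<^sub>L C)"
  by (rule blinfun_eqI) (simp add: blinfun.bilinear_simps)
lemma blinfun_compose_add_left: "(A + B) o\<^sub>L C = (A o\<^sub>L C) + (B o\<^sub>L C)"
  by (rule blinfun_eqI) (simp add: blinfun.bilinear_simps)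
lemma blinfun_compose_add_right: "A o\<^sub>L (B + C) = (A o\<^sub>L B) + (A o\<^sub>L C)"
  by (rule blinfun_eqI) (simp add: blinfun.bilinear_simps)
lemma blinfun_compose_scaleR_left: "(r *\<^sub>R A) o\<^sub>L B = r *\<^sub>R (A o\<^sub>L B)"
  by (rule blinfun_eqI) (simp add: blinfun.bilinear_simps)
lemma blinfun_compose_scaleR_right: "A o\<^sub>L (r *\<^sub>R B) = r *\<^sub>R (A o\<^sub>L B)"
  by (rule blinfun_eqI) (simp add: blinfun.bilinear_simps)
lemma blinfun_compose_id [simp]: "id_blinfun o\<^sub>L A = A" "A o\<^sub>L id_blinfun = A"
  by (rule blinfun_eqI, simp)+
lemma blinfun_compose_assoc: "(A o\<^sub>L B) o\<^sub>L C = A o\<^sub>L (B o\<^sub>L C)"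
  by (rule blinfun_eqI) simp
lemma blinfun_compose_uminus_left: "(- A) o\<^sub>L B = - (A o\<^sub>L B)"
  by (rule blinfun_eqI) (simp add: blinfun.bilinear_simps)
lemma blinfun_compose_uminus_right: "A o\<^sub>L (- B) = - (A o\<^sub>L B)"
  by (rule blinfun_eqI) (simp add: blinfun.bilinear_simps)

lemmas compose_distribs = blinfun_compose_diff_left blinfun_compose_diff_right
  blinfun_compose_add_left blinfun_compose_add_right
  blinfun_compose_scaleR_left blinfun_compose_scaleR_right
  blinfun_compose_uminus_left blinfun_compose_uminus_right

text \<open>
  Real scalars are enough for Neumann series and lower bounds. This lets the notion cover the
  operators that leave a real subspace invariant as well as the complex algebras.
\<close>

definition closed_subalgebra :: "('h::real_normed_vector \<Rightarrow>\<^sub>L 'h) set \<Rightarrow> bool" where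
  "closed_subalgebra C \<longleftrightarrow> closed C \<and> subspace C \<and> id_blinfun \<in> C \<and> (\<forall>A\<in>C. \<forall>B\<in>C. A o\<^sub>L B \<in> C)"

lemma closed_subalgebraD:
  assumes "closed_subalgebra C"
  shows "closed C" "0 \<in> C" "id_blinfun \<in> C" "A \<in> C \<Longrightarrow> B \<in> C \<Longrightarrow> A o\<^sub>L B \<in> C"
    "A \<in> C \<Longrightarrow> B \<in> C \<Longrightarrow> A + B \<in> C" "A \<in> C \<Longrightarrow> B \<in> C \<Longrightarrow> A - B \<in> C" "A \<in> C \<Longrightarrow> r *\<^sub>R A \<in> C"
    "A \<in> C \<Longrightarrow> - A \<in> C"
  using assms
  by (auto simp: closed_subalgebra_def subspace_0 subspace_add subspace_diff subspace_scale subspace_neg)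

text \<open>
  The partial sums of the geometric series lie in the closed set \<open>C\<close>, so the inverse does not leave
  it. Different choices of \<open>C\<close> give different properties of the same inverse.
\<close>

lemma Neumann_inverse:
  fixes E :: "'h::banach \<Rightarrow>\<^sub>L 'h"
  assumes C: "closed_subalgebra C" and E: "E \<in> C" "norm E < 1"
  shows "\<exists>D\<in>C. D o\<^sub>L (id_blinfun - E) = id_blinfun \<and> (id_blinfun - E) o\<^sub>L D = id_blinfun"
proof -
  define P where "P n = ((\<lambda>A. E o\<^sub>L A) ^^ n) id_blinfun" for n
  have P_Suc: "P (Suc n) = E o\<^sub>L P n" and P_0: "P 0 = id_blinfun" for n by (simp_all add: P_def)
  have P_comm: "E o\<^sub>L P n = P n o\<^sub>L E" for n
  proof (induction n)
    case (Suc n)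
    have "E o\<^sub>L P (Suc n) = E o\<^sub>L (P n o\<^sub>L E)" by (simp add: P_Suc Suc)
    then show ?case by (simp add: P_Suc blinfun_compose_assoc)
  qed (simp add: P_0)
  have PC: "P n \<in> C" for n
    by (induction n) (simp_all add: P_0 P_Suc closed_subalgebraD[OF C] E)
  have nP: "norm (P (Suc n)) \<le> norm E ^ (Suc n)" for n
  proof (induction n)
    case (Suc n)
    have "norm (P (Suc (Suc n))) \<le> norm E * norm (P (Suc n))"
      unfolding P_Suc[of "Suc n"] by (rule norm_blinfun_compose)
    also have "\<dots> \<le> norm E * norm E ^ Suc n" by (intro mult_left_mono Suc) auto
    finally show ?case by simp
  qed (simp add: P_0 P_Suc)
  have sm: "summable P"
  proof (rule summable_comparison_test)
    show "\<exists>N. \<forall>n\<ge>N. norm (P n) \<le> norm E ^ n"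
      by (rule exI[of _ 1]) (metis nP Suc_le_D One_nat_def)
    show "summable (\<lambda>n. norm E ^ n)" using E(2) by (intro summable_geometric) simp
  qed
  define D where "D = suminf P"
  have "D \<in> C"
  proof (rule closed_sequentially[OF closed_subalgebraD(1)[OF C]])
    show "(\<lambda>n. \<Sum>i<n. P i) \<longlonglongrightarrow> D" using sm by (simp add: D_def summable_LIMSEQ)
    show "(\<Sum>i<n. P i) \<in> C" for n
      by (induction n) (auto simp: closed_subalgebraD[OF C] PC)
  qed
  have bl: "bounded_linear (\<lambda>A. E o\<^sub>L A)" and br: "bounded_linear (\<lambda>A. A o\<^sub>L E)"
    by (rule bounded_bilinear.bounded_linear_right[OF bounded_bilinear_blinfun_compose]
        bounded_bilinear.bounded_linear_left[OF bounded_bilinear_blinfun_compose])+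
  have 1: "E o\<^sub>L D = (\<Sum>n. P (Suc n))"
    unfolding D_def by (simp add: bounded_linear.suminf[OF bl sm] P_Suc)
  have 2: "D o\<^sub>L E = (\<Sum>n. P (Suc n))"
    unfolding D_def by (simp add: bounded_linear.suminf[OF br sm] P_Suc P_comm)
  have 3: "(\<Sum>n. P (Suc n)) = D - id_blinfun"
    unfolding D_def by (simp add: suminf_split_head[OF sm] P_0)
  show ?thesis
    using \<open>D \<in> C\<close> by (intro bexI[of _ D]) (simp_all add: compose_distribs 1 2 3)
qed

text \<open>
  Closed subalgebras that are stable under adjoints contain the inverses of their elements, even
  relative inverses. If \<open>B\<close> is bounded below up to a correction by \<open>K\<close>, then
  \<open>Q = B\<^sup>* B + K\<^sup>* K\<close> is bounded below, so \<open>1 - t Q\<close> has norm less than one for small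
  \<open>t > 0\<close> and the Neumann series puts \<open>Q\<close>'s inverse into the algebra. The inverse applied to \<open>B\<^sup>*\<close>
  then inverts \<open>B\<close> from the left up to a multiple of \<open>K\<close>.
\<close>

lemma left_parametrix_in_subalgebra:
  fixes B :: "'h::{real_inner,banach} \<Rightarrow>\<^sub>L 'h"
  assumes A: "closed_subalgebra \<A>" and A_adj: "\<And>T. T \<in> \<A> \<Longrightarrow> adj T \<in> \<A>"
    and B: "B \<in> \<A>" and K: "K \<in> \<A>"
    and b: "b > 0" "\<And>f. norm f \<le> b * (norm (blinfun_apply B f) + norm (blinfun_apply K f))"
  shows "\<exists>L\<in>\<A>. \<exists>M\<in>\<A>. L o\<^sub>L B = id_blinfun - (M o\<^sub>L K)"
proof -
  note alg = closed_subalgebraD[OF A]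
  define Q where "Q = (adj B o\<^sub>L B) + (adj K o\<^sub>L K)"
  have Q: "Q \<in> \<A>" unfolding Q_def by (intro alg A_adj B K)
  have low: "(norm f)\<^sup>2 \<le> 2 * b\<^sup>2 * (f \<bullet> blinfun_apply Q f)" for f
  proof -
    have "norm f \<le> b * (norm (blinfun_apply B f) + norm (blinfun_apply K f))" by (rule b(2))
    then have "(norm f)\<^sup>2 \<le> b\<^sup>2 * (norm (blinfun_apply B f) + norm (blinfun_apply K f))\<^sup>2"
      by (subst power_mult_distrib[symmetric], intro power_mono) auto
    also have "\<dots> \<le> b\<^sup>2 * (2 * ((norm (blinfun_apply B f))\<^sup>2 + (norm (blinfun_apply K f))\<^sup>2))"
      using sum_squares_bound[of "norm (blinfun_apply B f)" "norm (blinfun_apply K f)"]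
      by (intro mult_left_mono) (auto simp: power2_sum)
    also have "(norm (blinfun_apply B f))\<^sup>2 + (norm (blinfun_apply K f))\<^sup>2 = f \<bullet> blinfun_apply Q f"
      by (simp add: Q_def blinfun.bilinear_simps inner_add_right inner_adj[symmetric] power2_norm_eq_inner)
    finally show ?thesis by (simp add: mult_ac)
  qed
  \<comment> \<open>for small \<open>t > 0\<close> the lower bound on \<open>Q\<close> beats the quadratic term \<open>t\<^sup>2 \<parallel>Q f\<parallel>\<^sup>2\<close>\<close>
  define e where "e = 1 / (2 * b\<^sup>2)"
  have e: "e > 0" using b(1) by (simp add: e_def)
  have low': "e * (norm f)\<^sup>2 \<le> f \<bullet> blinfun_apply Q f" for f
    using low[of f] b(1) by (simp add: e_def field_simps)
  define q where "q = norm Q + e"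
  have q: "q > 0" "norm Q \<le> q" "e \<le> q" using e by (auto simp: q_def add_nonneg_pos)
  define t where "t = e / q\<^sup>2"
  have t: "t > 0" using e q by (simp add: t_def)
  have te: "t * e \<le> 1"
  proof -
    have "e * e \<le> q * q" using e q by (intro mult_mono) auto
    then show ?thesis using q by (simp add: t_def power2_eq_square field_simps)
  qed
  define E where "E = id_blinfun - t *\<^sub>R Q"
  have nE: "norm E \<le> sqrt (1 - t * e)"
  proof (rule norm_blinfun_bound)
    fix f
    have nQ: "(norm (blinfun_apply Q f))\<^sup>2 \<le> q\<^sup>2 * (norm f)\<^sup>2"
    proof -
      have "norm (blinfun_apply Q f) \<le> q * norm f"
        using norm_blinfun[of Q f] mult_right_mono[OF q(2) norm_ge_zero[of f]] by linarith
      then show ?thesis by (subst power_mult_distrib[symmetric], intro power_mono) auto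
    qed
    have "(norm (blinfun_apply E f))\<^sup>2
        = (norm f)\<^sup>2 - 2 * t * (f \<bullet> blinfun_apply Q f) + t\<^sup>2 * (norm (blinfun_apply Q f))\<^sup>2"
      unfolding E_def power2_norm_eq_inner
      by (simp add: blinfun.bilinear_simps inner_diff_left inner_diff_right inner_commute power2_eq_square algebra_simps)
    also have "\<dots> \<le> (norm f)\<^sup>2 - 2 * t * (e * (norm f)\<^sup>2) + t\<^sup>2 * (q\<^sup>2 * (norm f)\<^sup>2)"
      using t low'[of f] nQ by (intro add_mono diff_mono mult_left_mono) auto
    also have "\<dots> = (1 - t * e) * (norm f)\<^sup>2"
      using q by (simp add: t_def field_simps power2_eq_square)
    finally have "norm (blinfun_apply E f) \<le> sqrt ((1 - t * e) * (norm f)\<^sup>2)"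
      by (rule real_le_rsqrt)
    then show "norm (blinfun_apply E f) \<le> sqrt (1 - t * e) * norm f"
      by (simp add: real_sqrt_mult)
  qed (use te in simp)
  also have "\<dots> < 1" using t e te by (simp add: real_sqrt_lt_1_iff)
  finally have E1: "norm E < 1" .
  have EA: "E \<in> \<A>" unfolding E_def by (intro alg Q)
  from Neumann_inverse[OF A EA E1] obtain D where D: "D \<in> \<A>" "D o\<^sub>L (id_blinfun - E) = id_blinfun"
    by blast
  then have DQ: "(t *\<^sub>R D) o\<^sub>L Q = id_blinfun"
    by (simp add: E_def compose_distribs)
  have "((t *\<^sub>R D) o\<^sub>L adj B) o\<^sub>L B = id_blinfun - (((t *\<^sub>R D) o\<^sub>L adj K) o\<^sub>L K)"
    using DQ by (simp add: Q_def compose_distribs blinfun_compose_assoc eq_diff_eq)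
  moreover have "(t *\<^sub>R D) o\<^sub>L adj B \<in> \<A>" "(t *\<^sub>R D) o\<^sub>L adj K \<in> \<A>"
    by (intro alg A_adj B K D)+
  ultimately show ?thesis by blast
qed

section \<open>Translations and spatial projections\<close>

lemma translation_measurable_lebesgue:
  fixes y :: "'a::euclidean_space"
  shows "(\<lambda>x. x - y) \<in> lebesgue \<rightarrow>\<^sub>M lebesgue"
  using lebesgue_affine_measurable[where c = "\<lambda>_::'a. 1" and t = "-y"]
  by (simp add: euclidean_representation add.commute)

lemma distr_lebesgue_translation:
  fixes y :: "'a::euclidean_space"
  shows "distr lebesgue lebesgue (\<lambda>x. x - y) = lebesgue"
proof -
  have "lebesgue = density (distr lebesgue lebesgue (\<lambda>x::'a. -y + (\<Sum>j\<in>Basis. (1 * (x \<bullet> j)) *\<^sub>R j))) (\<lambda>_. ennreal (\<Prod>j\<in>(Basis::'a set). \<bar>1\<bar>))"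
    by (rule lebesgue_affine_euclidean[where c = "\<lambda>_. 1" and t = "-y"]) simp
  then show ?thesis by (simp add: euclidean_representation density_1)
qed

lemma AE_translation: "AE x in lebesgue. P x \<Longrightarrow> AE x in lebesgue. P (x - y)"
  for y :: "'a::euclidean_space"
  by (rule AE_distrD[OF translation_measurable_lebesgue[of y]]) (simp only: distr_lebesgue_translation)

lemma integral_translation:
  fixes f :: "'a::euclidean_space \<Rightarrow> real"
  assumes [measurable]: "f \<in> borel_measurable lebesgue"
  shows "(\<integral>x. f (x - y) \<partial>lebesgue) = (\<integral>x. f x \<partial>lebesgue)"
  using integral_distr[OF translation_measurable_lebesgue[of y] assms]
  by (simp add: distr_lebesgue_translation)

lemma integrable_translation:
  fixes f :: "'a::euclidean_space \<Rightarrow> real"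
  assumes "integrable lebesgue f"
  shows "integrable lebesgue (\<lambda>x. f (x - y))"
  using integrable_distr[OF translation_measurable_lebesgue[of y], of f] assms
  by (simp add: distr_lebesgue_translation)

lemma sq_integrable_translation:
  assumes "sq_integrable f"
  shows "sq_integrable (\<lambda>x. f (x - y))"
  using assms measurable_compose[OF translation_measurable_lebesgue[of y], of f borel]
    integrable_translation[of "\<lambda>x. (norm (f x))\<^sup>2" y]
  by (simp add: sq_integrable_def)

lift_definition translate_L2 :: "'a::euclidean_space \<Rightarrow> 'a L2 \<Rightarrow> 'a L2" is "\<lambda>y f x. f (x - y)"
proof -
  fix y and f g :: "'a \<Rightarrow> complex" assume "L2_rel f g"
  then show "L2_rel (\<lambda>x. f (x - y)) (\<lambda>x. g (x - y))"
    using AE_translation[of "\<lambda>x. f x = g x" y] by (simp add: L2_rel_def sq_integrable_translation)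
qed

lemma translate_L2_of: "sq_integrable f \<Longrightarrow> translate_L2 y (L2_of f) = L2_of (\<lambda>x. f (x - y))"
  by transfer (auto simp: L2_rel_def intro: sq_integrable_translation)

lemma inner_translate: "translate_L2 y f \<bullet> translate_L2 y g = f \<bullet> g"
proof -
  let ?f = "rep_L2 f" and ?g = "rep_L2 g"
  have "L2_of (\<lambda>x. ?f (x - y)) \<bullet> L2_of (\<lambda>x. ?g (x - y)) = (\<integral>x. ?f (x - y) \<bullet> ?g (x - y) \<partial>lebesgue)"
    by (intro inner_L2_of sq_integrable_translation sq_integrable_rep_L2)
  also have "\<dots> = (\<integral>x. ?f x \<bullet> ?g x \<partial>lebesgue)"
    by (rule integral_translation[of "\<lambda>x. ?f x \<bullet> ?g x"]) measurable
  also have "\<dots> = L2_of ?f \<bullet> L2_of ?g"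
    by (intro inner_L2_of[symmetric] sq_integrable_rep_L2)
  finally show ?thesis
    by (simp add: translate_L2_of[symmetric] sq_integrable_rep_L2 L2_of_rep_L2)
qed

lift_definition shift :: "'a::euclidean_space \<Rightarrow> 'a op" is translate_L2
proof (rule bounded_linear_intro)
  fix y :: 'a and f g :: "'a L2" and r :: real
  show "translate_L2 y (f + g) = translate_L2 y f + translate_L2 y g"
    by transfer (auto simp: L2_rel_def intro!: sq_integrable_add sq_integrable_translation)
  show "translate_L2 y (r *\<^sub>R f) = r *\<^sub>R translate_L2 y f"
    by transfer (auto simp: L2_rel_def scaleR_conv_of_real intro!: sq_integrable_translation sq_integrable_scaleC)
  show "norm (translate_L2 y f) \<le> norm f * 1"
    by (simp add: norm_eq_sqrt_inner inner_translate)
qed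

lemma shift_L2_of: "sq_integrable f \<Longrightarrow> blinfun_apply (shift y) (L2_of f) = L2_of (\<lambda>x. f (x - y))"
  by (simp add: shift.rep_eq translate_L2_of)

lemma rep_shift: "AE x in lebesgue. rep_L2 (blinfun_apply (shift y) f) x = rep_L2 f (x - y)"
  using rep_L2_of[OF sq_integrable_translation[where y = y, OF sq_integrable_rep_L2[of f]]]
  by (simp add: shift_L2_of[symmetric] sq_integrable_rep_L2 L2_of_rep_L2)

lemma inner_shift: "blinfun_apply (shift y) f \<bullet> blinfun_apply (shift y) g = f \<bullet> g"
  by (simp add: shift.rep_eq inner_translate)

lemma norm_shift_apply [simp]: "norm (blinfun_apply (shift y) f) = norm f"
  by (simp add: norm_eq_sqrt_inner inner_shift)

lemma shift_shift_apply: "blinfun_apply (shift y) (blinfun_apply (shift z) f) = blinfun_apply (shift (y + z)) f"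
proof -
  have "blinfun_apply (shift y) (blinfun_apply (shift z) (L2_of (rep_L2 f))) = blinfun_apply (shift (y + z)) (L2_of (rep_L2 f))"
    by (simp add: shift_L2_of sq_integrable_rep_L2 sq_integrable_translation algebra_simps)
  then show ?thesis by (simp add: L2_of_rep_L2)
qed

lemma shift_compose: "shift y o\<^sub>L shift z = shift (y + z)"
  by (rule blinfun_eqI) (simp add: shift_shift_apply)

lemma shift_0 [simp]: "shift 0 = id_blinfun"
proof (rule blinfun_eqI)
  fix f :: "'a L2"
  have "blinfun_apply (shift 0) (L2_of (rep_L2 f)) = L2_of (rep_L2 f)"
    by (simp add: shift_L2_of sq_integrable_rep_L2)
  then show "blinfun_apply (shift 0) f = blinfun_apply id_blinfun f" by (simp add: L2_of_rep_L2)
qed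

lemma shift_bounded_ops [intro]: "shift y \<in> bounded_ops"
proof (rule bounded_opsI)
  fix k f
  have "blinfun_apply (shift y) (k *\<^sub>C L2_of (rep_L2 f)) = k *\<^sub>C blinfun_apply (shift y) (L2_of (rep_L2 f))"
    by (simp add: shift_L2_of L2_of_scaleC[symmetric] sq_integrable_rep_L2 sq_integrable_translation sq_integrable_scaleC)
  then show "blinfun_apply (shift y) (k *\<^sub>C f) = k *\<^sub>C blinfun_apply (shift y) f"
    by (simp add: L2_of_rep_L2)
qed

lemma sq_integrable_indicator:
  assumes "sq_integrable f" "E \<in> sets lebesgue"
  shows "sq_integrable (\<lambda>x. indicator E x * f x)"
  using sq_integrable_restrict[OF assms(1), of E] assms(2) by simp

lemma proj_L2_of:
  assumes "sq_integrable f" "E \<in> sets lebesgue"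
  shows "blinfun_apply (proj E) (L2_of f) = L2_of (\<lambda>x. indicator E x * f x)"
proof -
  have "restrict_L2 E (L2_of f) = L2_of (\<lambda>x. if E \<in> sets lebesgue then indicator E x * f x else 0)"
    using assms(1) sq_integrable_restrict[OF assms(1), of E]
    by transfer (simp add: L2_rel_def)
  with assms show ?thesis by (simp add: proj.rep_eq)
qed

lemma rep_proj:
  "E \<in> sets lebesgue \<Longrightarrow> AE x in lebesgue. rep_L2 (blinfun_apply (proj E) f) x = indicator E x * rep_L2 f x"
  using rep_L2_of[OF sq_integrable_indicator[OF sq_integrable_rep_L2, of E f]]
  by (simp add: proj_L2_of[symmetric] sq_integrable_rep_L2 L2_of_rep_L2)

lemma proj_nonmeasurable: "E \<notin> sets lebesgue \<Longrightarrow> proj E = 0"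
  by (rule blinfun_eqI) (simp add: proj.rep_eq, transfer, auto simp: L2_rel_def sq_integrable_zero)

lemma op_eqI_L2_of:
  assumes "\<And>f. sq_integrable f \<Longrightarrow> blinfun_apply A (L2_of f) = blinfun_apply B (L2_of f)"
  shows "A = B"
  by (rule blinfun_eqI) (metis assms L2_of_rep_L2 sq_integrable_rep_L2)

lemma proj_proj:
  assumes "E \<in> sets lebesgue" "F \<in> sets lebesgue"
  shows "proj E o\<^sub>L proj F = proj (E \<inter> F)"
  by (rule op_eqI_L2_of)
    (simp add: proj_L2_of assms sq_integrable_indicator sets.Int indicator_inter_arith mult.assoc)

lemma proj_UNIV [simp]: "proj UNIV = id_blinfun"
  by (rule op_eqI_L2_of) (simp add: proj_L2_of)

lemma proj_empty [simp]: "proj {} = 0"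
  by (rule op_eqI_L2_of) (simp add: proj_L2_of L2_of_zero)

lemma proj_disjoint_Un:
  assumes "E \<in> sets lebesgue" "F \<in> sets lebesgue" "E \<inter> F = {}"
  shows "proj (E \<union> F) = proj E + proj F"
proof (rule op_eqI_L2_of)
  fix f :: "'a \<Rightarrow> complex" assume f: "sq_integrable f"
  have "indicator (E \<union> F) x = (indicator E x + indicator F x :: complex)" for x
    using assms(3) by (auto simp: indicator_def)
  then show "blinfun_apply (proj (E \<union> F)) (L2_of f) = blinfun_apply (proj E + proj F) (L2_of f)"
    using f assms
    by (simp add: proj_L2_of sets.Un blinfun.bilinear_simps L2_of_add[symmetric] sq_integrable_indicator distrib_right)
qed

lemma proj_compl:
  assumes "E \<in> sets lebesgue"
  shows "proj (- E) = id_blinfun - proj E"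
  using proj_disjoint_Un[of E "-E"] assms by (auto simp: eq_diff_eq add.commute Compl_in_sets_lebesgue)

lemma proj_mono:
  assumes "E \<in> sets lebesgue" "F \<in> sets lebesgue" "E \<subseteq> F"
  shows "proj E o\<^sub>L proj F = proj E" "proj F o\<^sub>L proj E = proj E"
  using assms by (simp_all add: proj_proj Int_absorb1 Int_absorb2)

lemma proj_bounded_ops [intro]: "proj E \<in> bounded_ops"
proof (cases "E \<in> sets lebesgue")
  case True
  show ?thesis
  proof (rule bounded_opsI)
    fix k f
    have "blinfun_apply (proj E) (k *\<^sub>C L2_of (rep_L2 f)) = k *\<^sub>C blinfun_apply (proj E) (L2_of (rep_L2 f))"
      using True by (simp add: proj_L2_of L2_of_scaleC[symmetric] sq_integrable_rep_L2 sq_integrable_indicator sq_integrable_scaleC mult.left_commute)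
    then show "blinfun_apply (proj E) (k *\<^sub>C f) = k *\<^sub>C blinfun_apply (proj E) f"
      by (simp add: L2_of_rep_L2)
  qed
qed (auto simp: proj_nonmeasurable)

lemma adj_proj [simp]: "adj (proj E) = proj E"
proof (cases "E \<in> sets lebesgue")
  case True
  have "blinfun_apply (proj E) (L2_of (rep_L2 f)) \<bullet> L2_of (rep_L2 g) = L2_of (rep_L2 f) \<bullet> blinfun_apply (proj E) (L2_of (rep_L2 g))" for f g
    using True
    by (simp add: proj_L2_of sq_integrable_rep_L2 inner_L2_of sq_integrable_indicator)
      (rule Bochner_Integration.integral_cong, auto simp: indicator_def)
  then show ?thesis by (intro adj_eqI) (simp add: L2_of_rep_L2)
qed (simp add: proj_nonmeasurable)

lemma norm_proj_apply: "norm (blinfun_apply (proj E) f) \<le> norm f"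
proof (cases "E \<in> sets lebesgue")
  case True
  have "norm (blinfun_apply (proj E) (L2_of (rep_L2 f))) \<le> norm (L2_of (rep_L2 f))"
    unfolding proj_L2_of[OF sq_integrable_rep_L2 True]
    by (rule norm_L2_of_mono[OF sq_integrable_indicator[OF sq_integrable_rep_L2 True] sq_integrable_rep_L2])
      (simp add: indicator_def)
  then show ?thesis by (simp add: L2_of_rep_L2)
qed (simp add: proj_nonmeasurable)

lemma norm_proj_le: "norm (proj E) \<le> 1"
  by (rule norm_blinfun_bound) (auto simp: norm_proj_apply)

lemma measurable_translated_set:
  fixes E :: "'a::euclidean_space set"
  shows "E \<in> sets lebesgue \<Longrightarrow> {x. x + y \<in> E} \<in> sets lebesgue"
  using measurable_sets[OF translation_measurable_lebesgue[of "-y"], of E] by (simp add: vimage_def)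

lemma proj_shift:
  assumes "E \<in> sets lebesgue"
  shows "proj E o\<^sub>L shift y = shift y o\<^sub>L proj {x. x + y \<in> E}"
proof (rule op_eqI_L2_of)
  fix f :: "'a \<Rightarrow> complex" assume "sq_integrable f"
  moreover have "indicator {x. x + y \<in> E} (x - y) = (indicator E x :: complex)" for x
    by (simp add: indicator_def)
  ultimately show "blinfun_apply (proj E o\<^sub>L shift y) (L2_of f) = blinfun_apply (shift y o\<^sub>L proj {x. x + y \<in> E}) (L2_of f)"
    using assms by (simp add: shift_L2_of proj_L2_of sq_integrable_translation measurable_translated_set sq_integrable_indicator)
qed

text \<open>Projections converge strongly when their sets converge pointwise, by dominated convergence.\<close>

lemma proj_tendsto:
  assumes E: "\<And>n::nat. E n \<in> sets lebesgue" "F \<in> sets lebesgue"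
    and lim: "\<And>x. \<forall>\<^sub>F n in sequentially. x \<in> E n \<longleftrightarrow> x \<in> F"
  shows "(\<lambda>n. blinfun_apply (proj (E n)) f) \<longlonglongrightarrow> blinfun_apply (proj F) f"
proof -
  let ?f = "rep_L2 f"
  have "(\<lambda>n. L2_of (\<lambda>x. indicator (E n) x * ?f x)) \<longlonglongrightarrow> L2_of (\<lambda>x. indicator F x * ?f x)"
  proof (rule dominated_convergence_L2)
    show "integrable lebesgue (\<lambda>x. (norm (?f x))\<^sup>2)"
      using sq_integrable_rep_L2[of f] by (simp add: sq_integrable_def)
    show "AE x in lebesgue. (\<lambda>n. indicator (E n) x * ?f x) \<longlonglongrightarrow> indicator F x * ?f x"
    proof (rule AE_I2)
      fix x
      have "\<forall>\<^sub>F n in sequentially. indicator (E n) x * ?f x = indicator F x * ?f x"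
        using lim[of x] by eventually_elim (simp add: indicator_def)
      then show "(\<lambda>n. indicator (E n) x * ?f x) \<longlonglongrightarrow> indicator F x * ?f x"
        by (rule tendsto_eventually)
    qed
    show "AE x in lebesgue. (norm (indicator (E n) x * ?f x - indicator F x * ?f x))\<^sup>2 \<le> (norm (?f x))\<^sup>2" for n
      by (auto simp: indicator_def)
  qed (use E in \<open>auto intro: sq_integrable_indicator sq_integrable_rep_L2\<close>)
  then show ?thesis
    by (simp add: proj_L2_of[symmetric] E sq_integrable_rep_L2 L2_of_rep_L2)
qed

text \<open>
  A countable union is the increasing union of finite ones, for which the claim is additivity of
  projections on disjoint sets; strong convergence of the projections gives the limit.
\<close>

lemma compose_proj_Union_eq_0:
  assumes F: "\<And>F. F \<in> \<F> \<Longrightarrow> F \<in> sets lebesgue" "countable \<F>"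
    and T: "\<And>F. F \<in> \<F> \<Longrightarrow> T o\<^sub>L proj F = 0"
  shows "T o\<^sub>L proj (\<Union>\<F>) = 0"
proof (cases "\<F> = {}")
  case False
  define G where "G n = (\<Union>i<n. from_nat_into \<F> i)" for n
  have GF: "from_nat_into \<F> i \<in> \<F>" for i using False by (rule from_nat_into)
  have G: "G n \<in> sets lebesgue" for n unfolding G_def using F GF by blast
  have TG: "T o\<^sub>L proj (G n) = 0" for n
  proof (induction n)
    case (Suc n)
    let ?F = "from_nat_into \<F> n"
    have "G (Suc n) = G n \<union> (?F \<inter> - G n)" by (auto simp: G_def less_Suc_eq)
    then have "proj (G (Suc n)) = proj (G n) + (proj ?F o\<^sub>L proj (- G n))"
      using G[of n] F(1)[OF GF, of n]
      by (simp add: proj_proj Compl_in_sets_lebesgue) (subst proj_disjoint_Un, auto simp: Compl_in_sets_lebesgue)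
    then show ?case
      using Suc T[OF GF, of n] by (simp add: compose_distribs blinfun_compose_assoc[symmetric])
  qed (simp add: G_def)
  show ?thesis
  proof (rule blinfun_eqI)
    fix f
    have "(\<lambda>n. blinfun_apply (proj (G n)) f) \<longlonglongrightarrow> blinfun_apply (proj (\<Union>\<F>)) f"
    proof (rule proj_tendsto[OF G])
      show "\<Union>\<F> \<in> sets lebesgue" using F by (intro sets.countable_Union) auto
      fix x show "\<forall>\<^sub>F n in sequentially. x \<in> G n \<longleftrightarrow> x \<in> \<Union>\<F>"
      proof (cases "x \<in> \<Union>\<F>")
        case True
        then obtain i where "x \<in> from_nat_into \<F> i"
          using from_nat_into_surj[OF F(2)] by (metis UnionE)
        then have "\<forall>n\<ge>Suc i. x \<in> G n" by (auto simp: G_def intro!: bexI[of _ i])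
        with True show ?thesis by (auto simp: eventually_sequentially)
      next
        case False then show ?thesis using GF by (auto simp: G_def)
      qed
    qed
    then have "(\<lambda>n. blinfun_apply T (blinfun_apply (proj (G n)) f)) \<longlonglongrightarrow> blinfun_apply T (blinfun_apply (proj (\<Union>\<F>)) f)"
      by (rule blinfun.tendsto[OF tendsto_const])
    moreover have "blinfun_apply T (blinfun_apply (proj (G n)) f) = 0" for n
      using arg_cong[OF TG[of n], of "\<lambda>A. blinfun_apply A f"] by simp
    ultimately show "blinfun_apply (T o\<^sub>L proj (\<Union>\<F>)) f = blinfun_apply 0 f"
      by (simp add: LIMSEQ_const_iff)
  qed
qed simp

section \<open>The standard algebra\<close>

lemma adj_eq_0_iff [simp]: "adj A = 0 \<longleftrightarrow> A = 0"
  by (metis adj_adj adj_zero)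

lemma finite_range_opsI:
  assumes "A \<in> bounded_ops"
    and "\<And>a b r s. r > 0 \<Longrightarrow> s > 0 \<Longrightarrow> dist a b > r + s + m \<Longrightarrow> proj (ball a r) o\<^sub>L (A o\<^sub>L proj (ball b s)) = 0"
  shows "A \<in> finite_range_ops m"
  using assms unfolding finite_range_ops_def blinfun_compose_assoc by (force simp: not_less)

lemma finite_range_opsD:
  assumes "A \<in> finite_range_ops m"
  shows "A \<in> bounded_ops"
    and "r > 0 \<Longrightarrow> s > 0 \<Longrightarrow> dist a b > r + s + m \<Longrightarrow> proj (ball a r) o\<^sub>L (A o\<^sub>L proj (ball b s)) = 0"
  using assms unfolding finite_range_ops_def blinfun_compose_assoc by force+

lemma ball_cover:
  fixes E :: "'a::euclidean_space set"
  assumes "\<delta> > 0"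
  obtains \<F> where "countable \<F>" "\<And>F. F \<in> \<F> \<Longrightarrow> \<exists>a\<in>E. F = ball a \<delta>" "E \<subseteq> \<Union>\<F>"
proof -
  obtain \<F> where "\<F> \<subseteq> (\<lambda>a. ball a \<delta>) ` E" "countable \<F>" "\<Union>\<F> = \<Union>((\<lambda>a. ball a \<delta>) ` E)"
    by (rule Lindelof[of "(\<lambda>a. ball a \<delta>) ` E"]) auto
  moreover have "E \<subseteq> \<Union>((\<lambda>a. ball a \<delta>) ` E)" using assms by auto
  ultimately show thesis by (intro that[of \<F>]) auto
qed

text \<open>
  The definition of finite range speaks of balls only. Both sets are covered by countably many balls
  whose radius is paid for by the gap between \<open>m\<close> and \<open>m'\<close>; the balls of \<open>F\<close> are united directly and
  those of \<open>E\<close> after passing to adjoints.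
\<close>

lemma finite_range_separated:
  assumes A: "A \<in> finite_range_ops m" and EF: "E \<in> sets lebesgue" "F \<in> sets lebesgue"
    and m': "m < m'" and sep: "\<And>x y. x \<in> E \<Longrightarrow> y \<in> F \<Longrightarrow> m' \<le> dist x y"
  shows "proj E o\<^sub>L (A o\<^sub>L proj F) = 0"
proof -
  define \<delta> where "\<delta> = (m' - m) / 3"
  have d: "\<delta> > 0" using m' by (simp add: \<delta>_def)
  obtain \<E> where E: "countable \<E>" "\<And>B. B \<in> \<E> \<Longrightarrow> \<exists>a\<in>E. B = ball a \<delta>" "E \<subseteq> \<Union>\<E>" using ball_cover[OF d, of E] by blast
  obtain \<F> where F: "countable \<F>" "\<And>B. B \<in> \<F> \<Longrightarrow> \<exists>a\<in>F. B = ball a \<delta>" "F \<subseteq> \<Union>\<F>" using ball_cover[OF d, of F] by blast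
  have 0: "proj B o\<^sub>L (A o\<^sub>L proj B') = 0" if BB': "B \<in> \<E>" "B' \<in> \<F>" for B B'
  proof -
    obtain a b where ab: "a \<in> E" "b \<in> F" "B = ball a \<delta>" "B' = ball b \<delta>" using E(2)[OF BB'(1)] F(2)[OF BB'(2)] by blast
    have "dist a b > \<delta> + \<delta> + m" using sep[OF ab(1,2)] d by (simp add: \<delta>_def field_simps)
    with ab d show ?thesis by (simp add: finite_range_opsD(2)[OF A])
  qed
  have mE: "B \<in> sets lebesgue" if "B \<in> \<E>" for B using E(2)[OF that] by auto
  have mF: "B \<in> sets lebesgue" if "B \<in> \<F>" for B using F(2)[OF that] by auto
  have "(proj B o\<^sub>L A) o\<^sub>L proj (\<Union>\<F>) = 0" if "B \<in> \<E>" for B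
    by (rule compose_proj_Union_eq_0[OF mF F(1)]) (simp_all add: 0 that blinfun_compose_assoc)
  then have "adj (A o\<^sub>L proj (\<Union>\<F>)) o\<^sub>L proj B = 0" if "B \<in> \<E>" for B
    using that by (subst adj_eq_0_iff[symmetric]) (simp add: adj_compose blinfun_compose_assoc)
  then have "adj (A o\<^sub>L proj (\<Union>\<F>)) o\<^sub>L proj (\<Union>\<E>) = 0"
    by (intro compose_proj_Union_eq_0[OF mE E(1)])
  then have 1: "proj (\<Union>\<E>) o\<^sub>L (A o\<^sub>L proj (\<Union>\<F>)) = 0"
    by (subst (asm) adj_eq_0_iff[symmetric]) (simp add: adj_compose blinfun_compose_assoc)
  have "\<Union>\<E> \<in> sets lebesgue" "\<Union>\<F> \<in> sets lebesgue"
    using mE mF E(1) F(1) by (auto intro!: sets.countable_Union)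
  note mono = proj_mono(1)[OF EF(1) this(1) E(3)] proj_mono(2)[OF EF(2) this(2) F(3)]
  have "proj E o\<^sub>L (A o\<^sub>L proj F) = (proj E o\<^sub>L proj (\<Union>\<E>)) o\<^sub>L (A o\<^sub>L (proj (\<Union>\<F>) o\<^sub>L proj F))"
    by (simp add: mono)
  also have "\<dots> = proj E o\<^sub>L (proj (\<Union>\<E>) o\<^sub>L (A o\<^sub>L proj (\<Union>\<F>))) o\<^sub>L proj F"
    by (simp add: blinfun_compose_assoc)
  finally show ?thesis by (simp add: 1)
qed

lemma finite_range_mono: "m \<le> m' \<Longrightarrow> finite_range_ops m \<subseteq> finite_range_ops m'"
  by (force simp: finite_range_ops_def)

text \<open>
  The space between the two operators is split along a ball \<open>G\<close> around \<open>a\<close>. Its complement is too far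
  from \<open>ball a r\<close> for \<open>A\<close>, and \<open>G\<close> itself is too far from \<open>ball b s\<close> for \<open>B\<close>.
\<close>

lemma finite_range_compose:
  assumes A: "A \<in> finite_range_ops m" and B: "B \<in> finite_range_ops m'"
  shows "A o\<^sub>L B \<in> finite_range_ops (m + m')"
proof (rule finite_range_opsI)
  show "A o\<^sub>L B \<in> bounded_ops" using A B by (auto dest: finite_range_opsD)
  fix a b :: 'a and r s :: real
  assume rs: "r > 0" "s > 0" and far: "dist a b > r + s + (m + m')"
  \<comment> \<open>the surplus distance is shared between both factors, and a third of it remains\<close>
  define \<delta> where "\<delta> = (dist a b - (r + s + (m + m'))) / 3"
  have d: "\<delta> > 0" using far by (simp add: \<delta>_def)
  define G where "G = cball a (r + m + \<delta>)"
  have G: "G \<in> sets lebesgue" "- G \<in> sets lebesgue" by (auto simp: G_def Compl_in_sets_lebesgue)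
  have 1: "proj (ball a r) o\<^sub>L (A o\<^sub>L proj (- G)) = 0"
  proof (rule finite_range_separated[OF A _ G(2), of _ "m + \<delta>"])
    show "m + \<delta> \<le> dist x y" if "x \<in> ball a r" "y \<in> - G" for x y
      using that dist_triangle[of a y x] by (auto simp: G_def)
  qed (use d in auto)
  have 2: "proj G o\<^sub>L (B o\<^sub>L proj (ball b s)) = 0"
  proof (rule finite_range_separated[OF B G(1), of _ "m' + \<delta>"])
    show "m' + \<delta> \<le> dist x y" if "x \<in> G" "y \<in> ball b s" for x y
    proof -
      have "dist a b \<le> dist a x + dist x y + dist y b"
        using dist_triangle[of a b x] dist_triangle[of x b y] by linarith
      moreover have "3 * \<delta> = dist a b - (r + s + (m + m'))" by (simp add: \<delta>_def)
      ultimately show ?thesis using that d by (auto simp: G_def dist_commute)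
    qed
  qed (use d in auto)
  have "proj (ball a r) o\<^sub>L ((A o\<^sub>L B) o\<^sub>L proj (ball b s))
      = ((proj (ball a r) o\<^sub>L (A o\<^sub>L proj (- G))) o\<^sub>L (B o\<^sub>L proj (ball b s)))
        + ((proj (ball a r) o\<^sub>L A) o\<^sub>L (proj G o\<^sub>L (B o\<^sub>L proj (ball b s))))"
    by (simp add: proj_compl[OF G(1)] compose_distribs blinfun_compose_assoc)
  then show "proj (ball a r) o\<^sub>L ((A o\<^sub>L B) o\<^sub>L proj (ball b s)) = 0" by (simp add: 1 2)
qed

lemma finite_range_adj: "A \<in> finite_range_ops m \<Longrightarrow> adj A \<in> finite_range_ops m"
  by (rule finite_range_opsI)
    (auto dest: finite_range_opsD(1), subst adj_eq_0_iff[symmetric],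
      simp add: adj_compose blinfun_compose_assoc finite_range_opsD(2) dist_commute add.commute)

lemma finite_range_add: "A \<in> finite_range_ops m \<Longrightarrow> B \<in> finite_range_ops m \<Longrightarrow> A + B \<in> finite_range_ops m"
  by (rule finite_range_opsI)
    (auto dest: finite_range_opsD(1) simp: compose_distribs finite_range_opsD(2)[of A m] finite_range_opsD(2)[of B m])

lemma finite_range_scalar_mult:
  "A \<in> finite_range_ops m \<Longrightarrow> scalar_op k o\<^sub>L A \<in> finite_range_ops m"
proof (rule finite_range_opsI)
  assume A: "A \<in> finite_range_ops m"
  then show "scalar_op k o\<^sub>L A \<in> bounded_ops" by (auto dest: finite_range_opsD)
  fix a b :: 'a and r s :: real assume "r > 0" "s > 0" "dist a b > r + s + m"
  from finite_range_opsD(2)[OF A this]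
  show "proj (ball a r) o\<^sub>L ((scalar_op k o\<^sub>L A) o\<^sub>L proj (ball b s)) = 0"
    by (simp add: blinfun_compose_assoc[symmetric] scalar_op_commute[OF proj_bounded_ops])
      (simp add: blinfun_compose_assoc)
qed

lemma finite_range_zero: "0 \<in> finite_range_ops m"
  by (rule finite_range_opsI) auto

lemma finite_range_proj: "proj E \<in> finite_range_ops 0"
proof (cases "E \<in> sets lebesgue")
  case True
  show ?thesis
  proof (rule finite_range_opsI)
    fix a b :: 'a and r s :: real assume "r > 0" "s > 0" and far: "dist a b > r + s + 0"
    have "ball a r \<inter> (E \<inter> ball b s) = {}"
    proof -
      have "dist a b < r + s" if "x \<in> ball a r" "x \<in> ball b s" for x
        using that dist_triangle[of a b x] by (auto simp: dist_commute)
      with far show ?thesis by force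
    qed
    with True show "proj (ball a r) o\<^sub>L (proj E o\<^sub>L proj (ball b s)) = 0"
      by (simp add: proj_proj sets.Int)
  qed auto
qed (simp add: proj_nonmeasurable finite_range_zero)

lemma finite_range_id: "id_blinfun \<in> finite_range_ops 0"
  using finite_range_proj[of UNIV] by simp

lemma shift_proj_disjoint:
  assumes "E \<in> sets lebesgue" "F \<in> sets lebesgue" "\<And>x. x + y \<in> E \<Longrightarrow> x \<notin> F"
  shows "proj E o\<^sub>L (shift y o\<^sub>L proj F) = 0"
proof -
  have "{x. x + y \<in> E} \<inter> F = {}" using assms(3) by auto
  then show ?thesis
    using assms by (simp add: blinfun_compose_assoc[symmetric] proj_shift)
      (simp add: blinfun_compose_assoc proj_proj measurable_translated_set)
qed

lemma finite_range_shift: "shift y \<in> finite_range_ops (norm y)"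
proof (rule finite_range_opsI)
  fix a b :: 'a and r s :: real assume rs: "r > 0" "s > 0" and far: "dist a b > r + s + norm y"
  show "proj (ball a r) o\<^sub>L (shift y o\<^sub>L proj (ball b s)) = 0"
  proof (rule shift_proj_disjoint)
    fix x assume "x + y \<in> ball a r"
    then have "dist a b < r + norm y + dist x b"
      using dist_triangle[of a b "x + y"] dist_triangle[of "x + y" b x] by (simp add: dist_norm)
    with far show "x \<notin> ball b s" by (auto simp: dist_commute)
  qed auto
qed auto

lemma finite_range_subset_std_algebra: "A \<in> finite_range_ops m \<Longrightarrow> A \<in> std_algebra"
  using finite_range_mono[of m "max m 0"]
  by (auto simp: std_algebra_def intro!: closure_subset[THEN subsetD] bexI[of _ "max m 0"])

lemma std_algebra_bounded: "A \<in> std_algebra \<Longrightarrow> A \<in> bounded_ops"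
proof -
  have "(\<Union>m\<in>{0..}. finite_range_ops m) \<subseteq> (bounded_ops :: 'a op set)" by (auto dest: finite_range_opsD)
  then have "std_algebra \<subseteq> (bounded_ops :: 'a op set)"
    unfolding std_algebra_def by (rule closure_minimal) (rule closed_bounded_ops)
  then show "A \<in> std_algebra \<Longrightarrow> A \<in> bounded_ops" for A :: "'a op" by auto
qed

lemma closure_mapI:
  fixes f :: "'b::real_normed_vector \<Rightarrow> 'c::real_normed_vector"
  assumes "bounded_linear f" "\<And>x. x \<in> S \<Longrightarrow> f x \<in> T" "x \<in> closure S"
  shows "f x \<in> closure T"
proof -
  obtain X where X: "\<And>n. X n \<in> S" "X \<longlonglongrightarrow> x" using assms(3) by (auto simp: closure_sequential)
  have "(\<lambda>n. f (X n)) \<longlonglongrightarrow> f x" by (rule bounded_linear.tendsto[OF assms(1) X(2)])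
  then show ?thesis
    using assms(2) X(1) unfolding closure_sequential by (intro exI[of _ "\<lambda>n. f (X n)"]) auto
qed

lemma closure_composeI:
  fixes A :: "'b::real_normed_vector \<Rightarrow>\<^sub>L 'c::real_normed_vector" and B :: "'d::real_normed_vector \<Rightarrow>\<^sub>L 'b"
  assumes "\<And>A B. A \<in> S \<Longrightarrow> B \<in> T \<Longrightarrow> A o\<^sub>L B \<in> closure U" "A \<in> closure S" "B \<in> closure T"
  shows "A o\<^sub>L B \<in> closure U"
proof -
  obtain X where X: "\<And>n. X n \<in> S" "X \<longlonglongrightarrow> A" using assms(2) by (auto simp: closure_sequential)
  obtain Y where Y: "\<And>n. Y n \<in> T" "Y \<longlonglongrightarrow> B" using assms(3) by (auto simp: closure_sequential)
  have "(\<lambda>n. X n o\<^sub>L Y n) \<longlonglongrightarrow> (A o\<^sub>L B)"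
    by (rule bounded_bilinear.tendsto[OF bounded_bilinear_blinfun_compose X(2) Y(2)])
  then show ?thesis
    by (rule closed_sequentially[OF closed_closure, rotated]) (use assms(1) X(1) Y(1) in auto)
qed

lemma bounded_linear_adj: "bounded_linear (adj :: ('h::{real_inner,complete_space} \<Rightarrow>\<^sub>L 'h) \<Rightarrow> _)"
proof (rule bounded_linear_intro[where K = 1])
  show "adj (A + B) = adj A + adj B" for A B :: "'h \<Rightarrow>\<^sub>L 'h"
    by (rule adj_eqI) (simp add: inner_adj blinfun.bilinear_simps inner_add_left inner_add_right)
  show "adj (r *\<^sub>R A) = r *\<^sub>R adj A" for r and A :: "'h \<Rightarrow>\<^sub>L 'h"
    by (rule adj_eqI) (simp add: inner_adj blinfun.bilinear_simps)
qed simp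

lemma std_algebra_adj: "A \<in> std_algebra \<Longrightarrow> adj A \<in> std_algebra"
  unfolding std_algebra_def by (erule closure_mapI[OF bounded_linear_adj, rotated]) (auto intro: finite_range_adj)

lemma std_algebra_scalar_mult: "A \<in> std_algebra \<Longrightarrow> scalar_op k o\<^sub>L A \<in> std_algebra"
  unfolding std_algebra_def
  by (erule closure_mapI[OF bounded_bilinear.bounded_linear_right[OF bounded_bilinear_blinfun_compose], rotated])
    (auto intro: finite_range_scalar_mult)

lemma subspace_closure:
  fixes S :: "'b::real_normed_vector set"
  assumes S: "subspace S"
  shows "subspace (closure S)"
  unfolding subspace_def
proof (intro conjI ballI allI)
  show "0 \<in> closure S" using subspace_0[OF S] closure_subset by auto
  show "r *\<^sub>R x \<in> closure S" if "x \<in> closure S" for r x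
    by (rule closure_mapI[OF bounded_linear_scaleR_right _ that]) (rule subspace_scale[OF S])
  fix x y assume "x \<in> closure S" "y \<in> closure S"
  then obtain X Y where "\<And>n. X n \<in> S" "X \<longlonglongrightarrow> x" "\<And>n. Y n \<in> S" "Y \<longlonglongrightarrow> y"
    by (auto simp: closure_sequential)
  then show "x + y \<in> closure S"
    unfolding closure_sequential
    by (intro exI[of _ "\<lambda>n. X n + Y n"]) (auto intro: tendsto_add subspace_add[OF S])
qed

lemma closed_subalgebra_std_algebra: "closed_subalgebra (std_algebra :: 'a::euclidean_space op set)"
  unfolding closed_subalgebra_def
proof (intro conjI ballI)
  let ?F = "\<Union>m\<in>{0..}. finite_range_ops m :: 'a op set"
  show "closed (std_algebra :: 'a op set)" by (simp add: std_algebra_def)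
  show "subspace (std_algebra :: 'a op set)"
    unfolding std_algebra_def
  proof (rule subspace_closure, unfold subspace_def, intro conjI ballI allI)
    show "0 \<in> ?F" using finite_range_zero by auto
    fix A B assume "A \<in> ?F" "B \<in> ?F"
    then obtain m m' where m: "A \<in> finite_range_ops m" "B \<in> finite_range_ops m'" "0 \<le> m" "0 \<le> m'" by auto
    then have "A + B \<in> finite_range_ops (max m m')"
      by (meson finite_range_add finite_range_mono max.cobounded1 max.cobounded2 subsetD)
    with m show "A + B \<in> ?F" by (auto intro!: bexI[of _ "max m m'"])
  next
    fix r A assume "A \<in> ?F"
    then show "r *\<^sub>R A \<in> ?F"
      using finite_range_scalar_mult[of A _ "of_real r"] by (auto simp: scalar_op_of_real compose_distribs)
  qed
  show "id_blinfun \<in> (std_algebra :: 'a op set)" using finite_range_id by (rule finite_range_subset_std_algebra)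
  fix A B :: "'a op" assume "A \<in> std_algebra" "B \<in> std_algebra"
  then show "A o\<^sub>L B \<in> std_algebra"
    unfolding std_algebra_def
  proof (rule closure_composeI[rotated])
    fix A B assume "A \<in> ?F" "B \<in> ?F"
    then show "A o\<^sub>L B \<in> closure ?F"
      using finite_range_compose finite_range_subset_std_algebra unfolding std_algebra_def by blast
  qed
qed

lemmas std_algebraD = closed_subalgebraD[OF closed_subalgebra_std_algebra]

lemma std_algebra_scalar_op: "scalar_op k \<in> std_algebra"
  using std_algebra_scalar_mult[OF std_algebraD(3), of k] by simp

section \<open>The ideal of a set\<close>

lemma nbhd_measurable: "nbhd S r \<in> sets lebesgue"
proof -
  have "open (nbhd S r)"
    unfolding nbhd_def by (intro open_Collect_less continuous_intros)
  then show ?thesis by auto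
qed

lemma nbhd_mono: "r \<le> s \<Longrightarrow> nbhd S r \<subseteq> nbhd S s"
  by (auto simp: nbhd_def)

lemma nbhd_far: "x \<in> nbhd S r \<Longrightarrow> y \<notin> nbhd S s \<Longrightarrow> s - r \<le> dist x y"
  using infdist_triangle[of y S x] by (simp add: nbhd_def dist_commute)

abbreviation near_supported :: "'a::euclidean_space set \<Rightarrow> 'a op set" where
  "near_supported S \<equiv> \<Union>n\<in>{1::nat..}. {A \<in> std_algebra. A = proj (nbhd S (real n)) o\<^sub>L A o\<^sub>L proj (nbhd S (real n))}"

text \<open>
  The two one-sided equations are what products and adjoints preserve. Once they hold for some
  neighbourhood, they persist for all larger ones, so finitely many operators share one.
\<close>

lemma near_supportedI:
  assumes "A \<in> std_algebra" "n \<ge> 1" "proj (nbhd S (real n)) o\<^sub>L A = A" "A o\<^sub>L proj (nbhd S (real n)) = A"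
  shows "A \<in> near_supported S"
proof (rule UN_I[of n])
  show "A \<in> {A \<in> std_algebra. A = proj (nbhd S (real n)) o\<^sub>L A o\<^sub>L proj (nbhd S (real n))}"
    using assms by simp
qed (use assms in simp)

lemma near_supportedE:
  assumes "A \<in> near_supported S"
  obtains n :: nat where "A \<in> std_algebra" "n \<ge> 1"
    "\<And>k. real n \<le> k \<Longrightarrow> proj (nbhd S k) o\<^sub>L A = A" "\<And>k. real n \<le> k \<Longrightarrow> A o\<^sub>L proj (nbhd S k) = A"
proof -
  obtain n :: nat where n: "n \<ge> 1" "A \<in> std_algebra" "A = proj (nbhd S (real n)) o\<^sub>L A o\<^sub>L proj (nbhd S (real n))"
    using assms by blast
  have "proj (nbhd S k) o\<^sub>L A = A" "A o\<^sub>L proj (nbhd S k) = A" if "real n \<le> k" for k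
  proof -
    note m = proj_mono[OF nbhd_measurable nbhd_measurable nbhd_mono[OF that], of S]
    have "proj (nbhd S k) o\<^sub>L A = proj (nbhd S k) o\<^sub>L (proj (nbhd S (real n)) o\<^sub>L A o\<^sub>L proj (nbhd S (real n)))"
      by (rule arg_cong[OF n(3)])
    also have "\<dots> = ((proj (nbhd S k) o\<^sub>L proj (nbhd S (real n))) o\<^sub>L A) o\<^sub>L proj (nbhd S (real n))"
      by (simp add: blinfun_compose_assoc)
    also have "\<dots> = A" unfolding m by (rule n(3)[symmetric])
    finally show "proj (nbhd S k) o\<^sub>L A = A" .
    have "A o\<^sub>L proj (nbhd S k) = (proj (nbhd S (real n)) o\<^sub>L A o\<^sub>L proj (nbhd S (real n))) o\<^sub>L proj (nbhd S k)"
      by (rule arg_cong[OF n(3)])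
    also have "\<dots> = (proj (nbhd S (real n)) o\<^sub>L A) o\<^sub>L (proj (nbhd S (real n)) o\<^sub>L proj (nbhd S k))"
      by (simp add: blinfun_compose_assoc)
    also have "\<dots> = A" unfolding m by (rule n(3)[symmetric])
    finally show "A o\<^sub>L proj (nbhd S k) = A" .
  qed
  with n show thesis by (intro that) auto
qed

lemma finite_range_spreads:
  assumes A: "A \<in> finite_range_ops m" and k: "m + r < k"
  shows "proj (nbhd S k) o\<^sub>L (A o\<^sub>L proj (nbhd S r)) = A o\<^sub>L proj (nbhd S r)"
    and "(proj (nbhd S r) o\<^sub>L A) o\<^sub>L proj (nbhd S k) = proj (nbhd S r) o\<^sub>L A"
proof -
  have *: "proj (- nbhd S k) o\<^sub>L (A o\<^sub>L proj (nbhd S r)) = 0" if "A \<in> finite_range_ops m" for A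
  proof (rule finite_range_separated[OF that, where m' = "k - r"])
    show "k - r \<le> dist x y" if "x \<in> - nbhd S k" "y \<in> nbhd S r" for x y
      using nbhd_far[of y S r x k] that by (simp add: dist_commute)
  qed (use k in \<open>auto simp: nbhd_measurable Compl_in_sets_lebesgue\<close>)
  have 1: "proj (nbhd S k) o\<^sub>L (A o\<^sub>L proj (nbhd S r)) = A o\<^sub>L proj (nbhd S r)" if "A \<in> finite_range_ops m" for A
    using *[OF that] by (simp add: proj_compl nbhd_measurable compose_distribs)
  show "proj (nbhd S k) o\<^sub>L (A o\<^sub>L proj (nbhd S r)) = A o\<^sub>L proj (nbhd S r)" by (rule 1[OF A])
  show "(proj (nbhd S r) o\<^sub>L A) o\<^sub>L proj (nbhd S k) = proj (nbhd S r) o\<^sub>L A"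
    using arg_cong[OF 1[OF finite_range_adj[OF A]], of adj] by (simp add: adj_compose)
qed

lemma std_ideal_subset: "A \<in> std_ideal S \<Longrightarrow> A \<in> std_algebra"
proof -
  have "std_ideal S \<subseteq> std_algebra"
    unfolding std_ideal_def by (rule closure_minimal) (auto simp: std_algebraD(1))
  then show "A \<in> std_ideal S \<Longrightarrow> A \<in> std_algebra" by auto
qed

lemma subspace_std_ideal: "subspace (std_ideal S)"
  unfolding std_ideal_def
proof (rule subspace_closure, unfold subspace_def, intro conjI ballI allI)
  let ?J = "near_supported S"
  show "0 \<in> ?J" by (rule near_supportedI[where n = 1]) (auto simp: std_algebraD(2))
  fix A B assume "A \<in> ?J" "B \<in> ?J"
  then show "A + B \<in> ?J"
  proof (elim near_supportedE)
    fix n n' :: nat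
    assume *: "A \<in> std_algebra" "n \<ge> 1" "B \<in> std_algebra"
      "\<And>k. real n \<le> k \<Longrightarrow> proj (nbhd S k) o\<^sub>L A = A" "\<And>k. real n \<le> k \<Longrightarrow> A o\<^sub>L proj (nbhd S k) = A"
      "\<And>k. real n' \<le> k \<Longrightarrow> proj (nbhd S k) o\<^sub>L B = B" "\<And>k. real n' \<le> k \<Longrightarrow> B o\<^sub>L proj (nbhd S k) = B"
    show ?thesis
      by (rule near_supportedI[where n = "max n n'"]) (use *(1-3) in \<open>auto simp: * std_algebraD(5) compose_distribs\<close>)
  qed
next
  let ?J = "near_supported S"
  fix r A assume "A \<in> ?J"
  then show "r *\<^sub>R A \<in> ?J"
    by (auto simp: std_algebraD(7) compose_distribs)
qed

lemma closed_std_ideal: "closed (std_ideal S)"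
  by (simp add: std_ideal_def)

lemma std_ideal_adj: "A \<in> std_ideal S \<Longrightarrow> adj A \<in> std_ideal S"
  unfolding std_ideal_def
proof (erule closure_mapI[OF bounded_linear_adj, rotated], erule near_supportedE)
  fix A and n :: nat
  assume *: "A \<in> std_algebra" "n \<ge> 1"
    "\<And>k. real n \<le> k \<Longrightarrow> proj (nbhd S k) o\<^sub>L A = A" "\<And>k. real n \<le> k \<Longrightarrow> A o\<^sub>L proj (nbhd S k) = A"
  show "adj A \<in> near_supported S"
    by (rule near_supportedI[OF std_algebra_adj[OF *(1)] *(2)])
      (use arg_cong[OF *(3), of n adj] arg_cong[OF *(4), of n adj] in \<open>simp_all add: adj_compose\<close>)
qed

text \<open>
  An operator of finite range moves the neighbourhood \<open>S(n)\<close> into some \<open>S(k)\<close>; this makes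
  \<open>std_ideal S\<close> an ideal, and it puts elements of the algebra that are supported near \<open>S\<close> on one
  side into it.
\<close>

lemma std_ideal_left:
  assumes A: "A \<in> std_algebra" and B: "B \<in> std_ideal S"
  shows "A o\<^sub>L B \<in> std_ideal S"
proof -
  have A': "A \<in> closure (\<Union>m\<in>{0..}. finite_range_ops m)" using A by (simp add: std_algebra_def)
  show ?thesis
    using A' B unfolding std_ideal_def
  proof (rule closure_composeI[rotated])
    let ?J = "near_supported S"
    fix A :: "'a op" and B assume A: "A \<in> (\<Union>m\<in>{0..}. finite_range_ops m)" and B: "B \<in> ?J"
    obtain m where m: "A \<in> finite_range_ops m" using A by auto
    obtain n :: nat where n: "B \<in> std_algebra" "n \<ge> 1"
      "\<And>k. real n \<le> k \<Longrightarrow> proj (nbhd S k) o\<^sub>L B = B" "\<And>k. real n \<le> k \<Longrightarrow> B o\<^sub>L proj (nbhd S k) = B"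
      using B by (rule near_supportedE) blast
    obtain j :: nat where j: "m + real n < real j" using reals_Archimedean2 by blast
    define k where "k = max n j"
    have k: "m + real n < real k" "n \<le> k" using j by (auto simp: k_def)
    have "proj (nbhd S (real k)) o\<^sub>L (A o\<^sub>L B) = (proj (nbhd S (real k)) o\<^sub>L (A o\<^sub>L proj (nbhd S (real n)))) o\<^sub>L B"
      by (simp add: blinfun_compose_assoc n(3))
    also have "\<dots> = A o\<^sub>L B"
      unfolding finite_range_spreads(1)[OF m k(1)] by (simp add: blinfun_compose_assoc n(3))
    finally have 1: "proj (nbhd S (real k)) o\<^sub>L (A o\<^sub>L B) = A o\<^sub>L B" .
    have "A o\<^sub>L B \<in> ?J"
      by (rule near_supportedI[where n = k])
        (use n k 1 in \<open>auto simp: blinfun_compose_assoc intro!: std_algebraD(4) finite_range_subset_std_algebra[OF m]\<close>)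
    then show "A o\<^sub>L B \<in> closure ?J" by (rule subsetD[OF closure_subset])
  qed
  qed

lemma std_ideal_right:
  assumes "A \<in> std_algebra" "B \<in> std_ideal S"
  shows "B o\<^sub>L A \<in> std_ideal S"
  using std_ideal_adj[OF std_ideal_left[OF std_algebra_adj[OF assms(1)] std_ideal_adj[OF assms(2)]]]
  by (simp add: adj_compose)

lemma one_sided_support_std_ideal:
  assumes T: "T \<in> std_algebra" and supp: "proj (nbhd S c) o\<^sub>L T = T"
  shows "T \<in> std_ideal S"
proof -
  have T': "T \<in> closure (\<Union>m\<in>{0..}. finite_range_ops m)" using T by (simp add: std_algebra_def)
  have "proj (nbhd S c) o\<^sub>L T \<in> std_ideal S"
    using T' unfolding std_ideal_def
  proof (rule closure_mapI[OF bounded_bilinear.bounded_linear_right[OF bounded_bilinear_blinfun_compose], rotated])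
    fix A :: "'a op" assume "A \<in> (\<Union>m\<in>{0..}. finite_range_ops m)"
    then obtain m where m: "A \<in> finite_range_ops m" "m \<ge> 0" by auto
    obtain k :: nat where k: "max (m + c) 1 < real k" using reals_Archimedean2 by blast
    have c: "proj (nbhd S (real k)) o\<^sub>L proj (nbhd S c) = proj (nbhd S c)"
      using k m by (intro proj_mono nbhd_measurable nbhd_mono) auto
    show "proj (nbhd S c) o\<^sub>L A \<in> near_supported S"
    proof (rule near_supportedI)
      show "(proj (nbhd S c) o\<^sub>L A) o\<^sub>L proj (nbhd S (real k)) = proj (nbhd S c) o\<^sub>L A"
        using k by (intro finite_range_spreads(2)[OF m(1)]) auto
      show "proj (nbhd S (real k)) o\<^sub>L (proj (nbhd S c) o\<^sub>L A) = proj (nbhd S c) o\<^sub>L A"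
        by (simp add: c flip: blinfun_compose_assoc)
      show "proj (nbhd S c) o\<^sub>L A \<in> std_algebra"
        by (intro std_algebraD(4) finite_range_subset_std_algebra[OF finite_range_proj] finite_range_subset_std_algebra[OF m(1)])
    qed (use k in auto)
  qed
  then show ?thesis by (simp add: supp)
qed

section \<open>Compact operators\<close>

lemma compact_opsI:
  assumes "A \<in> bounded_ops" "compact C" "\<And>f. norm f \<le> 1 \<Longrightarrow> blinfun_apply A f \<in> C"
  shows "A \<in> compact_ops"
proof -
  have "closure (blinfun_apply A ` cball 0 1) \<subseteq> C"
    using assms(2,3) by (intro closure_minimal) (auto intro: compact_imp_closed)
  then have "compact (closure (blinfun_apply A ` cball 0 1))"
    using assms(2) closed_Int_compact[OF closed_closure assms(2)] by (metis inf.absorb1)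
  with assms(1) show ?thesis by (simp add: compact_ops_def)
qed

lemma compact_opsE:
  assumes "A \<in> compact_ops"
  obtains C where "A \<in> bounded_ops" "compact C" "\<And>f. norm f \<le> 1 \<Longrightarrow> blinfun_apply A f \<in> C"
  using assms closure_subset[of "blinfun_apply A ` cball 0 1"] by (force simp: compact_ops_def)

lemma compact_ops_bounded: "A \<in> compact_ops \<Longrightarrow> A \<in> bounded_ops"
  by (simp add: compact_ops_def)

lemma compact_ops_zero: "0 \<in> compact_ops"
  by (rule compact_opsI[where C = "{0}"]) auto

lemma compact_ops_diff:
  assumes "A \<in> compact_ops" "B \<in> compact_ops" shows "A - B \<in> compact_ops"
proof -
  obtain C where C: "A \<in> bounded_ops" "compact C" "\<And>f. norm f \<le> 1 \<Longrightarrow> blinfun_apply A f \<in> C" using assms(1) by (rule compact_opsE) blast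
  obtain D where D: "B \<in> bounded_ops" "compact D" "\<And>f. norm f \<le> 1 \<Longrightarrow> blinfun_apply B f \<in> D" using assms(2) by (rule compact_opsE) blast
  show ?thesis
    by (rule compact_opsI[OF _ compact_differences[OF C(2) D(2)]])
      (use C D in \<open>auto simp: blinfun.bilinear_simps\<close>)
qed

lemma compact_ops_left:
  assumes "A \<in> bounded_ops" "K \<in> compact_ops" shows "A o\<^sub>L K \<in> compact_ops"
proof -
  obtain C where C: "K \<in> bounded_ops" "compact C" "\<And>f. norm f \<le> 1 \<Longrightarrow> blinfun_apply K f \<in> C" using assms(2) by (rule compact_opsE) blast
  have "compact (blinfun_apply A ` C)"
    by (intro compact_continuous_image C continuous_intros)
  then show ?thesis by (rule compact_opsI[rotated]) (use assms C in auto)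
qed

lemma compact_ops_right:
  assumes "A \<in> bounded_ops" "K \<in> compact_ops" shows "K o\<^sub>L A \<in> compact_ops"
proof -
  obtain C where C: "K \<in> bounded_ops" "compact C" "\<And>f. norm f \<le> 1 \<Longrightarrow> blinfun_apply K f \<in> C" using assms(2) by (rule compact_opsE) blast
  define b where "b = norm A + 1"
  have b: "b > 0" by (simp add: b_def add_nonneg_pos)
  have "compact ((\<lambda>x. b *\<^sub>R x) ` C)"
    by (intro compact_continuous_image C continuous_intros)
  then show ?thesis
  proof (rule compact_opsI[rotated])
    fix f :: "'a L2" assume f: "norm f \<le> 1"
    have "norm (blinfun_apply A f) \<le> b"
      using norm_blinfun[of A f] mult_left_mono[OF f, of "norm A"] by (simp add: b_def)
    then have "blinfun_apply K ((1/b) *\<^sub>R blinfun_apply A f) \<in> C" using b by (intro C(3)) simp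
    then have "b *\<^sub>R blinfun_apply K ((1/b) *\<^sub>R blinfun_apply A f) \<in> (\<lambda>x. b *\<^sub>R x) ` C" by (rule imageI)
    then show "blinfun_apply (K o\<^sub>L A) f \<in> (\<lambda>x. b *\<^sub>R x) ` C" using b by (simp add: blinfun.bilinear_simps)
  qed (use assms C in auto)
qed

lemma compact_ops_uminus: "A \<in> compact_ops \<Longrightarrow> - A \<in> compact_ops"
  using compact_ops_diff[OF compact_ops_zero] by fastforce

text \<open>
  The image of the unit ball is covered by finitely many small balls, and strong convergence is
  uniform on the finite set of their centres.
\<close>

lemma norm_compact_tendsto_0:
  assumes K: "K \<in> compact_ops" and T: "\<And>n::nat. norm (T n) \<le> 1" "\<And>f. (\<lambda>n. blinfun_apply (T n) f) \<longlonglongrightarrow> 0"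
  shows "(\<lambda>n. norm (T n o\<^sub>L K)) \<longlonglongrightarrow> 0"
proof (rule LIMSEQ_I)
  fix e :: real assume e: "e > 0"
  obtain C where C: "compact C" "\<And>f. norm f \<le> 1 \<Longrightarrow> blinfun_apply K f \<in> C" using K by (rule compact_opsE) blast
  have "C \<subseteq> (\<Union>x\<in>C. ball x (e/4))" using e by force
  then obtain F where F: "finite F" "C \<subseteq> (\<Union>x\<in>F. ball x (e/4))"
    by (rule compactE_image[OF C(1), of C "\<lambda>x. ball x (e/4)", rotated]) auto
  have "\<forall>x\<in>F. \<forall>\<^sub>F n in sequentially. norm (blinfun_apply (T n) x) < e/4"
  proof
    fix x assume "x \<in> F"
    have "(\<lambda>n. norm (blinfun_apply (T n) x)) \<longlonglongrightarrow> 0" using T(2) by (rule tendsto_norm_zero)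
    then show "\<forall>\<^sub>F n in sequentially. norm (blinfun_apply (T n) x) < e/4" by (rule order_tendstoD) (use e in simp)
  qed
  then have "\<forall>\<^sub>F n in sequentially. \<forall>x\<in>F. norm (blinfun_apply (T n) x) < e/4"
    using F(1) by (simp add: eventually_ball_finite)
  then obtain N where N: "\<And>n x. n \<ge> N \<Longrightarrow> x \<in> F \<Longrightarrow> norm (blinfun_apply (T n) x) < e/4"
    by (auto simp: eventually_sequentially)
  have "norm (T n o\<^sub>L K) \<le> e/2" if n: "n \<ge> N" for n
  proof (rule norm_blinfun_bound)
    have ball: "norm (blinfun_apply (T n o\<^sub>L K) f) \<le> e/2" if f: "norm f \<le> 1" for f
    proof -
      obtain x where x: "x \<in> F" "norm (blinfun_apply K f - x) < e/4"
        using C(2)[OF f] F(2) by (auto simp: dist_norm norm_minus_commute)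
      have "norm (blinfun_apply (T n) (blinfun_apply K f - x)) \<le> 1 * norm (blinfun_apply K f - x)"
        using norm_blinfun[of "T n" "blinfun_apply K f - x"] mult_right_mono[OF T(1)[of n] norm_ge_zero[of "blinfun_apply K f - x"]] by linarith
      then have "norm (blinfun_apply (T n) (blinfun_apply K f) - blinfun_apply (T n) x) < e/4"
        using x(2) by (simp add: blinfun.bilinear_simps)
      with N[OF n x(1)] show ?thesis
        using norm_triangle_sub[of "blinfun_apply (T n) (blinfun_apply K f)" "blinfun_apply (T n) x"] by simp
    qed
    show "norm (blinfun_apply (T n o\<^sub>L K) f) \<le> e/2 * norm f" for f
    proof (cases "f = 0")
      case False
      then show ?thesis using ball[of "(1 / norm f) *\<^sub>R f"]
        by (simp add: blinfun.bilinear_simps field_simps)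
    qed simp
  qed (use e in simp)
  then have "norm (norm (T n o\<^sub>L K) - 0) < e" if "n \<ge> N" for n using that e by fastforce
  then show "\<exists>N. \<forall>n\<ge>N. norm (norm (T n o\<^sub>L K) - 0) < e" by blast
qed

lemma norm_sq_le_adj: "(norm T)\<^sup>2 \<le> norm (adj T o\<^sub>L T)" for T :: "'h::{real_inner,complete_space} \<Rightarrow>\<^sub>L 'h"
proof -
  have "norm T \<le> sqrt (norm (adj T o\<^sub>L T))"
  proof (rule norm_blinfun_bound)
    fix f
    have "(norm (blinfun_apply T f))\<^sup>2 = f \<bullet> blinfun_apply (adj T o\<^sub>L T) f"
      by (simp add: power2_norm_eq_inner inner_adj)
    also have "\<dots> \<le> norm f * norm (blinfun_apply (adj T o\<^sub>L T) f)" by (rule norm_cauchy_schwarz)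
    also have "\<dots> \<le> norm f * (norm (adj T o\<^sub>L T) * norm f)" by (intro mult_left_mono norm_blinfun) auto
    also have "\<dots> = norm (adj T o\<^sub>L T) * (norm f)\<^sup>2" by (simp add: power2_eq_square)
    finally have "norm (blinfun_apply T f) \<le> sqrt (norm (adj T o\<^sub>L T) * (norm f)\<^sup>2)" by (rule real_le_rsqrt)
    then show "norm (blinfun_apply T f) \<le> sqrt (norm (adj T o\<^sub>L T)) * norm f"
      by (simp add: real_sqrt_mult)
  qed simp
  then have "(norm T)\<^sup>2 \<le> (sqrt (norm (adj T o\<^sub>L T)))\<^sup>2" by (intro power_mono) auto
  then show ?thesis by simp
qed

text \<open>
  A compact operator is the norm limit of its compressions to large balls: on the left since balls
  exhaust the space, on the right by applying this to \<open>K\<^sup>* K\<close>.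
\<close>

lemma compact_ops_subset_std_ideal:
  assumes K: "K \<in> compact_ops" and s: "s \<in> S"
  shows "K \<in> std_ideal S"
proof -
  define P where "P n = proj (ball s (real (Suc n)))" for n
  define T where "T n = id_blinfun - P n" for n
  have T_proj: "T n = proj (- ball s (real (Suc n)))" for n by (simp add: T_def P_def proj_compl)
  have nT: "norm (T n) \<le> 1" for n unfolding T_proj by (rule norm_proj_le)
  have Tlim: "(\<lambda>n. blinfun_apply (T n) f) \<longlonglongrightarrow> 0" for f
  proof -
    have "(\<lambda>n. blinfun_apply (T n) f) \<longlonglongrightarrow> blinfun_apply (proj {}) f"
      unfolding T_proj
    proof (rule proj_tendsto)
      fix x
      obtain N :: nat where "dist s x < real N" using reals_Archimedean2 by blast
      then show "\<forall>\<^sub>F n in sequentially. x \<in> - ball s (real (Suc n)) \<longleftrightarrow> x \<in> {}"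
        unfolding eventually_sequentially by (intro exI[of _ N]) auto
    qed (auto simp: Compl_in_sets_lebesgue)
    then show ?thesis by simp
  qed
  have Kb: "K \<in> bounded_ops" using K by (rule compact_ops_bounded)
  have 1: "(\<lambda>n. norm (T n o\<^sub>L K)) \<longlonglongrightarrow> 0" by (rule norm_compact_tendsto_0[OF K nT Tlim])
  have "(\<lambda>n. norm (T n o\<^sub>L (adj K o\<^sub>L K))) \<longlonglongrightarrow> 0"
    by (rule norm_compact_tendsto_0[OF compact_ops_left[OF _ K] nT Tlim]) (use Kb in auto)
  then have 3: "(\<lambda>n. sqrt (norm (T n o\<^sub>L (adj K o\<^sub>L K)))) \<longlonglongrightarrow> 0" using tendsto_real_sqrt by fastforce
  have 4: "norm (K o\<^sub>L T n) \<le> sqrt (norm (T n o\<^sub>L (adj K o\<^sub>L K)))" for n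
  proof -
    have "(norm (K o\<^sub>L T n))\<^sup>2 \<le> norm ((T n o\<^sub>L (adj K o\<^sub>L K)) o\<^sub>L T n)"
      using norm_sq_le_adj[of "K o\<^sub>L T n"] by (simp add: adj_compose T_proj blinfun_compose_assoc)
    also have "\<dots> \<le> norm (T n o\<^sub>L (adj K o\<^sub>L K)) * norm (T n)" by (rule norm_blinfun_compose)
    also have "\<dots> \<le> norm (T n o\<^sub>L (adj K o\<^sub>L K))" using mult_left_mono[OF nT[of n] norm_ge_zero] by simp
    finally show ?thesis by (rule real_le_rsqrt)
  qed
  have 2: "(\<lambda>n. norm (K o\<^sub>L T n)) \<longlonglongrightarrow> 0"
    by (rule Lim_null_comparison[OF always_eventually 3]) (simp add: 4)
  have lim: "(\<lambda>n. P n o\<^sub>L (K o\<^sub>L P n)) \<longlonglongrightarrow> K"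
  proof (rule LIM_zero_cancel, rule Lim_null_comparison)
    show "(\<lambda>n. norm (K o\<^sub>L T n) + norm (T n o\<^sub>L K)) \<longlonglongrightarrow> 0"
      using tendsto_add[OF 2 1] by simp
    have "norm ((P n o\<^sub>L (K o\<^sub>L P n)) - K) \<le> norm (K o\<^sub>L T n) + norm (T n o\<^sub>L K)" for n
    proof -
      have "(P n o\<^sub>L (K o\<^sub>L P n)) - K = - (P n o\<^sub>L (K o\<^sub>L T n)) - (T n o\<^sub>L K)"
        by (simp add: T_def compose_distribs)
      then have "norm ((P n o\<^sub>L (K o\<^sub>L P n)) - K) \<le> norm (P n o\<^sub>L (K o\<^sub>L T n)) + norm (T n o\<^sub>L K)"
        by (metis norm_minus_cancel norm_triangle_ineq4)
      also have "norm (P n o\<^sub>L (K o\<^sub>L T n)) \<le> norm (P n) * norm (K o\<^sub>L T n)" by (rule norm_blinfun_compose)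
      also have "\<dots> \<le> norm (K o\<^sub>L T n)"
        using mult_right_mono[OF norm_proj_le norm_ge_zero, of "ball s (real (Suc n))" "K o\<^sub>L T n"] by (simp add: P_def)
      finally show ?thesis by simp
    qed
    then show "\<forall>\<^sub>F n in sequentially. norm ((P n o\<^sub>L (K o\<^sub>L P n)) - K) \<le> norm (K o\<^sub>L T n) + norm (T n o\<^sub>L K)"
      by simp
  qed
  show ?thesis
  proof (rule closed_sequentially[OF closed_std_ideal _ lim])
    fix n
    let ?B = "ball s (real (Suc n))"
    have sub: "?B \<subseteq> nbhd S (real (Suc n))"
      by (auto simp: nbhd_def dist_commute simp del: of_nat_Suc intro: le_less_trans[OF infdist_le[OF s]])
    have "P n o\<^sub>L (K o\<^sub>L P n) \<in> finite_range_ops (2 * real (Suc n))"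
    proof (rule finite_range_opsI)
      show "P n o\<^sub>L (K o\<^sub>L P n) \<in> bounded_ops" using Kb by (auto simp: P_def)
      fix a b :: 'a and r t :: real assume "r > 0" "t > 0" and far: "dist a b > r + t + 2 * real (Suc n)"
      have "ball a r \<inter> ?B = {} \<or> ?B \<inter> ball b t = {}"
      proof (rule ccontr)
        assume "\<not> ?thesis"
        then obtain x y where "x \<in> ball a r" "x \<in> ?B" "y \<in> ?B" "y \<in> ball b t" by blast
        then have "dist a x < r" "dist x s < real (Suc n)" "dist s y < real (Suc n)" "dist y b < t"
          by (simp_all add: dist_commute)
        then have "dist a b < r + real (Suc n) + real (Suc n) + t"
          using dist_triangle[of a b s] dist_triangle[of a s x] dist_triangle[of s b y] by linarith
        with far show False by simp
      qed
      then have "proj (ball a r) o\<^sub>L P n = 0 \<or> P n o\<^sub>L proj (ball b t) = 0"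
        by (auto simp: P_def proj_proj)
      then show "proj (ball a r) o\<^sub>L ((P n o\<^sub>L (K o\<^sub>L P n)) o\<^sub>L proj (ball b t)) = 0"
        by (metis blinfun_compose_assoc blinfun_compose_zero)
    qed
    then have A: "P n o\<^sub>L (K o\<^sub>L P n) \<in> std_algebra" by (rule finite_range_subset_std_algebra)
    have PN: "proj (nbhd S (real (Suc n))) o\<^sub>L P n = P n"
      unfolding P_def by (intro proj_mono sub nbhd_measurable) auto
    show "P n o\<^sub>L (K o\<^sub>L P n) \<in> std_ideal S"
      by (rule one_sided_support_std_ideal[OF A, of S "real (Suc n)"])
        (simp add: PN del: of_nat_Suc flip: blinfun_compose_assoc)
  qed
qed

section \<open>Quotient algebras and spectra\<close>

text \<open>
  Invertibility of the coset of \<open>A\<close>, expressed through representatives so that no cosets occur in the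
  estimates.
\<close>

definition invertible_mod :: "'a::euclidean_space op set \<Rightarrow> 'a op set \<Rightarrow> 'a op \<Rightarrow> bool" where
  "invertible_mod C J A \<longleftrightarrow> (\<exists>B\<in>C. (B o\<^sub>L A) - id_blinfun \<in> J \<and> (A o\<^sub>L B) - id_blinfun \<in> J)"

definition op_ideal :: "'a::euclidean_space op set \<Rightarrow> 'a op set \<Rightarrow> bool" where
  "op_ideal C J \<longleftrightarrow> J \<subseteq> C \<and> 0 \<in> J \<and> (\<forall>A\<in>J. \<forall>B\<in>J. A - B \<in> J) \<and> (\<forall>A\<in>C. \<forall>B\<in>J. (A o\<^sub>L B) \<in> J \<and> (B o\<^sub>L A) \<in> J)"

definition op_algebra :: "'a::euclidean_space op set \<Rightarrow> bool" where
  "op_algebra C \<longleftrightarrow> id_blinfun \<in> C \<and> (\<forall>A\<in>C. \<forall>B\<in>C. A - B \<in> C \<and> (A o\<^sub>L B) \<in> C) \<and> (\<forall>k. scalar_op k \<in> C) \<and> C \<subseteq> bounded_ops"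

lemma op_algebraD:
  assumes "op_algebra C"
  shows "id_blinfun \<in> C" "0 \<in> C" "scalar_op k \<in> C" "A \<in> C \<Longrightarrow> B \<in> C \<Longrightarrow> A - B \<in> C" "A \<in> C \<Longrightarrow> B \<in> C \<Longrightarrow> A o\<^sub>L B \<in> C"
    "A \<in> C \<Longrightarrow> - A \<in> C" "A \<in> C \<Longrightarrow> B \<in> C \<Longrightarrow> A + B \<in> C" "A \<in> C \<Longrightarrow> A \<in> bounded_ops"
proof -
  have d: "A - B \<in> C" if "A \<in> C" "B \<in> C" for A B using assms that by (simp add: op_algebra_def)
  show 0: "0 \<in> C" using assms d[of id_blinfun id_blinfun] by (simp add: op_algebra_def)
  show m: "- A \<in> C" if "A \<in> C" for A using d[OF 0 that] by simp
  show "A + B \<in> C" if "A \<in> C" "B \<in> C" for A B using d[OF that(1) m[OF that(2)]] by simp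
qed (use assms in \<open>auto simp: op_algebra_def\<close>)

lemma op_idealD:
  assumes "op_ideal C J"
  shows "A \<in> J \<Longrightarrow> A \<in> C" "0 \<in> J" "A \<in> J \<Longrightarrow> B \<in> J \<Longrightarrow> A - B \<in> J" "A \<in> J \<Longrightarrow> - A \<in> J"
    "A \<in> J \<Longrightarrow> B \<in> J \<Longrightarrow> A + B \<in> J" "A \<in> C \<Longrightarrow> B \<in> J \<Longrightarrow> A o\<^sub>L B \<in> J" "A \<in> C \<Longrightarrow> B \<in> J \<Longrightarrow> B o\<^sub>L A \<in> J"
proof -
  have d: "A - B \<in> J" if "A \<in> J" "B \<in> J" for A B using assms that by (simp add: op_ideal_def)
  show 0: "0 \<in> J" using assms by (simp add: op_ideal_def)
  show m: "- A \<in> J" if "A \<in> J" for A using d[OF 0 that] by simp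
  show "A + B \<in> J" if "A \<in> J" "B \<in> J" for A B using d[OF that(1) m[OF that(2)]] by simp
qed (use assms in \<open>auto simp: op_ideal_def\<close>)

lemma ring_op_ring:
  assumes "op_algebra C"
  shows "ring (op_ring C)"
proof (rule ringI)
  note alg = op_algebraD[OF assms]
  show "abelian_group (op_ring C)"
    by (rule abelian_groupI) (auto simp: op_ring_def alg intro: exI bexI[of _ "- x" for x])
  show "monoid (op_ring C)"
    by (rule monoidI) (auto simp: op_ring_def alg blinfun_compose_assoc)
qed (auto simp: op_ring_def compose_distribs)

lemma minus_op_ring:
  assumes "op_algebra C" "A \<in> C" "B \<in> C"
  shows "A \<ominus>\<^bsub>op_ring C\<^esub> B = A - B"
proof -
  interpret ring "op_ring C" by (rule ring_op_ring[OF assms(1)])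
  have "\<ominus>\<^bsub>op_ring C\<^esub> B = - B"
    by (rule minus_equality) (use assms op_algebraD(6)[OF assms(1)] in \<open>auto simp: op_ring_def\<close>)
  then show ?thesis by (simp add: a_minus_def op_ring_def)
qed

lemma ideal_op_ring:
  assumes "op_algebra C" "op_ideal C J"
  shows "ideal J (op_ring C)"
proof -
  interpret ring "op_ring C" by (rule ring_op_ring[OF assms(1)])
  note id = op_idealD[OF assms(2)] and alg = op_algebraD[OF assms(1)]
  have minv: "\<ominus>\<^bsub>op_ring C\<^esub> B = - B" if "B \<in> C" for B
    by (rule minus_equality) (use alg that in \<open>auto simp: op_ring_def\<close>)
  show ?thesis
  proof (rule idealI[OF ring_axioms])
    show "subgroup J (add_monoid (op_ring C))"
    proof (rule add.subgroupI)
      show "J \<noteq> {}" using id(2) by auto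
      show "\<ominus>\<^bsub>op_ring C\<^esub> A \<in> J" if "A \<in> J" for A using that by (simp add: minv id(1) id(4))
    qed (auto simp: op_ring_def intro: id)
  qed (auto simp: op_ring_def id)
qed

lemma coset_Units_iff:
  assumes C: "op_algebra C" and J: "op_ideal C J" and A: "A \<in> C"
  shows "J +>\<^bsub>op_ring C\<^esub> A \<in> Units (op_ring C Quot J) \<longleftrightarrow> invertible_mod C J A"
proof -
  let ?R = "op_ring C"
  interpret ideal J ?R by (rule ideal_op_ring[OF C J])
  have carr: "carrier ?R = C" by (simp add: op_ring_def)
  have cosets: "J +>\<^bsub>?R\<^esub> X = J +>\<^bsub>?R\<^esub> Y \<longleftrightarrow> X - Y \<in> J" if "X \<in> C" "Y \<in> C" for X Y
    using quotient_eq_iff_same_a_r_cos[OF ideal_axioms, of X Y] that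
    by (simp add: carr minus_op_ring[OF C that])
  have mult: "(J +>\<^bsub>?R\<^esub> X) \<otimes>\<^bsub>?R Quot J\<^esub> (J +>\<^bsub>?R\<^esub> Y) = J +>\<^bsub>?R\<^esub> (X o\<^sub>L Y)" if "X \<in> C" "Y \<in> C" for X Y
    using rcoset_mult_add[of X Y] that by (simp add: FactRing_def carr) (simp add: op_ring_def)
  have one: "\<one>\<^bsub>?R Quot J\<^esub> = J +>\<^bsub>?R\<^esub> id_blinfun" by (simp add: FactRing_def) (simp add: op_ring_def)
  have qc: "carrier (?R Quot J) = {J +>\<^bsub>?R\<^esub> X |X. X \<in> C}"
    by (auto simp: FactRing_def A_RCOSETS_def' carr)
  note alg = op_algebraD[OF C]
  show ?thesis
  proof
    assume "J +>\<^bsub>?R\<^esub> A \<in> Units (?R Quot J)"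
    then obtain X where "X \<in> C"
      "(J +>\<^bsub>?R\<^esub> X) \<otimes>\<^bsub>?R Quot J\<^esub> (J +>\<^bsub>?R\<^esub> A) = J +>\<^bsub>?R\<^esub> id_blinfun"
      "(J +>\<^bsub>?R\<^esub> A) \<otimes>\<^bsub>?R Quot J\<^esub> (J +>\<^bsub>?R\<^esub> X) = J +>\<^bsub>?R\<^esub> id_blinfun"
      unfolding Units_def qc one by blast
    with A show "invertible_mod C J A" by (auto simp: invertible_mod_def mult cosets alg)
  next
    assume "invertible_mod C J A"
    then obtain X where X: "X \<in> C" "(X o\<^sub>L A) - id_blinfun \<in> J" "(A o\<^sub>L X) - id_blinfun \<in> J"
      by (auto simp: invertible_mod_def)
    have "(J +>\<^bsub>?R\<^esub> X) \<otimes>\<^bsub>?R Quot J\<^esub> (J +>\<^bsub>?R\<^esub> A) = J +>\<^bsub>?R\<^esub> id_blinfun"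
      "(J +>\<^bsub>?R\<^esub> A) \<otimes>\<^bsub>?R Quot J\<^esub> (J +>\<^bsub>?R\<^esub> X) = J +>\<^bsub>?R\<^esub> id_blinfun"
      using X A by (simp_all add: mult cosets alg)
    with X(1) A show "J +>\<^bsub>?R\<^esub> A \<in> Units (?R Quot J)" unfolding Units_def qc one by blast
  qed
qed

lemma one_plus_coset:
  assumes C: "op_algebra C" and J: "op_ideal C J" and A: "A \<in> C"
  shows "\<one>\<^bsub>op_ring C Quot J\<^esub> \<oplus>\<^bsub>op_ring C Quot J\<^esub> (J +>\<^bsub>op_ring C\<^esub> A) = J +>\<^bsub>op_ring C\<^esub> (id_blinfun + A)"
proof -
  interpret ideal J "op_ring C" by (rule ideal_op_ring[OF C J])
  show ?thesis
    using a_rcos_sum[of id_blinfun A] A op_algebraD(1)[OF C]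
    by (simp add: FactRing_def) (simp add: op_ring_def)
qed

lemma op_algebra_bounded_ops: "op_algebra bounded_ops"
  by (auto simp: op_algebra_def)

lemma op_algebra_std_algebra: "op_algebra std_algebra"
  by (auto simp: op_algebra_def std_algebraD std_algebra_scalar_op std_algebra_bounded)

lemma op_ideal_compact_ops: "op_ideal bounded_ops compact_ops"
  by (auto simp: op_ideal_def compact_ops_bounded compact_ops_zero compact_ops_diff compact_ops_left compact_ops_right)

lemma op_ideal_std_ideal: "op_ideal std_algebra (std_ideal S)"
  using subspace_std_ideal[of S]
  by (auto simp: op_ideal_def std_ideal_left std_ideal_right subspace_0 subspace_diff dest: std_ideal_subset)

lemma invertible_mod_cong:
  assumes J: "op_ideal C J" and XY: "X - Y \<in> J"
  shows "invertible_mod C J X \<longleftrightarrow> invertible_mod C J Y"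
proof -
  have *: "invertible_mod C J Y" if XY: "X - Y \<in> J" and X: "invertible_mod C J X" for X Y
  proof -
    note id = op_idealD[OF J]
    obtain B where B: "B \<in> C" "(B o\<^sub>L X) - id_blinfun \<in> J" "(X o\<^sub>L B) - id_blinfun \<in> J"
      using X by (auto simp: invertible_mod_def)
    have "(B o\<^sub>L Y) - id_blinfun = ((B o\<^sub>L X) - id_blinfun) - (B o\<^sub>L (X - Y))"
      "(Y o\<^sub>L B) - id_blinfun = ((X o\<^sub>L B) - id_blinfun) - ((X - Y) o\<^sub>L B)"
      by (simp_all add: compose_distribs)
    then have "(B o\<^sub>L Y) - id_blinfun \<in> J" "(Y o\<^sub>L B) - id_blinfun \<in> J"
      by (simp_all only:) (intro id B XY)+
    with B(1) show ?thesis by (auto simp: invertible_mod_def)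
  qed
  have "Y - X \<in> J" using op_idealD(4)[OF J XY] by simp
  with * XY show ?thesis by blast
qed

lemma invertible_mod_unit_right:
  assumes C: "op_algebra C" and J: "op_ideal C J"
    and U: "U \<in> C" "U' \<in> C" "U o\<^sub>L U' = id_blinfun" "U' o\<^sub>L U = id_blinfun"
    and X: "invertible_mod C J X"
  shows "invertible_mod C J (X o\<^sub>L U)"
proof -
  obtain B where B: "B \<in> C" "(B o\<^sub>L X) - id_blinfun \<in> J" "(X o\<^sub>L B) - id_blinfun \<in> J"
    using X by (auto simp: invertible_mod_def)
  note id = op_idealD[OF J]
  have "((U' o\<^sub>L B) o\<^sub>L (X o\<^sub>L U)) - id_blinfun = (U' o\<^sub>L ((B o\<^sub>L X) - id_blinfun)) o\<^sub>L U"
    using U by (simp add: compose_distribs blinfun_compose_assoc)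
  moreover have "((X o\<^sub>L U) o\<^sub>L (U' o\<^sub>L B)) - id_blinfun = (X o\<^sub>L ((U o\<^sub>L U') o\<^sub>L B)) - id_blinfun"
    by (simp add: blinfun_compose_assoc)
  ultimately show ?thesis
    unfolding invertible_mod_def using B U id(7)[OF U(1) id(6)[OF U(2) B(2)]] op_algebraD(5)[OF C U(2) B(1)]
    by (intro bexI[of _ "U' o\<^sub>L B"]) simp_all
qed

section \<open>Resolvents\<close>

text \<open>
  The equation says that \<open>(f, h) \<in> T\<close> exactly if \<open>A\<close> maps \<open>(z - T) f\<close> back to \<open>f\<close>; it determines the
  graph of \<open>T\<close> by \<open>A\<close> and avoids the relational inverse.
\<close>

definition is_resolvent :: "complex \<Rightarrow> 'a::euclidean_space unbounded_op \<Rightarrow> 'a op \<Rightarrow> bool" where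
  "is_resolvent z T A \<longleftrightarrow> A \<in> bounded_ops \<and> (\<forall>f h. (f, h) \<in> T \<longleftrightarrow> f = blinfun_apply A (z *\<^sub>C f - h))"

lemma is_bounded_inverse_iff:
  "is_bounded_inverse (op_plus (op_graph (scalar_op z)) (op_uminus T)) A \<longleftrightarrow> is_resolvent z T A"
proof -
  have 1: "(op_plus (op_graph (scalar_op z)) (op_uminus T))\<inverse> = {(z *\<^sub>C f - h, f) |f h. (f, h) \<in> T}"
    unfolding op_plus_def op_graph_def op_uminus_def by force
  have "op_graph A = {(z *\<^sub>C f - h, f) |f h. (f, h) \<in> T} \<longleftrightarrow> (\<forall>f h. (f, h) \<in> T \<longleftrightarrow> f = blinfun_apply A (z *\<^sub>C f - h))"
    (is "?l \<longleftrightarrow> ?r")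
  proof
    assume l: ?l
    show ?r
    proof (intro allI iffI)
      fix f h assume "(f, h) \<in> T"
      then have "(z *\<^sub>C f - h, f) \<in> op_graph A" unfolding l by blast
      then show "f = blinfun_apply A (z *\<^sub>C f - h)" by (simp add: op_graph_def)
    next
      fix f h assume "f = blinfun_apply A (z *\<^sub>C f - h)"
      then have "(z *\<^sub>C f - h, f) \<in> op_graph A" by (auto simp: op_graph_def)
      then obtain f' h' where *: "z *\<^sub>C f - h = z *\<^sub>C f' - h'" "f = f'" "(f', h') \<in> T" unfolding l by blast
      then have "h = h'" by simp
      with * show "(f, h) \<in> T" by simp
    qed
  next
    assume r: ?r
    have "(g, blinfun_apply A g) \<in> {(z *\<^sub>C f - h, f) |f h. (f, h) \<in> T}" for g
    proof -
      let ?f = "blinfun_apply A g"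
      have "(?f, z *\<^sub>C ?f - g) \<in> T" using r by simp
      moreover have "g = z *\<^sub>C ?f - (z *\<^sub>C ?f - g)" by simp
      ultimately show ?thesis by blast
    qed
    with r show ?l by (auto simp: op_graph_def)
  qed
  then show ?thesis by (simp add: is_bounded_inverse_def is_resolvent_def 1)
qed

lemma resolvent_set_iff: "z \<in> resolvent_set T \<longleftrightarrow> (\<exists>A. is_resolvent z T A)"
  by (simp add: resolvent_set_def is_bounded_inverse_iff)

lemma resolvent_eqI: "is_resolvent z T A \<Longrightarrow> resolvent z T = A"
  unfolding resolvent_def by (rule bounded_inverse_eq) (simp add: is_bounded_inverse_iff)

lemma is_resolvent_resolvent: "z \<in> resolvent_set T \<Longrightarrow> is_resolvent z T (resolvent z T)"
  unfolding resolvent_set_iff using resolvent_eqI by blast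

lemma is_resolventD:
  assumes "is_resolvent z T A"
  shows "A \<in> bounded_ops" "(f, h) \<in> T \<longleftrightarrow> f = blinfun_apply A (z *\<^sub>C f - h)"
  using assms by (auto simp: is_resolvent_def)

lemma resolvent_identity:
  assumes z: "is_resolvent z T R" and w: "is_resolvent w T R'"
  shows "R' = R + (scalar_op (z - w) o\<^sub>L (R o\<^sub>L R'))"
proof (rule blinfun_eqI)
  fix g
  let ?f = "blinfun_apply R' g"
  have "(?f, w *\<^sub>C ?f - g) \<in> T" by (subst is_resolventD(2)[OF w]) simp
  then have "?f = blinfun_apply R (z *\<^sub>C ?f - (w *\<^sub>C ?f - g))" by (subst (asm) is_resolventD(2)[OF z])
  also have "z *\<^sub>C ?f - (w *\<^sub>C ?f - g) = g + (z - w) *\<^sub>C ?f" by (simp add: scaleC_diff_left)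
  finally show "blinfun_apply R' g = blinfun_apply (R + (scalar_op (z - w) o\<^sub>L (R o\<^sub>L R'))) g"
    by (simp add: blinfun.bilinear_simps bounded_opsD[OF is_resolventD(1)[OF z]])
qed

text \<open>
  Formally this is \<open>(z - T) (\<alpha> - T)\<^sup>-\<^sup>1\<close> for \<open>R = (\<alpha> - T)\<^sup>-\<^sup>1\<close>, the element whose image in a
  quotient decides whether \<open>z\<close> belongs to the quotient spectrum. The formal expression explains
  the product rule below and that \<open>R\<close> times the inverse is the resolvent at \<open>z\<close>.
\<close>

definition resolvent_symbol :: "complex \<Rightarrow> complex \<Rightarrow> 'a::euclidean_space op \<Rightarrow> 'a op" where
  "resolvent_symbol z \<alpha> R = id_blinfun + (scalar_op (z - \<alpha>) o\<^sub>L R)"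

lemma resolvent_symbol_apply:
  "blinfun_apply (resolvent_symbol z \<alpha> R) f = f + (z - \<alpha>) *\<^sub>C blinfun_apply R f"
  by (simp add: resolvent_symbol_def blinfun.bilinear_simps)

lemma resolvent_symbol_compose:
  assumes z: "is_resolvent \<alpha> T R" and w: "is_resolvent \<beta> T R'"
  shows "resolvent_symbol z \<beta> R' o\<^sub>L resolvent_symbol \<beta> \<alpha> R = resolvent_symbol z \<alpha> R"
proof (rule blinfun_eqI)
  fix f
  let ?F = "blinfun_apply R f"
  have "?F = blinfun_apply (R' + (scalar_op (\<beta> - \<alpha>) o\<^sub>L (R' o\<^sub>L R))) f"
    using resolvent_identity[OF w z] by simp
  then have "?F = blinfun_apply R' f + (\<beta> - \<alpha>) *\<^sub>C blinfun_apply R' ?F"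
    by (simp add: blinfun.bilinear_simps)
  from this[symmetric] have *: "blinfun_apply R' f = ?F - (\<beta> - \<alpha>) *\<^sub>C blinfun_apply R' ?F"
    by (simp only: eq_diff_eq)
  have "blinfun_apply R' (f + (\<beta> - \<alpha>) *\<^sub>C ?F) = ?F"
    by (simp add: blinfun.bilinear_simps bounded_opsD[OF is_resolventD(1)[OF w]] *)
  then show "blinfun_apply (resolvent_symbol z \<beta> R' o\<^sub>L resolvent_symbol \<beta> \<alpha> R) f = blinfun_apply (resolvent_symbol z \<alpha> R) f"
    by (simp add: resolvent_symbol_apply scaleC_diff_left algebra_simps)
qed

lemma resolvent_symbol_self: "resolvent_symbol \<alpha> \<alpha> R = id_blinfun"
  by (rule blinfun_eqI) (simp add: resolvent_symbol_apply)

lemma resolvent_symbol_inverse: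
  assumes "is_resolvent \<alpha> T R" "is_resolvent \<beta> T R'"
  shows "resolvent_symbol \<alpha> \<beta> R' o\<^sub>L resolvent_symbol \<beta> \<alpha> R = id_blinfun"
  by (simp add: resolvent_symbol_compose[OF assms] resolvent_symbol_self)

lemma resolvent_symbol_in:
  assumes "op_algebra C" "R \<in> C"
  shows "resolvent_symbol z \<alpha> R \<in> C"
  using op_algebraD[OF assms(1)] assms(2) by (simp add: resolvent_symbol_def)

lemma is_resolvent_of_inverse:
  assumes R: "is_resolvent \<alpha> T R" and D: "D \<in> bounded_ops"
    and inv: "D o\<^sub>L resolvent_symbol z \<alpha> R = id_blinfun" "resolvent_symbol z \<alpha> R o\<^sub>L D = id_blinfun"
  shows "is_resolvent z T (R o\<^sub>L D)"
  unfolding is_resolvent_def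
proof (intro conjI allI iffI)
  show "R o\<^sub>L D \<in> bounded_ops" using is_resolventD(1)[OF R] D by auto
  have DB: "blinfun_apply D (blinfun_apply (resolvent_symbol z \<alpha> R) f) = f" for f
    using arg_cong[OF inv(1), of "\<lambda>A. blinfun_apply A f"] by simp
  have BD: "blinfun_apply (resolvent_symbol z \<alpha> R) (blinfun_apply D f) = f" for f
    using arg_cong[OF inv(2), of "\<lambda>A. blinfun_apply A f"] by simp
  fix f h
  {
    assume "(f, h) \<in> T"
    then have f: "f = blinfun_apply R (\<alpha> *\<^sub>C f - h)" by (subst (asm) is_resolventD(2)[OF R])
    have "z *\<^sub>C f - h = (\<alpha> *\<^sub>C f - h) + (z - \<alpha>) *\<^sub>C f" by (simp add: scaleC_diff_left)
    also have "\<dots> = blinfun_apply (resolvent_symbol z \<alpha> R) (\<alpha> *\<^sub>C f - h)"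
      by (simp add: resolvent_symbol_apply f[symmetric])
    finally show "f = blinfun_apply (R o\<^sub>L D) (z *\<^sub>C f - h)" using DB f by simp
  }
  {
    assume f: "f = blinfun_apply (R o\<^sub>L D) (z *\<^sub>C f - h)"
    define \<psi> where "\<psi> = blinfun_apply D (z *\<^sub>C f - h)"
    have f': "f = blinfun_apply R \<psi>" using f by (simp add: \<psi>_def)
    have "z *\<^sub>C f - h = \<psi> + (z - \<alpha>) *\<^sub>C f"
      using BD[of "z *\<^sub>C f - h"] by (simp add: \<psi>_def[symmetric] resolvent_symbol_apply f'[symmetric])
    then have "\<alpha> *\<^sub>C f - h = \<psi>" by (simp add: scaleC_diff_left algebra_simps)
    then show "(f, h) \<in> T" by (subst is_resolventD(2)[OF R]) (simp add: f')
  }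
qed

text \<open>
  By the product rule a change of the base point multiplies the symbol by an invertible element of the
  algebra, so one base point decides.
\<close>

lemma quot_spectrum_eq:
  assumes C: "op_algebra C" and J: "op_ideal C J"
    and R: "is_resolvent \<alpha> T R" and all: "\<And>\<beta> R'. is_resolvent \<beta> T R' \<Longrightarrow> R' \<in> C"
  shows "quot_spectrum C J T = {z. \<not> invertible_mod C J (resolvent_symbol z \<alpha> R)}"
proof -
  have unit: "\<one>\<^bsub>op_ring C Quot J\<^esub> \<oplus>\<^bsub>op_ring C Quot J\<^esub>
          (J +>\<^bsub>op_ring C\<^esub> (scalar_op (z - \<beta>) o\<^sub>L resolvent \<beta> T)) \<in> Units (op_ring C Quot J)
      \<longleftrightarrow> invertible_mod C J (resolvent_symbol z \<beta> (resolvent \<beta> T))" if "\<beta> \<in> resolvent_set T" for z \<beta>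
  proof -
    have "resolvent \<beta> T \<in> C" using all is_resolvent_resolvent[OF that] by blast
    then have in_C: "scalar_op (z - \<beta>) o\<^sub>L resolvent \<beta> T \<in> C" by (intro op_algebraD[OF C])
    show ?thesis
      unfolding one_plus_coset[OF C J in_C] resolvent_symbol_def
      by (rule coset_Units_iff[OF C J]) (intro op_algebraD[OF C] in_C)
  qed
  have transfer: "invertible_mod C J (resolvent_symbol z \<beta> R')"
    if "is_resolvent \<gamma> T R''" "is_resolvent \<beta> T R'" "invertible_mod C J (resolvent_symbol z \<gamma> R'')" for z \<beta> \<gamma> R' R''
    using invertible_mod_unit_right[OF C J resolvent_symbol_in[OF C all[OF that(2)]] resolvent_symbol_in[OF C all[OF that(1)]]
        resolvent_symbol_inverse[OF that(1,2)] resolvent_symbol_inverse[OF that(2,1)] that(3)]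
    by (simp only: resolvent_symbol_compose[OF that(2,1)])
  have "\<alpha> \<in> resolvent_set T" using R by (auto simp: resolvent_set_iff)
  moreover have "resolvent \<alpha> T = R" by (rule resolvent_eqI[OF R])
  ultimately show ?thesis
    unfolding quot_spectrum_def using unit transfer is_resolvent_resolvent R
    by (auto simp: set_eq_iff) blast+
qed

lemma quot_spectrum_subset_spectrum:
  assumes C: "op_algebra C" and J: "op_ideal C J" and all: "\<And>\<beta> R'. is_resolvent \<beta> T R' \<Longrightarrow> R' \<in> C"
  shows "quot_spectrum C J T \<subseteq> spectrum T"
proof -
  have "z \<notin> quot_spectrum C J T" if z: "z \<in> resolvent_set T" for z
  proof -
    have R: "is_resolvent z T (resolvent z T)" by (rule is_resolvent_resolvent[OF z])
    have "invertible_mod C J id_blinfun"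
      unfolding invertible_mod_def by (rule bexI[of _ id_blinfun]) (auto simp: op_idealD(2)[OF J] op_algebraD(1)[OF C])
    then show ?thesis by (simp add: quot_spectrum_eq[OF C J R all] resolvent_symbol_self)
  qed
  then show ?thesis by (auto simp: spectrum_def)
qed

section \<open>Inverse closedness of the standard algebra\<close>

lemma left_parametrix_std_algebra:
  assumes B: "B \<in> std_algebra" and K: "K \<in> std_algebra" and CB: "C o\<^sub>L B = id_blinfun + K"
  shows "\<exists>L\<in>std_algebra. \<exists>M\<in>std_algebra. L o\<^sub>L B = id_blinfun - (M o\<^sub>L K)"
proof (rule left_parametrix_in_subalgebra[OF closed_subalgebra_std_algebra std_algebra_adj B K])
  show "norm C + 1 > 0" by (simp add: add_nonneg_pos)
  fix f
  have "f = blinfun_apply C (blinfun_apply B f) - blinfun_apply K f"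
    using arg_cong[OF CB, of "\<lambda>T. blinfun_apply T f"] by (simp add: blinfun.bilinear_simps)
  then have "norm f \<le> norm (blinfun_apply C (blinfun_apply B f)) + norm (blinfun_apply K f)"
    by (metis norm_triangle_ineq4)
  also have "\<dots> \<le> norm C * norm (blinfun_apply B f) + norm (blinfun_apply K f)"
    by (intro add_right_mono norm_blinfun)
  also have "\<dots> \<le> (norm C + 1) * (norm (blinfun_apply B f) + norm (blinfun_apply K f))"
    by (simp add: algebra_simps)
  finally show "norm f \<le> (norm C + 1) * (norm (blinfun_apply B f) + norm (blinfun_apply K f))" .
qed

lemma inverse_in_std_algebra:
  assumes "B \<in> std_algebra" "C o\<^sub>L B = id_blinfun" "B o\<^sub>L C = id_blinfun"
  shows "C \<in> std_algebra"
proof -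
  obtain L M where L: "L \<in> std_algebra" "L o\<^sub>L B = id_blinfun - (M o\<^sub>L 0)"
    using left_parametrix_std_algebra[OF assms(1) std_algebraD(2), of C] assms(2) by auto
  have "C = (L o\<^sub>L B) o\<^sub>L C" using L(2) by simp
  also have "\<dots> = L" using assms(3) by (simp add: blinfun_compose_assoc)
  finally show ?thesis using L(1) by simp
qed

lemma resolvents_in_std_algebra:
  assumes R: "is_resolvent \<alpha> T R" "R \<in> std_algebra" and R': "is_resolvent z T R'"
  shows "R' \<in> std_algebra"
proof -
  have D: "resolvent_symbol \<alpha> z R' \<in> std_algebra"
    by (rule inverse_in_std_algebra[OF resolvent_symbol_in[OF op_algebra_std_algebra R(2)]
          resolvent_symbol_inverse[OF R(1) R'] resolvent_symbol_inverse[OF R' R(1)]])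
  have "R' = R o\<^sub>L resolvent_symbol \<alpha> z R'"
    by (rule trans[OF resolvent_identity[OF R(1) R']], rule blinfun_eqI)
      (simp add: resolvent_symbol_apply blinfun.bilinear_simps bounded_opsD[OF is_resolventD(1)[OF R(1)]])
  with D R(2) show ?thesis by (metis std_algebraD(4))
qed

text \<open>
  An inverse modulo compact operators of an element of the algebra differs from an element of the
  algebra by a compact operator only, so the element is also invertible modulo the larger ideal.
\<close>

lemma invertible_mod_compact_imp_std_ideal:
  assumes B: "B \<in> std_algebra" and inv: "invertible_mod bounded_ops compact_ops B" and s: "s \<in> S"
  shows "invertible_mod std_algebra (std_ideal S) B"
proof -
  obtain C where C: "C \<in> bounded_ops" "(C o\<^sub>L B) - id_blinfun \<in> compact_ops" "(B o\<^sub>L C) - id_blinfun \<in> compact_ops"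
    using inv by (auto simp: invertible_mod_def)
  define K where "K = (C o\<^sub>L B) - id_blinfun"
  define K' where "K' = (B o\<^sub>L C) - id_blinfun"
  have K: "K \<in> compact_ops" "K' \<in> compact_ops" using C by (simp_all add: K_def K'_def)
  have KA: "K \<in> std_algebra" by (rule std_ideal_subset[OF compact_ops_subset_std_ideal[OF K(1) s]])
  obtain L M where L: "L \<in> std_algebra" "M \<in> std_algebra" "L o\<^sub>L B = id_blinfun - (M o\<^sub>L K)"
    using left_parametrix_std_algebra[OF B KA, of C] by (auto simp: K_def)
  note bd = std_algebra_bounded[OF L(1)] std_algebra_bounded[OF L(2)] std_algebra_bounded[OF B] C(1)
  have 1: "(L o\<^sub>L B) - id_blinfun \<in> compact_ops"
    using L(3) compact_ops_uminus[OF compact_ops_left[OF bd(2) K(1)]] by simp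
  have "L o\<^sub>L (B o\<^sub>L C) = (L o\<^sub>L B) o\<^sub>L C" by (simp add: blinfun_compose_assoc)
  then have L_eq: "L = C - ((M o\<^sub>L K) o\<^sub>L C) - (L o\<^sub>L K')"
    unfolding L(3) by (simp add: K'_def compose_distribs algebra_simps)
  have BC: "B o\<^sub>L C = K' + id_blinfun" by (simp add: K'_def)
  have "(B o\<^sub>L L) - id_blinfun = (B o\<^sub>L (C - ((M o\<^sub>L K) o\<^sub>L C) - (L o\<^sub>L K'))) - id_blinfun"
    using L_eq by (rule arg_cong[where f = "\<lambda>T. (B o\<^sub>L T) - id_blinfun"])
  also have "\<dots> = K' - (B o\<^sub>L ((M o\<^sub>L K) o\<^sub>L C)) - (B o\<^sub>L (L o\<^sub>L K'))"
    by (simp add: compose_distribs BC)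
  finally have "(B o\<^sub>L L) - id_blinfun = K' - (B o\<^sub>L ((M o\<^sub>L K) o\<^sub>L C)) - (B o\<^sub>L (L o\<^sub>L K'))" .
  moreover have "K' - (B o\<^sub>L ((M o\<^sub>L K) o\<^sub>L C)) - (B o\<^sub>L (L o\<^sub>L K')) \<in> compact_ops"
    by (rule compact_ops_diff[OF compact_ops_diff[OF K(2)
            compact_ops_left[OF bd(3) compact_ops_right[OF bd(4) compact_ops_left[OF bd(2) K(1)]]]]
          compact_ops_left[OF bd(3) compact_ops_left[OF bd(1) K(2)]]])
  ultimately have 2: "(B o\<^sub>L L) - id_blinfun \<in> compact_ops" by simp
  show ?thesis
    unfolding invertible_mod_def
    using L(1) compact_ops_subset_std_ideal[OF 1 s] compact_ops_subset_std_ideal[OF 2 s] by blast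
qed

lemma S_spectrum_eq:
  assumes "is_resolvent \<alpha> T R" "R \<in> std_algebra"
  shows "S_spectrum S T = {z. \<not> invertible_mod std_algebra (std_ideal S) (resolvent_symbol z \<alpha> R)}"
  unfolding S_spectrum_def
  by (rule quot_spectrum_eq[OF op_algebra_std_algebra op_ideal_std_ideal assms(1)])
    (rule resolvents_in_std_algebra[OF assms])

lemma S_spectrum_subset_ess_spectrum:
  assumes R: "is_resolvent \<alpha> T R" "R \<in> std_algebra" and s: "s \<in> S"
  shows "S_spectrum S T \<subseteq> ess_spectrum T"
proof -
  have "ess_spectrum T = {z. \<not> invertible_mod bounded_ops compact_ops (resolvent_symbol z \<alpha> R)}"
    unfolding ess_spectrum_def
    by (rule quot_spectrum_eq[OF op_algebra_bounded_ops op_ideal_compact_ops R(1)]) (rule is_resolventD(1))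
  then show ?thesis
    using S_spectrum_eq[OF R] invertible_mod_compact_imp_std_ideal[OF resolvent_symbol_in[OF op_algebra_std_algebra R(2)] _ s] by auto
qed

lemma ess_spectrum_subset_spectrum: "ess_spectrum T \<subseteq> spectrum T"
  unfolding ess_spectrum_def
  by (rule quot_spectrum_subset_spectrum[OF op_algebra_bounded_ops op_ideal_compact_ops]) (rule is_resolventD(1))

lemma S_spectrum_cong:
  assumes R: "is_resolvent \<alpha> T R" "R \<in> std_algebra" and R': "is_resolvent \<alpha> T' R'" "R' \<in> std_algebra"
    and J: "R - R' \<in> std_ideal S"
  shows "S_spectrum S T = S_spectrum S T'"
proof -
  have "invertible_mod std_algebra (std_ideal S) (resolvent_symbol z \<alpha> R) \<longleftrightarrow>
    invertible_mod std_algebra (std_ideal S) (resolvent_symbol z \<alpha> R')" for z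
  proof (rule invertible_mod_cong[OF op_ideal_std_ideal])
    have "resolvent_symbol z \<alpha> R - resolvent_symbol z \<alpha> R' = scalar_op (z - \<alpha>) o\<^sub>L (R - R')"
      by (simp add: resolvent_symbol_def compose_distribs)
    then show "resolvent_symbol z \<alpha> R - resolvent_symbol z \<alpha> R' \<in> std_ideal S"
      using std_ideal_left[OF std_algebra_scalar_op J] by simp
  qed
  then show ?thesis by (simp add: S_spectrum_eq[OF R] S_spectrum_eq[OF R'])
qed

section \<open>Operators commuting with a translation that leaves the neighbourhoods of a set\<close>

lemma shift_tendsto_0_near:
  assumes leave: "\<And>x. \<forall>\<^sub>F n in sequentially. x + real n *\<^sub>R y \<notin> nbhd S r"
  shows "(\<lambda>n. norm (blinfun_apply (proj (nbhd S r)) (blinfun_apply (shift (real n *\<^sub>R y)) f))) \<longlonglongrightarrow> 0"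
proof -
  have "(\<lambda>n. blinfun_apply (proj {x. x + real n *\<^sub>R y \<in> nbhd S r}) f) \<longlonglongrightarrow> blinfun_apply (proj {}) f"
    by (rule proj_tendsto) (use leave in \<open>auto simp: measurable_translated_set nbhd_measurable\<close>)
  then have "(\<lambda>n. norm (blinfun_apply (proj {x. x + real n *\<^sub>R y \<in> nbhd S r}) f)) \<longlonglongrightarrow> 0"
    by (simp add: tendsto_norm_zero)
  moreover have "blinfun_apply (proj (nbhd S r)) (blinfun_apply (shift z) f)
      = blinfun_apply (shift z) (blinfun_apply (proj {x. x + z \<in> nbhd S r}) f)" for z
    using arg_cong[OF proj_shift[OF nbhd_measurable, of S r z], of "\<lambda>A. blinfun_apply A f"] by simp
  ultimately show ?thesis by simp
qed

text \<open>
  Up to a small error in norm, \<open>D\<close> depends only on the restriction of its argument to some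
  neighbourhood of \<open>S\<close>, and the translates of \<open>f\<close> leave that neighbourhood.
\<close>

lemma std_ideal_shift_tendsto_0:
  assumes leave: "\<And>x r. \<forall>\<^sub>F n in sequentially. x + real n *\<^sub>R y \<notin> nbhd S r"
    and D: "D \<in> std_ideal S"
  shows "(\<lambda>n. blinfun_apply D (blinfun_apply (shift (real n *\<^sub>R y)) f)) \<longlonglongrightarrow> 0"
proof (rule LIMSEQ_I)
  fix e :: real assume e: "e > 0"
  \<comment> \<open>adding one allows to divide by \<open>q\<close> when \<open>f\<close> is zero\<close>
  define q where "q = norm f + 1"
  have q: "q > 0" "norm f \<le> q" by (auto simp: q_def add_nonneg_pos)
  define \<delta> where "\<delta> = e / (2 * q)"
  have d: "\<delta> > 0" using e q by (simp add: \<delta>_def)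
  obtain D' where D': "D' \<in> near_supported S"
    "dist D' D < \<delta>"
    using D d unfolding std_ideal_def closure_approachable by blast
  obtain m :: nat where m: "\<And>k. real m \<le> k \<Longrightarrow> D' o\<^sub>L proj (nbhd S k) = D'"
    using D'(1) by (rule near_supportedE) blast
  let ?g = "\<lambda>n. blinfun_apply (shift (real n *\<^sub>R y)) f"
  let ?P = "proj (nbhd S (real m))"
  have D'P: "blinfun_apply D' (blinfun_apply ?P g) = blinfun_apply D' g" for g
    using arg_cong[OF m[of "real m"], of "\<lambda>A. blinfun_apply A g"] by simp
  have "(\<lambda>n. norm D' * norm (blinfun_apply ?P (?g n))) \<longlonglongrightarrow> norm D' * 0"
    by (intro tendsto_mult tendsto_const shift_tendsto_0_near leave)
  then have "\<forall>\<^sub>F n in sequentially. norm D' * norm (blinfun_apply ?P (?g n)) < e/2"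
    by (rule order_tendstoD) (use e in simp)
  then obtain N where N: "\<And>n. n \<ge> N \<Longrightarrow> norm D' * norm (blinfun_apply ?P (?g n)) < e/2"
    by (auto simp: eventually_sequentially)
  have "norm (blinfun_apply D (?g n)) < e" if "n \<ge> N" for n
  proof -
    have "norm (blinfun_apply D (?g n)) \<le> norm (blinfun_apply (D - D') (?g n)) + norm (blinfun_apply D' (?g n))"
      using norm_triangle_ineq[of "blinfun_apply (D - D') (?g n)" "blinfun_apply D' (?g n)"]
      by (simp add: blinfun.bilinear_simps)
    also have "norm (blinfun_apply D' (?g n)) \<le> norm D' * norm (blinfun_apply ?P (?g n))"
      using norm_blinfun[of D' "blinfun_apply ?P (?g n)"] by (simp add: D'P)
    also have "norm (blinfun_apply (D - D') (?g n)) \<le> \<delta> * norm f"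
    proof -
      have "norm (blinfun_apply (D - D') (?g n)) \<le> norm (D - D') * norm (?g n)" by (rule norm_blinfun)
      also have "\<dots> \<le> \<delta> * norm f"
        using D'(2) by (intro mult_mono) (auto simp: dist_norm norm_minus_commute less_imp_le[OF d])
      finally show ?thesis .
    qed
    also have "\<delta> * norm f \<le> e/2"
    proof -
      have "\<delta> * q = e/2" using q by (simp add: \<delta>_def)
      moreover have "\<delta> * norm f \<le> \<delta> * q" using d q by simp
      ultimately show ?thesis by simp
    qed
    finally show ?thesis using N[OF that] by simp
  qed
  then show "\<exists>N. \<forall>n\<ge>N. norm (blinfun_apply D (?g n) - 0) < e" by auto
qed

text \<open>
  Let \<open>B\<close> commute with a translation whose powers carry everything away from \<open>S\<close>. Conjugating an
  inverse of \<open>B\<close> modulo the ideal with these powers makes the errors tend strongly to zero. Hence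
  \<open>B\<close> is bounded below, and the conjugated right inverses show that the bounded left inverse which
  this provides is a right inverse as well.
\<close>

lemma invertible_of_translation_invariant:
  assumes leave: "\<And>x r. \<forall>\<^sub>F n in sequentially. x + real n *\<^sub>R y \<notin> nbhd S r"
    and B: "B \<in> std_algebra" and comm: "B o\<^sub>L shift y = shift y o\<^sub>L B"
    and inv: "invertible_mod std_algebra (std_ideal S) B"
  shows "\<exists>L\<in>std_algebra. L o\<^sub>L B = id_blinfun \<and> B o\<^sub>L L = id_blinfun"
proof -
  obtain C where C: "C \<in> std_algebra" "(C o\<^sub>L B) - id_blinfun \<in> std_ideal S" "(B o\<^sub>L C) - id_blinfun \<in> std_ideal S"
    using inv by (auto simp: invertible_mod_def)
  define U where "U n = shift (real n *\<^sub>R y)" for n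
  define U' where "U' n = shift (- (real n *\<^sub>R y))" for n
  have U_Suc: "U (Suc n) = shift y o\<^sub>L U n" for n by (simp add: U_def shift_compose algebra_simps)
  have comm_n: "B o\<^sub>L U n = U n o\<^sub>L B" for n
  proof (induction n)
    case (Suc n)
    have "B o\<^sub>L U (Suc n) = (B o\<^sub>L shift y) o\<^sub>L U n" by (simp add: U_Suc blinfun_compose_assoc)
    also have "\<dots> = shift y o\<^sub>L (B o\<^sub>L U n)" by (simp add: comm blinfun_compose_assoc)
    finally show ?case by (simp add: Suc U_Suc blinfun_compose_assoc)
  qed (simp add: U_def)
  have comm_app: "blinfun_apply B (blinfun_apply (U n) f) = blinfun_apply (U n) (blinfun_apply B f)" for n f
    using arg_cong[OF comm_n[of n], of "\<lambda>A. blinfun_apply A f"] by simp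
  have UU': "blinfun_apply (U n) (blinfun_apply (U' n) f) = f" "blinfun_apply (U' n) (blinfun_apply (U n) f) = f" for n f
    by (simp_all add: U_def U'_def shift_shift_apply)
  have comm_app': "blinfun_apply B (blinfun_apply (U' n) f) = blinfun_apply (U' n) (blinfun_apply B f)" for n f
    by (metis comm_app UU')
  define b where "b = norm C + 1"
  have b: "b > 0" by (simp add: b_def add_nonneg_pos)
  have low: "norm f \<le> b * (norm (blinfun_apply B f) + norm (blinfun_apply 0 f))" for f
  proof -
    have "norm f \<le> norm C * norm (blinfun_apply B f) + norm (blinfun_apply ((C o\<^sub>L B) - id_blinfun) (blinfun_apply (U n) f))" for n
    proof -
      have "norm f = norm (blinfun_apply (U n) f)" by (simp add: U_def)
      also have "\<dots> \<le> norm (blinfun_apply C (blinfun_apply B (blinfun_apply (U n) f)))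
          + norm (blinfun_apply ((C o\<^sub>L B) - id_blinfun) (blinfun_apply (U n) f))"
        using norm_triangle_ineq4[of "blinfun_apply C (blinfun_apply B (blinfun_apply (U n) f))" "blinfun_apply ((C o\<^sub>L B) - id_blinfun) (blinfun_apply (U n) f)"]
        by (simp add: blinfun.bilinear_simps)
      also have "norm (blinfun_apply C (blinfun_apply B (blinfun_apply (U n) f))) \<le> norm C * norm (blinfun_apply B f)"
        using norm_blinfun[of C "blinfun_apply B (blinfun_apply (U n) f)"] by (simp add: comm_app) (simp add: U_def)
      finally show ?thesis by simp
    qed
    moreover have "(\<lambda>n. norm C * norm (blinfun_apply B f) + norm (blinfun_apply ((C o\<^sub>L B) - id_blinfun) (blinfun_apply (U n) f)))
      \<longlonglongrightarrow> norm C * norm (blinfun_apply B f) + norm (0 :: 'a L2)"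
      unfolding U_def by (intro tendsto_add tendsto_const tendsto_norm std_ideal_shift_tendsto_0[OF leave C(2)])
    ultimately have "norm f \<le> norm C * norm (blinfun_apply B f)"
      using LIMSEQ_le_const by fastforce
    also have "\<dots> \<le> b * norm (blinfun_apply B f)" by (simp add: b_def distrib_right)
    finally show ?thesis by simp
  qed
  have "\<exists>L\<in>std_algebra. \<exists>M\<in>std_algebra. L o\<^sub>L B = id_blinfun - (M o\<^sub>L 0)"
    by (rule left_parametrix_in_subalgebra[OF closed_subalgebra_std_algebra _ B std_algebraD(2) b low])
      (rule std_algebra_adj)
  then obtain L where L: "L \<in> std_algebra" "L o\<^sub>L B = id_blinfun" by auto
  note LB = L(2)
  have LB_app: "blinfun_apply L (blinfun_apply B f) = f" for f
    using arg_cong[OF LB, of "\<lambda>A. blinfun_apply A f"] by simp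
  have "blinfun_apply B (blinfun_apply L f) = f" for f
  proof -
    \<comment> \<open>conjugated right inverses give approximate solutions of \<open>B v = f\<close>\<close>
    define v where "v n = blinfun_apply (U' n) (blinfun_apply C (blinfun_apply (U n) f))" for n
    have "(\<lambda>n. norm (blinfun_apply ((B o\<^sub>L C) - id_blinfun) (blinfun_apply (U n) f))) \<longlonglongrightarrow> norm (0 :: 'a L2)"
      unfolding U_def by (intro tendsto_norm std_ideal_shift_tendsto_0[OF leave C(3)])
    moreover have "norm (blinfun_apply B (v n) - f) = norm (blinfun_apply ((B o\<^sub>L C) - id_blinfun) (blinfun_apply (U n) f))" for n
    proof -
      have "blinfun_apply B (v n) - f = blinfun_apply (U' n) (blinfun_apply ((B o\<^sub>L C) - id_blinfun) (blinfun_apply (U n) f))"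
        by (simp add: v_def comm_app' blinfun.bilinear_simps UU')
      then show ?thesis by (simp add: U'_def)
    qed
    ultimately have "(\<lambda>n. norm (blinfun_apply B (v n) - f)) \<longlonglongrightarrow> 0" by simp
    then have Bv: "(\<lambda>n. blinfun_apply B (v n)) \<longlonglongrightarrow> f" by (simp add: LIM_zero_iff tendsto_norm_zero_iff)
    then have "(\<lambda>n. blinfun_apply L (blinfun_apply B (v n))) \<longlonglongrightarrow> blinfun_apply L f"
      by (rule blinfun.tendsto[OF tendsto_const])
    then have "v \<longlonglongrightarrow> blinfun_apply L f" by (simp add: LB_app)
    then have "(\<lambda>n. blinfun_apply B (v n)) \<longlonglongrightarrow> blinfun_apply B (blinfun_apply L f)"
      by (rule blinfun.tendsto[OF tendsto_const])
    with Bv show ?thesis using LIMSEQ_unique by blast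
  qed
  then have "B o\<^sub>L L = id_blinfun" by (intro blinfun_eqI) simp
  with L(1) LB show ?thesis by blast
qed

lemma spectrum_subset_S_spectrum:
  assumes leave: "\<And>x r. \<forall>\<^sub>F n in sequentially. x + real n *\<^sub>R y \<notin> nbhd S r"
    and R: "is_resolvent \<alpha> T R" "R \<in> std_algebra" and comm: "R o\<^sub>L shift y = shift y o\<^sub>L R"
  shows "spectrum T \<subseteq> S_spectrum S T"
proof
  fix z assume z: "z \<in> spectrum T"
  show "z \<in> S_spectrum S T"
  proof (rule ccontr)
    assume "z \<notin> S_spectrum S T"
    then have inv: "invertible_mod std_algebra (std_ideal S) (resolvent_symbol z \<alpha> R)"
      by (simp add: S_spectrum_eq[OF R])
    have "resolvent_symbol z \<alpha> R o\<^sub>L shift y = shift y o\<^sub>L resolvent_symbol z \<alpha> R"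
      using comm scalar_op_commute[OF shift_bounded_ops, of y "z - \<alpha>"]
      by (simp add: resolvent_symbol_def compose_distribs) (metis blinfun_compose_assoc)
    from invertible_of_translation_invariant[OF leave resolvent_symbol_in[OF op_algebra_std_algebra R(2)] this inv]
    obtain L where "L \<in> std_algebra" "L o\<^sub>L resolvent_symbol z \<alpha> R = id_blinfun" "resolvent_symbol z \<alpha> R o\<^sub>L L = id_blinfun"
      by blast
    then have "is_resolvent z T (R o\<^sub>L L)"
      by (intro is_resolvent_of_inverse[OF R(1)] std_algebra_bounded)
    then have "z \<in> resolvent_set T" by (auto simp: resolvent_set_iff)
    with z show False by (simp add: spectrum_def)
  qed
qed

section \<open>Smooth functions of compact support\<close>

lemma partial_deriv_eqI: "(f has_derivative f') (at x) \<Longrightarrow> partial_deriv b f x = f' b"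
  unfolding partial_deriv_def using frechet_derivative_at[of f f' x] by simp

lemma C_kD:
  assumes "C_k (Suc k) f"
  shows "(f has_derivative frechet_derivative f (at x)) (at x)" "b \<in> Basis \<Longrightarrow> C_k k (partial_deriv b f)"
  using assms by (auto simp: differentiable_on_def frechet_derivative_works)

lemma C_k_SucI:
  assumes "\<And>x. (f has_derivative f' x) (at x)" "\<And>b. b \<in> Basis \<Longrightarrow> C_k k (\<lambda>x. f' x b)"
  shows "C_k (Suc k) f"
proof -
  have "partial_deriv b f = (\<lambda>x. f' x b)" for b
    using partial_deriv_eqI[OF assms(1)] by (rule ext)
  with assms show ?thesis by (auto simp: differentiable_on_def differentiable_def)
qed

lemma C_k_Suc_imp: "C_k (Suc k) f \<Longrightarrow> C_k k f"
proof (induction k arbitrary: f)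
  case 0
  then show ?case by (simp add: differentiable_imp_continuous_on)
qed auto

lemma C_k_const: "C_k k (\<lambda>x. c)"
proof (induction k arbitrary: c)
  case (Suc k)
  show ?case by (rule C_k_SucI[where f' = "\<lambda>x y. 0"]) (auto simp: Suc)
qed simp

lemma C_k_add: "C_k k f \<Longrightarrow> C_k k g \<Longrightarrow> C_k k (\<lambda>x. f x + g x)"
proof (induction k arbitrary: f g)
  case (Suc k)
  show ?case
    by (rule C_k_SucI[OF has_derivative_add[OF C_kD(1)[OF Suc.prems(1)] C_kD(1)[OF Suc.prems(2)]]])
      (use Suc.IH[OF C_kD(2)[OF Suc.prems(1)] C_kD(2)[OF Suc.prems(2)]] in \<open>simp add: partial_deriv_def\<close>)
qed (auto intro: continuous_on_add)

lemma C_k_mult: "C_k k f \<Longrightarrow> C_k k g \<Longrightarrow> C_k k (\<lambda>x. f x * g x)"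
proof (induction k arbitrary: f g)
  case (Suc k)
  have "C_k k (\<lambda>x. f x * partial_deriv b g x + partial_deriv b f x * g x)" if "b \<in> Basis" for b
    by (rule C_k_add[OF Suc.IH[OF C_k_Suc_imp[OF Suc.prems(1)] C_kD(2)[OF Suc.prems(2) that]]
          Suc.IH[OF C_kD(2)[OF Suc.prems(1) that] C_k_Suc_imp[OF Suc.prems(2)]]])
  then show ?case
    by (intro C_k_SucI[OF has_derivative_mult[OF C_kD(1)[OF Suc.prems(1)] C_kD(1)[OF Suc.prems(2)]]])
      (simp add: partial_deriv_def)
qed (auto intro: continuous_on_mult)

lemma C_k_prod: "(\<And>i. i \<in> I \<Longrightarrow> C_k k (f i)) \<Longrightarrow> C_k k (\<lambda>x. \<Prod>i\<in>I. f i x)"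
  by (induction I rule: infinite_finite_induct) (auto intro: C_k_const C_k_mult)

lemma has_derivative_translation:
  "(f has_derivative f') (at (x - y)) \<Longrightarrow> ((\<lambda>x. f (x - y)) has_derivative f') (at x)"
proof -
  have "((\<lambda>x. x - y) has_derivative (\<lambda>x. x)) (at x)" by (auto intro!: derivative_eq_intros)
  then show "(f has_derivative f') (at (x - y)) \<Longrightarrow> ((\<lambda>x. f (x - y)) has_derivative f') (at x)"
    using has_derivative_compose by fastforce
qed

lemma C_k_translation: "C_k k f \<Longrightarrow> C_k k (\<lambda>x. f (x - y))"
proof (induction k arbitrary: f)
  case 0
  then show ?case by (auto intro!: continuous_on_compose2[of UNIV f] continuous_intros)
next
  case (Suc k)
  show ?case
    by (rule C_k_SucI[OF has_derivative_translation[OF C_kD(1)[OF Suc.prems]]])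
      (use Suc.IH[OF C_kD(2)[OF Suc.prems]] in \<open>simp add: partial_deriv_def\<close>)
qed

lemma partial_deriv_translation:
  assumes "C_k (Suc 0) f"
  shows "partial_deriv b (\<lambda>x. f (x - y)) = (\<lambda>x. partial_deriv b f (x - y))"
  by (rule ext, subst partial_deriv_eqI[OF has_derivative_translation[OF C_kD(1)[OF assms]]])
    (simp add: partial_deriv_def)

lemma partial_deriv_add:
  assumes "C_k (Suc 0) f" "C_k (Suc 0) g"
  shows "partial_deriv b (\<lambda>x. f x + g x) = (\<lambda>x. partial_deriv b f x + partial_deriv b g x)"
  by (rule ext, subst partial_deriv_eqI[OF has_derivative_add[OF C_kD(1)[OF assms(1)] C_kD(1)[OF assms(2)]]])
    (simp add: partial_deriv_def)

lemma partial_deriv_cmult: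
  assumes "C_k (Suc 0) f"
  shows "partial_deriv b (\<lambda>x. c * f x) = (\<lambda>x. c * partial_deriv b f x)"
  by (rule ext, subst partial_deriv_eqI[OF has_derivative_mult_right[OF C_kD(1)[OF assms]]])
    (simp add: partial_deriv_def)

lemma test_function_iff: "test_function f \<longleftrightarrow> (\<forall>k. C_k k f) \<and> (\<exists>R>0. \<forall>x. norm x > R \<longrightarrow> f x = 0)"
proof -
  have "bounded (support_on UNIV f) \<longleftrightarrow> (\<exists>R>0. \<forall>x. norm x > R \<longrightarrow> f x = 0)"
    unfolding bounded_pos support_on_def by (auto simp: not_less[symmetric])
  then show ?thesis by (simp add: test_function_def)
qed

lemma test_functionD:
  assumes "test_function f"
  shows "C_k k f" "continuous_on UNIV f"
  using assms C_k.simps(1)[of f] by (auto simp: test_function_iff simp del: C_k.simps)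

lemma test_functionE:
  assumes "test_function f"
  obtains R where "R > 0" "\<And>x. norm x > R \<Longrightarrow> f x = 0"
  using assms by (auto simp: test_function_iff)

lemma test_function_add:
  assumes "test_function f" "test_function g"
  shows "test_function (\<lambda>x. f x + g x)"
proof -
  obtain R where R: "R > 0" "\<And>x. norm x > R \<Longrightarrow> f x = 0" using assms(1) by (rule test_functionE) blast
  obtain R' where R': "R' > 0" "\<And>x. norm x > R' \<Longrightarrow> g x = 0" using assms(2) by (rule test_functionE) blast
  have "\<exists>R>0. \<forall>x. norm x > R \<longrightarrow> f x + g x = 0"
    using R R' by (intro exI[of _ "max R R'"]) auto
  then show ?thesis using assms by (simp add: test_function_iff C_k_add)
qed

lemma test_function_cmult: "test_function f \<Longrightarrow> test_function (\<lambda>x. c * f x)"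
  by (auto simp: test_function_iff C_k_mult C_k_const)

lemma test_function_translation: "test_function f \<Longrightarrow> test_function (\<lambda>x. f (x - y))"
proof -
  assume f: "test_function f"
  then obtain R where R: "R > 0" "\<And>x. norm x > R \<Longrightarrow> f x = 0" by (rule test_functionE) blast
  have "f (x - y) = 0" if "norm x > R + norm y" for x
    using that norm_triangle_sub[of x y] by (intro R(2)) simp
  with R(1) f show ?thesis
    unfolding test_function_iff by (auto simp: C_k_translation intro!: exI[of _ "R + norm y"] add_pos_nonneg)
qed

lemma partial_deriv_support:
  assumes "\<And>x. norm x > R \<Longrightarrow> f x = 0" "norm x > R"
  shows "partial_deriv b f x = 0"
proof -
  have "open {x::'a. norm x > R}" by (intro open_Collect_less continuous_intros)
  then have "(f has_derivative (\<lambda>_. 0)) (at x)"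
    using assms by (intro has_derivative_transform_within_open[of "\<lambda>_. 0" "\<lambda>_. 0" x UNIV "{x. norm x > R}" f]) auto
  then show ?thesis by (simp add: partial_deriv_eqI)
qed

lemma test_function_partial_deriv:
  assumes f: "test_function f" and b: "b \<in> Basis"
  shows "test_function (partial_deriv b f)"
proof -
  obtain R where R: "R > 0" "\<And>x. norm x > R \<Longrightarrow> f x = 0" using f by (rule test_functionE) blast
  have "partial_deriv b f x = 0" if "norm x > R" for x
    by (rule partial_deriv_support[OF R(2) that])
  with R(1) show ?thesis
    unfolding test_function_iff using C_kD(2)[OF test_functionD(1)[OF f] b] by blast
qed

lemma test_function_sum: "(\<And>i. i \<in> I \<Longrightarrow> test_function (f i)) \<Longrightarrow> test_function (\<lambda>x. \<Sum>i\<in>I. f i x)"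
proof (induction I rule: infinite_finite_induct)
  case (insert i I)
  then show ?case using test_function_add[of "f i" "\<lambda>x. \<Sum>i\<in>I. f i x"] by simp
qed (auto simp: test_function_iff C_k_const intro: exI[of _ 1])

lemma test_function_laplacian: "test_function f \<Longrightarrow> test_function (laplacian f)"
  unfolding laplacian_def[abs_def] by (intro test_function_sum test_function_partial_deriv)

lemma laplacian_translation:
  assumes "test_function f"
  shows "laplacian (\<lambda>x. f (x - y)) = (\<lambda>x. laplacian f (x - y))"
proof
  fix x
  have "partial_deriv b (partial_deriv b (\<lambda>x. f (x - y))) = (\<lambda>x. partial_deriv b (partial_deriv b f) (x - y))"
    if "b \<in> Basis" for b
    using that assms by (simp add: partial_deriv_translation test_functionD(1) test_function_partial_deriv del: C_k.simps)
  then show "laplacian (\<lambda>x. f (x - y)) x = laplacian f (x - y)" by (simp add: laplacian_def)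
qed

lemma laplacian_add:
  assumes "test_function f" "test_function g"
  shows "laplacian (\<lambda>x. f x + g x) = (\<lambda>x. laplacian f x + laplacian g x)"
proof
  fix x
  have "partial_deriv b (partial_deriv b (\<lambda>x. f x + g x)) = (\<lambda>x. partial_deriv b (partial_deriv b f) x + partial_deriv b (partial_deriv b g) x)"
    if "b \<in> Basis" for b
    using that assms by (simp add: partial_deriv_add test_functionD(1) test_function_partial_deriv del: C_k.simps)
  then show "laplacian (\<lambda>x. f x + g x) x = laplacian f x + laplacian g x" by (simp add: laplacian_def sum.distrib)
qed

lemma laplacian_cmult:
  assumes "test_function f"
  shows "laplacian (\<lambda>x. c * f x) = (\<lambda>x. c * laplacian f x)"
proof
  fix x
  have "partial_deriv b (partial_deriv b (\<lambda>x. c * f x)) = (\<lambda>x. c * partial_deriv b (partial_deriv b f) x)"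
    if "b \<in> Basis" for b
    using that assms by (simp add: partial_deriv_cmult test_functionD(1) test_function_partial_deriv del: C_k.simps)
  then show "laplacian (\<lambda>x. c * f x) x = c * laplacian f x" by (simp add: laplacian_def sum_distrib_left)
qed

lemma sq_integrable_indicator_cball: "sq_integrable (\<lambda>x. of_real \<eta> * indicator (cball z R) x)"
  and norm_L2_of_indicator_cball: "norm (L2_of (\<lambda>x. of_real \<eta> * indicator (cball z R) x)) = \<bar>\<eta>\<bar> * sqrt (measure lebesgue (cball z R))"
proof -
  have m: "(\<lambda>x. of_real \<eta> * indicator (cball z R) x :: complex) \<in> borel_measurable lebesgue"
    by (intro borel_measurable_times borel_measurable_const borel_measurable_indicator) auto
  have eq: "(norm (of_real \<eta> * indicator (cball z R) x :: complex))\<^sup>2 = \<eta>\<^sup>2 * indicator (cball z R) x" for x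
    by (simp add: indicator_def norm_mult)
  have i: "integrable lebesgue (\<lambda>x. \<eta>\<^sup>2 * indicat_real (cball z R) x)"
    by (intro integrable_mult_right integrable_real_indicator)
      (use lmeasurable_cball[of z R] in \<open>auto simp: fmeasurable_def\<close>)
  show s: "sq_integrable (\<lambda>x. of_real \<eta> * indicator (cball z R) x)"
    unfolding sq_integrable_def eq using m i by simp
  show "norm (L2_of (\<lambda>x. of_real \<eta> * indicator (cball z R) x)) = \<bar>\<eta>\<bar> * sqrt (measure lebesgue (cball z R))"
    unfolding norm_L2_of[OF s] eq by (simp add: real_sqrt_mult)
qed

lemma norm_L2_of_le_sup:
  assumes f: "f \<in> borel_measurable lebesgue" and b: "\<And>x. norm (f x) \<le> \<eta>" "\<And>x. x \<notin> cball z R \<Longrightarrow> f x = 0"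
  shows "sq_integrable f" "norm (L2_of f) \<le> \<eta> * sqrt (measure lebesgue (cball z R))"
proof -
  have e: "\<eta> \<ge> 0" using b(1)[of z] norm_ge_zero order_trans by blast
  have le: "norm (f x) \<le> norm (of_real \<eta> * indicator (cball z R) x :: complex)" for x
    using b[of x] e by (auto simp: indicator_def norm_mult)
  show s: "sq_integrable f"
    by (rule sq_integrable_bound[OF sq_integrable_indicator_cball f, where c = 1]) (use le in simp)
  have "norm (L2_of f) \<le> norm (L2_of (\<lambda>x. of_real \<eta> * indicator (cball z R) x))"
    by (rule norm_L2_of_mono[OF s sq_integrable_indicator_cball]) (use le in simp)
  then show "norm (L2_of f) \<le> \<eta> * sqrt (measure lebesgue (cball z R))"
    using e by (simp add: norm_L2_of_indicator_cball)
qed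

lemma continuous_borel_lebesgue: "continuous_on UNIV f \<Longrightarrow> f \<in> borel_measurable lebesgue"
  for f :: "'a::euclidean_space \<Rightarrow> 'b::topological_space"
  by (rule measurable_completion) (simp add: borel_measurable_continuous_onI)

lemma compact_support_bounded:
  fixes f :: "'a::euclidean_space \<Rightarrow> complex"
  assumes "continuous_on UNIV f" "\<And>x. norm x > R \<Longrightarrow> f x = 0"
  obtains M where "\<And>x. norm (f x) \<le> M"
proof -
  have "compact (f ` cball 0 R)"
    by (rule compact_continuous_image[OF continuous_on_subset[OF assms(1)]]) auto
  then obtain M where M: "\<And>y. y \<in> f ` cball 0 R \<Longrightarrow> norm y \<le> M"
    using compact_imp_bounded bounded_iff by metis
  have "norm (f x) \<le> max M 0" for x
    using M[of "f x"] assms(2)[of x] by (cases "norm x > R") (auto simp: not_less)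
  then show thesis by (rule that)
qed

lemma sq_integrable_test_function: "test_function f \<Longrightarrow> sq_integrable f"
proof -
  assume f: "test_function f"
  then obtain R where R: "R > 0" "\<And>x. norm x > R \<Longrightarrow> f x = 0" by (rule test_functionE) blast
  obtain M where M: "\<And>x. norm (f x) \<le> M"
    using compact_support_bounded[OF test_functionD(2)[OF f] R(2)] by blast
  show ?thesis
    by (rule norm_L2_of_le_sup(1)[OF continuous_borel_lebesgue[OF test_functionD(2)[OF f]] M, of 0 R])
      (use R in auto)
qed

lemma compact_support_uniformly_continuous:
  fixes f :: "'a::euclidean_space \<Rightarrow> complex"
  assumes c: "continuous_on UNIV f" and R: "\<And>x. norm x > R \<Longrightarrow> f x = 0" and e: "e > 0"
  shows "\<exists>d>0. d \<le> 1 \<and> (\<forall>x y. norm (x - y) < d \<longrightarrow> norm (f x - f y) < e)"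
proof -
  have "uniformly_continuous_on (cball 0 (R + 1)) f"
    by (rule compact_uniformly_continuous[OF continuous_on_subset[OF c]]) auto
  then obtain d where d: "d > 0" "\<And>x y. x \<in> cball 0 (R+1) \<Longrightarrow> y \<in> cball 0 (R+1) \<Longrightarrow> dist y x < d \<Longrightarrow> dist (f y) (f x) < e"
    unfolding uniformly_continuous_on_def using e by blast
  have "norm (f x - f y) < e" if xy: "norm (x - y) < min d 1" for x y
  proof (cases "x \<in> cball 0 (R+1) \<and> y \<in> cball 0 (R+1)")
    case True
    then show ?thesis using d(2)[of y x] xy by (simp add: dist_norm)
  next
    case False
    then have "norm x > R" "norm y > R"
      using xy norm_triangle_sub[of x y] norm_triangle_sub[of y x] by (auto simp: norm_minus_commute)
    then show ?thesis using R e by simp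
  qed
  then show ?thesis using d(1) by (intro exI[of _ "min d 1"]) auto
qed

section \<open>Second differences\<close>

definition discrete_laplacian :: "real \<Rightarrow> ('a::euclidean_space \<Rightarrow> complex) \<Rightarrow> 'a \<Rightarrow> complex" where
  "discrete_laplacian h f x = (\<Sum>b\<in>Basis. (f (x - h *\<^sub>R b) + f (x + h *\<^sub>R b) - 2 * f x) / of_real (h\<^sup>2))"

lemma has_vector_derivative_along:
  assumes "C_k (Suc 0) f"
  shows "((\<lambda>s. f (x + s *\<^sub>R b)) has_vector_derivative partial_deriv b f (x + s *\<^sub>R b)) (at s within T)"
proof -
  have "((\<lambda>s. f (x + s *\<^sub>R b)) has_derivative (\<lambda>r. frechet_derivative f (at (x + s *\<^sub>R b)) (r *\<^sub>R b))) (at s within T)"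
    by (rule has_derivative_compose[where f = "\<lambda>s. x + s *\<^sub>R b" and g = f, OF _ C_kD(1)[OF assms]])
      (auto intro!: derivative_eq_intros)
  moreover have "linear (frechet_derivative f (at (x + s *\<^sub>R b)))"
    using C_kD(1)[OF assms] by (rule has_derivative_linear)
  ultimately show ?thesis
    by (simp add: has_vector_derivative_def partial_deriv_def linear_cmul)
qed

text \<open>
  The mean value inequality is applied twice: to \<open>\<phi>' s - s \<phi>'' 0\<close>, where \<open>\<phi>\<close> is the restriction of \<open>f\<close>
  to the line through \<open>x\<close> in direction \<open>b\<close>, and then to \<open>\<phi> s + \<phi> (- s) - s\<^sup>2 \<phi>'' 0\<close>.
\<close>

lemma second_difference_bound:
  assumes f: "test_function f" and b: "b \<in> Basis" and h: "h > 0"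
    and g: "\<And>x y. norm (x - y) \<le> h \<Longrightarrow> norm (partial_deriv b (partial_deriv b f) x - partial_deriv b (partial_deriv b f) y) \<le> e"
  shows "norm ((f (x - h *\<^sub>R b) + f (x + h *\<^sub>R b) - 2 * f x) / of_real (h\<^sup>2) - partial_deriv b (partial_deriv b f) x) \<le> 2 * e"
proof -
  let ?f' = "partial_deriv b f" and ?f'' = "partial_deriv b (partial_deriv b f)"
  define \<phi> where "\<phi> s = f (x + s *\<^sub>R b)" for s
  define \<phi>' where "\<phi>' s = ?f' (x + s *\<^sub>R b)" for s
  have d1: "(\<phi> has_vector_derivative \<phi>' s) (at s within T)" for s T
    unfolding \<phi>_def \<phi>'_def by (rule has_vector_derivative_along[OF test_functionD(1)[OF f]])
  have d2: "(\<phi>' has_vector_derivative ?f'' (x + s *\<^sub>R b)) (at s within T)" for s T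
    unfolding \<phi>'_def by (rule has_vector_derivative_along[OF test_functionD(1)[OF test_function_partial_deriv[OF f b]]])
  have e0: "e \<ge> 0" using g[of 0 0] h by simp
  have lin: "norm (\<phi>' r - \<phi>' 0 - r *\<^sub>R ?f'' x) \<le> h * e" if r: "r \<in> {-h..h}" for r
  proof -
    have "norm (\<phi>' r - \<phi>' 0 - (r - 0) *\<^sub>R ?f'' (x + 0 *\<^sub>R b)) \<le> norm (r - 0) * e"
    proof (rule vector_differentiable_bound_linearization[where S = "{-h..h}"])
      show "closed_segment 0 r \<subseteq> {- h..h}" using r h by (auto simp: closed_segment_eq_real_ivl)
      fix s assume "s \<in> {-h..h}"
      then show "norm (?f'' (x + s *\<^sub>R b) - ?f'' (x + 0 *\<^sub>R b)) \<le> e"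
        using b by (intro g) (auto simp: abs_le_iff)
    qed (use d2 h in auto)
    also have "\<dots> \<le> h * e" using r e0 by (intro mult_right_mono) auto
    finally show ?thesis by simp
  qed
  \<comment> \<open>\<open>G h - G 0\<close> is \<open>h\<^sup>2\<close> times the error, and the derivative of \<open>G\<close> vanishes at \<open>0\<close>\<close>
  define G where "G s = \<phi> s + \<phi> (- s) - (s * s) *\<^sub>R ?f'' x" for s
  define G' where "G' s = \<phi>' s - \<phi>' (- s) - (2 * s) *\<^sub>R ?f'' x" for s
  have dG: "(G has_vector_derivative G' s) (at s within {0..h})" for s
  proof -
    have "((\<lambda>s. \<phi> (- s)) has_vector_derivative (-1) *\<^sub>R \<phi>' (- s)) (at s within {0..h})"
      using vector_diff_chain_within[OF has_vector_derivative_minus[OF has_vector_derivative_id], of \<phi> "\<phi>' (- s)" s "{0..h}"] d1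
      by (simp add: o_def)
    then show ?thesis
      unfolding G_def G'_def by (auto intro!: derivative_eq_intros d1 simp: algebra_simps)
  qed
  have "norm (G h - G 0 - (h - 0) *\<^sub>R G' 0) \<le> norm (h - 0) * (2 * (h * e))"
  proof (rule vector_differentiable_bound_linearization[where S = "{0..h}", OF dG])
    fix s assume s: "s \<in> {0..h}"
    have "G' s - G' 0 = (\<phi>' s - \<phi>' 0 - s *\<^sub>R ?f'' x) - (\<phi>' (- s) - \<phi>' 0 - (- s) *\<^sub>R ?f'' x)"
    proof -
      have "(2 * s) *\<^sub>R ?f'' x = s *\<^sub>R ?f'' x + s *\<^sub>R ?f'' x"
        unfolding mult_2 by (rule scaleR_left_distrib)
      then show ?thesis by (simp add: G'_def)
    qed
    also have "norm \<dots> \<le> h * e + h * e"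
      by (rule order_trans[OF norm_triangle_ineq4 add_mono[OF lin lin]]) (use s in auto)
    finally show "norm (G' s - G' 0) \<le> 2 * (h * e)" by (simp only: mult_2)
  qed (use h in \<open>auto simp: closed_segment_eq_real_ivl\<close>)
  then have "norm (\<phi> h + \<phi> (- h) - (h * h) *\<^sub>R ?f'' x - 2 * \<phi> 0) \<le> (h * h) * (2 * e)"
    using h by (simp add: G_def G'_def mult_ac)
  moreover have "\<phi> h + \<phi> (- h) - (h * h) *\<^sub>R ?f'' x - 2 * \<phi> 0
      = of_real (h * h) * ((f (x - h *\<^sub>R b) + f (x + h *\<^sub>R b) - 2 * f x) / of_real (h\<^sup>2) - ?f'' x)"
    using h by (simp add: \<phi>_def scaleR_conv_of_real power2_eq_square field_simps)
  ultimately have "(h * h) * norm ((f (x - h *\<^sub>R b) + f (x + h *\<^sub>R b) - 2 * f x) / of_real (h\<^sup>2) - ?f'' x) \<le> (h * h) * (2 * e)"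
    using h by (simp add: norm_mult)
  then show ?thesis using h by simp
qed

text \<open>
  The second derivatives of a test function are uniformly continuous, which makes the error bound for
  second differences uniform in \<open>x\<close>.
\<close>

lemma discrete_laplacian_uniform:
  assumes f: "test_function f" and e: "e > 0"
  shows "\<exists>d>0. \<forall>h. 0 < h \<and> h < d \<longrightarrow> (\<forall>x. norm (discrete_laplacian h f x - laplacian f x) \<le> e)"
proof -
  define \<eta> where "\<eta> = e / (2 * DIM('a))"
  have \<eta>: "\<eta> > 0" using e by (simp add: \<eta>_def)
  have "\<exists>d>0. \<forall>x y. norm (x - y) < d \<longrightarrow> norm (partial_deriv b (partial_deriv b f) x - partial_deriv b (partial_deriv b f) y) < \<eta>"
    if b: "b \<in> Basis" for b
  proof -
    have t: "test_function (partial_deriv b (partial_deriv b f))"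
      by (intro test_function_partial_deriv f b)
    then obtain R where "R > 0" "\<And>x. norm x > R \<Longrightarrow> partial_deriv b (partial_deriv b f) x = 0" by (rule test_functionE) blast
    with compact_support_uniformly_continuous[OF test_functionD(2)[OF t] _ \<eta>] show ?thesis by blast
  qed
  then obtain d where d: "\<And>b. b \<in> Basis \<Longrightarrow> d b > 0"
    "\<And>b x y. b \<in> Basis \<Longrightarrow> norm (x - y) < d b \<Longrightarrow> norm (partial_deriv b (partial_deriv b f) x - partial_deriv b (partial_deriv b f) y) < \<eta>"
    by metis
  define \<delta> where "\<delta> = Min (d ` (Basis :: 'a set))"
  have \<delta>: "\<delta> > 0" using d(1) by (simp add: \<delta>_def)
  have "norm (discrete_laplacian h f x - laplacian f x) \<le> e" if h: "0 < h" "h < \<delta>" for h x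
  proof -
    have "norm (discrete_laplacian h f x - laplacian f x)
        \<le> (\<Sum>b\<in>(Basis::'a set). norm ((f (x - h *\<^sub>R b) + f (x + h *\<^sub>R b) - 2 * f x) / of_real (h\<^sup>2) - partial_deriv b (partial_deriv b f) x))"
      unfolding discrete_laplacian_def laplacian_def sum_subtractf[symmetric] by (rule norm_sum)
    also have "\<dots> \<le> (\<Sum>b\<in>(Basis::'a set). 2 * \<eta>)"
    proof (intro sum_mono second_difference_bound[OF f _ h(1)])
      fix b :: 'a and y z :: 'a assume b: "b \<in> Basis" and "norm (y - z) \<le> h"
      moreover have "\<delta> \<le> d b" using b by (simp add: \<delta>_def)
      ultimately have "norm (y - z) < d b" using h by linarith
      then show "norm (partial_deriv b (partial_deriv b f) y - partial_deriv b (partial_deriv b f) z) \<le> \<eta>"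
        using d(2)[OF b] by (simp add: less_imp_le)
    qed
    also have "\<dots> = e" by (simp add: \<eta>_def)
    finally show ?thesis .
  qed
  with \<delta> show ?thesis by blast
qed

lemma laplacian_support:
  assumes R: "\<And>x. norm x > R \<Longrightarrow> f x = 0" and x: "norm x > R"
  shows "laplacian f x = 0"
proof -
  have "partial_deriv b f y = 0" if "norm y > R" for b y
    using R that by (rule partial_deriv_support)
  then have "partial_deriv b (partial_deriv b f) x = 0" for b
    using x by (rule partial_deriv_support)
  then show ?thesis by (simp add: laplacian_def)
qed

lemma discrete_laplacian_support:
  assumes R: "\<And>x. norm x > R \<Longrightarrow> f x = 0" and x: "norm x > R + 1" and h: "0 < h" "h \<le> 1"
  shows "discrete_laplacian h f x = 0"
proof -
  have "f (x - h *\<^sub>R b) = 0" "f (x + h *\<^sub>R b) = 0" "f x = 0" if "b \<in> Basis" for b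
    using that x h norm_triangle_sub[of x "h *\<^sub>R b"] norm_triangle_ineq2[of x "- (h *\<^sub>R b)"]
    by (auto intro!: R)
  then show ?thesis by (simp add: discrete_laplacian_def)
qed

section \<open>Bump functions and density\<close>

text \<open>
  The functions \<open>t\<^sup>-\<^sup>n exp (-1/t)\<close> for \<open>t > 0\<close>, continued by zero. This family is closed under
  differentiation up to linear combinations, so all of its members are smooth.
\<close>

definition exp_bump :: "nat \<Rightarrow> real \<Rightarrow> real" where
  "exp_bump n t = (if t > 0 then inverse t ^ n * exp (- inverse t) else 0)"

lemma exp_bump_tendsto_0: "(exp_bump n \<longlongrightarrow> 0) (at_right 0)"
proof -
  have "((\<lambda>t::real. inverse t ^ n / exp (inverse t)) \<longlongrightarrow> 0) (at_right 0)"
    by (rule filterlim_compose[OF tendsto_power_div_exp_0 filterlim_inverse_at_top_right])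
  then show ?thesis
    by (rule Lim_transform_eventually)
      (auto simp: eventually_at_right_less exp_bump_def exp_minus divide_inverse intro!: eventually_at_rightI[of 0 1])
qed

text \<open>
  At the origin the difference quotient of the \<open>n\<close>-th function is the next function of the family.
\<close>

lemma DERIV_exp_bump: "DERIV (exp_bump n) t :> - real n * exp_bump (Suc n) t + exp_bump (Suc (Suc n)) t"
proof (cases t "0::real" rule: linorder_cases)
  case less
  have "((\<lambda>_. 0) has_real_derivative 0) (at t)" by (rule DERIV_const)
  then have "(exp_bump n has_real_derivative 0) (at t)"
    by (rule has_field_derivative_transform_within_open[where S = "{..<0}"]) (use less in \<open>auto simp: exp_bump_def\<close>)
  then show ?thesis using less by (simp add: exp_bump_def)
next
  case greater
  define s where "s = inverse t"
  have "((\<lambda>s. s ^ n * exp (- s)) has_real_derivative real n * s ^ (n - 1) * exp (- s) - s ^ n * exp (- s)) (at s)"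
    by (auto intro!: derivative_eq_intros)
  moreover have "(inverse has_real_derivative - (s * s)) (at t)"
    using DERIV_inverse[of t UNIV] greater by (simp add: s_def)
  ultimately have "((\<lambda>t. inverse t ^ n * exp (- inverse t)) has_real_derivative
      (real n * s ^ (n - 1) * exp (- s) - s ^ n * exp (- s)) * - (s * s)) (at t)"
    unfolding s_def by (rule DERIV_chain2)
  also have "(real n * s ^ (n - 1) * exp (- s) - s ^ n * exp (- s)) * - (s * s)
      = - real n * (s ^ Suc n * exp (- s)) + s ^ Suc (Suc n) * exp (- s)"
    by (cases n) (simp_all add: algebra_simps)
  finally have "((\<lambda>t. inverse t ^ n * exp (- inverse t)) has_real_derivative
      - real n * (inverse t ^ Suc n * exp (- inverse t)) + inverse t ^ Suc (Suc n) * exp (- inverse t)) (at t)"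
    unfolding s_def .
  then have "(exp_bump n has_real_derivative
      - real n * (inverse t ^ Suc n * exp (- inverse t)) + inverse t ^ Suc (Suc n) * exp (- inverse t)) (at t)"
    by (rule has_field_derivative_transform_within_open[where S = "{0<..}"]) (use greater in \<open>auto simp: exp_bump_def\<close>)
  then show ?thesis using greater by (simp add: exp_bump_def)
next
  case equal
  have "((\<lambda>s. (exp_bump n s - exp_bump n 0) / (s - 0)) \<longlongrightarrow> 0) (at 0)"
  proof (rule filterlim_split_at)
    show "((\<lambda>s. (exp_bump n s - exp_bump n 0) / (s - 0)) \<longlongrightarrow> 0) (at_left 0)"
      by (rule tendsto_eventually) (auto simp: exp_bump_def intro!: eventually_at_leftI[of "-1"])
    show "((\<lambda>s. (exp_bump n s - exp_bump n 0) / (s - 0)) \<longlongrightarrow> 0) (at_right 0)"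
      by (rule Lim_transform_eventually[OF exp_bump_tendsto_0[of "Suc n"]])
        (auto simp: exp_bump_def divide_inverse mult_ac intro!: eventually_at_rightI[of 0 1])
  qed
  then show ?thesis using equal by (simp add: has_field_derivative_iff exp_bump_def)
qed

lemma exp_bump_range: "0 \<le> exp_bump 0 t" "exp_bump 0 t \<le> 1"
  by (auto simp: exp_bump_def)

lemma C_k_exp_bump: "C_k k (\<lambda>x. of_real (exp_bump n (x \<bullet> v + c)))"
proof (induction k arbitrary: n)
  case 0
  have "continuous_on UNIV (exp_bump n)"
    by (rule DERIV_continuous_on) (rule has_field_derivative_at_within[OF DERIV_exp_bump])
  then show ?case
    by (auto intro!: continuous_intros continuous_on_compose2[of UNIV "exp_bump n"])
next
  case (Suc k)
  let ?D = "\<lambda>t. - real n * exp_bump (Suc n) t + exp_bump (Suc (Suc n)) t"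
  show ?case
  proof (rule C_k_SucI)
    fix x
    have "((\<lambda>x. exp_bump n (x \<bullet> v + c)) has_derivative (\<lambda>y. ?D (x \<bullet> v + c) * (y \<bullet> v))) (at x)"
    proof -
      have "((\<lambda>x. x \<bullet> v + c) has_derivative (\<lambda>y. y \<bullet> v)) (at x)" by (auto intro!: derivative_eq_intros)
      from has_derivative_compose[OF this DERIV_exp_bump[of n "x \<bullet> v + c", unfolded has_field_derivative_def]]
      show ?thesis .
    qed
    then show "((\<lambda>x. complex_of_real (exp_bump n (x \<bullet> v + c))) has_derivative (\<lambda>y. of_real (?D (x \<bullet> v + c) * (y \<bullet> v)))) (at x)"
      by (rule has_derivative_of_real)
    fix b :: 'a
    have "C_k k (\<lambda>x. of_real (b \<bullet> v) * (of_real (- real n) * complex_of_real (exp_bump (Suc n) (x \<bullet> v + c)) + of_real (exp_bump (Suc (Suc n)) (x \<bullet> v + c))))"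
      by (intro C_k_mult C_k_const C_k_add Suc)
    then show "C_k k (\<lambda>x. complex_of_real (?D (x \<bullet> v + c) * (b \<bullet> v)))"
      by (simp add: mult_ac)
  qed
qed

text \<open>
  As \<open>c\<close> grows these increase to the indicator function of \<open>box l u\<close>. The arguments are written as
  \<open>x \<bullet> v + t\<close>, the form of an affine function for which smoothness has been shown.
\<close>

definition box_bump :: "real \<Rightarrow> 'a::euclidean_space \<Rightarrow> 'a \<Rightarrow> 'a \<Rightarrow> real" where
  "box_bump c l u x = (\<Prod>b\<in>Basis. exp_bump 0 (x \<bullet> (c *\<^sub>R b) + - (c * (l \<bullet> b))) * exp_bump 0 (x \<bullet> (- c *\<^sub>R b) + c * (u \<bullet> b)))"

lemma box_bump_range: "0 \<le> box_bump c l u x" "box_bump c l u x \<le> 1"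
  unfolding box_bump_def by (auto intro!: prod_nonneg prod_le_1 mult_nonneg_nonneg mult_le_one exp_bump_range)

lemma box_bump_pos_iff:
  assumes "c > 0"
  shows "box_bump c l u x > 0 \<longleftrightarrow> x \<in> box l u"
proof -
  have arg: "x \<bullet> (c *\<^sub>R b) + - (c * (l \<bullet> b)) = c * (x \<bullet> b - l \<bullet> b)" "x \<bullet> (- c *\<^sub>R b) + c * (u \<bullet> b) = c * (u \<bullet> b - x \<bullet> b)" for b
    by (simp_all add: algebra_simps)
  have "exp_bump 0 t > 0 \<longleftrightarrow> t > 0" "exp_bump 0 t = 0 \<longleftrightarrow> \<not> t > 0" for t by (auto simp: exp_bump_def)
  then have "box_bump c l u x = 0 \<longleftrightarrow> x \<notin> box l u"
    unfolding box_bump_def arg using assms by (auto simp: mem_box zero_less_mult_iff)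
  with box_bump_range(1)[of c l u x] show ?thesis by (metis less_le)
qed

lemma box_bump_0: "c > 0 \<Longrightarrow> x \<notin> box l u \<Longrightarrow> box_bump c l u x = 0"
  using box_bump_pos_iff[of c l u x] box_bump_range(1)[of c l u x] by linarith

lemma test_function_box_bump:
  assumes "c > 0"
  shows "test_function (\<lambda>x. of_real (box_bump c l u x))"
proof -
  have "C_k k (\<lambda>x. complex_of_real (box_bump c l u x))" for k
    unfolding box_bump_def of_real_prod of_real_mult by (intro C_k_prod C_k_mult C_k_exp_bump)
  moreover obtain R where "R > 0" "\<And>x. x \<in> box l u \<Longrightarrow> norm x \<le> R"
    using bounded_box[of l u] by (auto simp: bounded_pos)
  moreover from this have "\<forall>x. norm x > R \<longrightarrow> complex_of_real (box_bump c l u x) = 0"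
    using box_bump_0[OF assms] by (auto simp: not_less[symmetric])
  ultimately show ?thesis unfolding test_function_iff by blast
qed

lemma box_bump_tendsto: "(\<lambda>n. box_bump (real (Suc n)) l u x) \<longlonglongrightarrow> indicator (box l u) x"
proof (cases "x \<in> box l u")
  case False
  then show ?thesis by (simp add: box_bump_0 del: of_nat_Suc)
next
  case True
  have e: "(\<lambda>n. exp_bump 0 (real (Suc n) * t)) \<longlonglongrightarrow> 1" if "t > 0" for t
  proof -
    have "(\<lambda>n. exp (- (inverse (real (Suc n)) * inverse t))) \<longlonglongrightarrow> exp (- (0 * inverse t))"
      by (intro tendsto_intros LIMSEQ_inverse_real_of_nat)
    then show ?thesis using that by (simp add: exp_bump_def zero_less_mult_iff)
  qed
  have "(\<lambda>n. box_bump (real (Suc n)) l u x) \<longlonglongrightarrow> (\<Prod>b\<in>(Basis::'a set). 1 * 1)"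
    unfolding box_bump_def
  proof (intro tendsto_prod tendsto_mult)
    fix b :: 'a assume b: "b \<in> Basis"
    have "(\<lambda>n. exp_bump 0 (real (Suc n) * (x \<bullet> b - l \<bullet> b))) \<longlonglongrightarrow> 1" "(\<lambda>n. exp_bump 0 (real (Suc n) * (u \<bullet> b - x \<bullet> b))) \<longlonglongrightarrow> 1"
      using True b by (auto simp: mem_box simp del: of_nat_Suc intro!: e)
    then show "(\<lambda>n. exp_bump 0 (x \<bullet> (real (Suc n) *\<^sub>R b) + - (real (Suc n) * (l \<bullet> b)))) \<longlonglongrightarrow> 1"
      "(\<lambda>n. exp_bump 0 (x \<bullet> (- real (Suc n) *\<^sub>R b) + real (Suc n) * (u \<bullet> b))) \<longlonglongrightarrow> 1"
      by (simp_all add: algebra_simps)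
  qed
  with True show ?thesis by simp
qed

text \<open>
  Almost every value of \<open>\<phi>\<close> is the limit of averages over shrinking boxes.
\<close>

lemma AE_eq_0_of_box_integrals:
  fixes \<phi> :: "'a::euclidean_space \<Rightarrow> real"
  assumes i: "\<And>l u. set_integrable lebesgue (cbox l u) \<phi>"
    and z: "\<And>l u. (\<integral>x. indicator (box l u) x * \<phi> x \<partial>lebesgue) = 0"
  shows "AE x in lebesgue. \<phi> x = 0"
proof -
  have I: "\<phi> integrable_on cbox l u" for l u using set_lebesgue_integral_eq_integral(1)[OF i] .
  have Z: "integral (cbox l u) \<phi> = 0" for l u
  proof -
    have "set_integrable lebesgue (box l u) \<phi>"
      by (rule set_integrable_subset[OF i[of l u]]) (auto simp: box_subset_cbox)
    then have "integral (box l u) \<phi> = (LINT x:box l u|lebesgue. \<phi> x)"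
      by (simp add: set_lebesgue_integral_eq_integral(2))
    also have "\<dots> = 0" using z[of l u] by (simp add: set_lebesgue_integral_def)
    finally show ?thesis by (simp add: integral_open_interval)
  qed
  obtain N where N: "negligible N"
    "\<And>x e. x \<notin> N \<Longrightarrow> 0 < e \<Longrightarrow> \<exists>d>0. \<forall>h. 0 < h \<and> h < d \<longrightarrow> norm (integral (cbox x (x + h *\<^sub>R One)) \<phi> /\<^sub>R h ^ DIM('a) - \<phi> x) < e"
    using integrable_ccontinuous_explicit[OF I] by metis
  have "\<phi> x = 0" if xN: "x \<notin> N" for x
  proof (rule ccontr)
    assume "\<phi> x \<noteq> 0"
    then obtain d where d: "d > 0" "\<And>h. 0 < h \<Longrightarrow> h < d \<Longrightarrow> norm (integral (cbox x (x + h *\<^sub>R One)) \<phi> /\<^sub>R h ^ DIM('a) - \<phi> x) < \<bar>\<phi> x\<bar>"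
      using N(2)[OF xN, of "\<bar>\<phi> x\<bar>"] by auto
    from d(2)[of "d/2"] d(1) show False by (simp add: Z)
  qed
  moreover have "N \<in> null_sets lebesgue" using N(1) by (simp add: negligible_iff_null_sets)
  ultimately show ?thesis by (intro AE_I'[of N]) auto
qed

definition test_space :: "'a::euclidean_space L2 set" where
  "test_space = {L2_of f |f. test_function f}"

lemma subspace_test_space: "subspace test_space"
  unfolding subspace_def
proof (intro conjI ballI allI)
  have "test_function (\<lambda>x::'a. 0)" by (auto simp: test_function_iff C_k_const intro: exI[of _ 1])
  then show "0 \<in> (test_space :: 'a L2 set)" unfolding test_space_def by (force simp: L2_of_zero[symmetric])
  fix f g :: "'a L2" assume "f \<in> test_space" "g \<in> test_space"
  then obtain F G where "test_function F" "test_function G" "f = L2_of F" "g = L2_of G" by (auto simp: test_space_def)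
  then show "f + g \<in> test_space"
    unfolding test_space_def
    by (auto intro!: exI[of _ "\<lambda>x. F x + G x"] simp: test_function_add L2_of_add sq_integrable_test_function)
next
  fix r and f :: "'a L2" assume "f \<in> test_space"
  then obtain F where "test_function F" "f = L2_of F" by (auto simp: test_space_def)
  then show "r *\<^sub>R f \<in> test_space"
    unfolding test_space_def
    by (auto intro!: exI[of _ "\<lambda>x. of_real r * F x"] simp: test_function_cmult L2_of_scaleC sq_integrable_test_function scaleC_of_real)
qed

text \<open>
  A function orthogonal to all box bumps and to their multiples by the imaginary unit has zero
  integral over every box, and then it vanishes by Lebesgue's differentiation theorem.
\<close>

lemma closure_test_space: "closure test_space = (UNIV :: 'a::euclidean_space L2 set)"
proof (rule subspace_dense_of_orthogonal[OF subspace_closure[OF subspace_test_space] closed_closure])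
  fix g :: "'a L2" assume orth: "\<And>u. u \<in> closure test_space \<Longrightarrow> g \<bullet> u = 0"
  let ?g = "rep_L2 g"
  have sg: "integrable lebesgue (\<lambda>x. (norm (?g x))\<^sup>2)"
    using sq_integrable_rep_L2[of g] by (simp add: sq_integrable_def)
  have zero: "AE x in lebesgue. ?g x \<bullet> w = 0" if w: "norm w = 1" for w :: complex
  proof (rule AE_eq_0_of_box_integrals)
    have le: "\<bar>?g x \<bullet> w\<bar> \<le> 1 + (norm (?g x))\<^sup>2" for x
    proof -
      have "\<bar>?g x \<bullet> w\<bar> \<le> norm (?g x)" using Cauchy_Schwarz_ineq2[of "?g x" w] w by simp
      also have "\<dots> \<le> 1 + (norm (?g x))\<^sup>2"
        using sum_squares_bound[of 1 "norm (?g x)"] norm_ge_zero[of "?g x"] by (simp; linarith)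
      finally show ?thesis .
    qed
    have ib: "integrable lebesgue (\<lambda>x. indicator K x * (1 + (norm (?g x))\<^sup>2))" if K: "K \<in> lmeasurable" for K
    proof -
      have "integrable lebesgue (\<lambda>x. indicat_real K x)"
        using K by (intro integrable_real_indicator) (auto simp: fmeasurable_def)
      moreover have "integrable lebesgue (\<lambda>x. indicat_real K x * (norm (?g x))\<^sup>2)"
        using integrable_mult_indicator[OF fmeasurableD[OF K] sg] by simp
      ultimately show ?thesis by (simp add: distrib_left)
    qed
    show "set_integrable lebesgue (cbox l u) (\<lambda>x. ?g x \<bullet> w)" for l u
      unfolding set_integrable_def
    proof (rule Bochner_Integration.integrable_bound[OF ib[of "cbox l u"]])
      show "AE x in lebesgue. norm (indicat_real (cbox l u) x *\<^sub>R (?g x \<bullet> w)) \<le> norm (indicat_real (cbox l u) x * (1 + (norm (?g x))\<^sup>2))"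
        using le by (auto simp: indicator_def)
      show "(\<lambda>x. indicat_real (cbox l u) x *\<^sub>R (?g x \<bullet> w)) \<in> borel_measurable lebesgue"
        by (intro borel_measurable_scaleR borel_measurable_indicator borel_measurable_inner) auto
    qed simp
    fix l u :: 'a
    let ?b = "\<lambda>n x. box_bump (real (Suc n)) l u x"
    have bm: "(\<lambda>x. complex_of_real (?b n x)) \<in> borel_measurable lebesgue" for n
      using sq_integrable_test_function[OF test_function_box_bump[of "real (Suc n)" l u]] by (simp add: sq_integrable_def)
    have bm': "?b n \<in> borel_measurable lebesgue" for n
      using measurable_compose[OF bm[of n] borel_measurable_Re] by simp
    have "(\<integral>x. ?b n x * (?g x \<bullet> w) \<partial>lebesgue) = 0" for n
    proof -
      have t: "test_function (\<lambda>x. w * of_real (?b n x))"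
        by (intro test_function_cmult test_function_box_bump) simp
      then have "L2_of (\<lambda>x. w * of_real (?b n x)) \<in> closure test_space"
        by (intro subsetD[OF closure_subset]) (auto simp: test_space_def)
      from orth[OF this] have "L2_of ?g \<bullet> L2_of (\<lambda>x. w * of_real (?b n x)) = 0" by (simp add: L2_of_rep_L2)
      then have "(\<integral>x. ?g x \<bullet> (w * of_real (?b n x)) \<partial>lebesgue) = 0"
        by (simp only: inner_L2_of[OF sq_integrable_rep_L2 sq_integrable_test_function[OF t]])
      moreover have "?g x \<bullet> (w * of_real (?b n x)) = ?b n x * (?g x \<bullet> w)" for x
        by (simp add: inner_complex_def algebra_simps)
      ultimately show ?thesis by simp
    qed
    moreover have "(\<lambda>n. \<integral>x. ?b n x * (?g x \<bullet> w) \<partial>lebesgue) \<longlonglongrightarrow> (\<integral>x. indicator (box l u) x * (?g x \<bullet> w) \<partial>lebesgue)"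
    proof (rule integral_dominated_convergence[where w = "\<lambda>x. indicator (box l u) x * (1 + (norm (?g x))\<^sup>2)"])
      show "AE x in lebesgue. (\<lambda>n. ?b n x * (?g x \<bullet> w)) \<longlonglongrightarrow> indicator (box l u) x * (?g x \<bullet> w)"
        by (intro AE_I2 tendsto_mult box_bump_tendsto tendsto_const)
      show "AE x in lebesgue. norm (?b n x * (?g x \<bullet> w)) \<le> indicator (box l u) x * (1 + (norm (?g x))\<^sup>2)" for n
      proof (rule AE_I2)
        fix x
        show "norm (?b n x * (?g x \<bullet> w)) \<le> indicator (box l u) x * (1 + (norm (?g x))\<^sup>2)"
        proof (cases "x \<in> box l u")
          case True
          have "\<bar>?b n x\<bar> * \<bar>?g x \<bullet> w\<bar> \<le> 1 * (1 + (norm (?g x))\<^sup>2)"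
            using box_bump_range[of "real (Suc n)" l u x] le[of x] by (intro mult_mono) auto
          with True show ?thesis by (simp add: abs_mult)
        qed (simp add: box_bump_0 del: of_nat_Suc)
      qed
      show "integrable lebesgue (\<lambda>x. indicator (box l u) x * (1 + (norm (?g x))\<^sup>2))" by (rule ib) simp
      show "(\<lambda>x. ?b n x * (?g x \<bullet> w)) \<in> borel_measurable lebesgue" for n
        by (intro borel_measurable_times borel_measurable_inner bm') auto
      show "(\<lambda>x. indicator (box l u) x * (?g x \<bullet> w)) \<in> borel_measurable lebesgue"
        by (intro borel_measurable_times borel_measurable_inner borel_measurable_indicator) auto
    qed
    ultimately show "(\<integral>x. indicator (box l u) x * (?g x \<bullet> w) \<partial>lebesgue) = 0"
      by (simp add: LIMSEQ_const_iff)
  qed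
  \<comment> \<open>the inner product with \<open>1\<close> gives the real part and that with \<open>\<i>\<close> the imaginary part\<close>
  have "AE x in lebesgue. ?g x = 0"
  proof -
    have "AE x in lebesgue. ?g x \<bullet> 1 = 0" "AE x in lebesgue. ?g x \<bullet> \<i> = 0" by (rule zero, simp)+
    then show ?thesis by eventually_elim (auto simp: inner_complex_def complex_eq_iff)
  qed
  then have "AE x in lebesgue. ?g x = rep_L2 0 x" using rep_zero by eventually_elim simp
  then show "g = 0" by (rule L2_eqI)
qed

lemma dense_test_space:
  assumes "e > 0"
  obtains F where "test_function F" "norm (f - L2_of F) < e"
proof -
  have "f \<in> closure test_space" by (simp add: closure_test_space)
  then obtain g where "g \<in> test_space" "dist g f < e" using assms by (auto simp: closure_approachable)
  then show thesis using that by (auto simp: test_space_def dist_norm norm_minus_commute)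
qed

section \<open>Strong continuity of translations\<close>

text \<open>
  Translations are isometric, so it suffices to consider the dense set of test functions, which are
  uniformly continuous with supports in a common ball.
\<close>

lemma shift_uniformly_continuous:
  fixes f :: "'a::euclidean_space L2"
  assumes e: "e > 0"
  shows "\<exists>d>0. \<forall>y z. norm (y - z) < d \<longrightarrow> norm (blinfun_apply (shift y) f - blinfun_apply (shift z) f) < e"
proof -
  obtain F where F: "test_function F" "norm (f - L2_of F) < e/3"
    by (rule dense_test_space[of "e/3" f]) (use e in auto)
  obtain R where R: "R > 0" "\<And>x. norm x > R \<Longrightarrow> F x = 0" using F(1) by (rule test_functionE) blast
  \<comment> \<open>a bound for the norm of functions bounded by one on the common support, made positive\<close>
  define \<mu> where "\<mu> = sqrt (measure lebesgue (cball (0::'a) (R + 1))) + 1"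
  have \<mu>: "\<mu> > 0" by (simp add: \<mu>_def add_nonneg_pos)
  obtain d where d: "d > 0" "d \<le> 1" "\<And>x y. norm (x - y) < d \<Longrightarrow> norm (F x - F y) < e / (3 * \<mu>)"
    using compact_support_uniformly_continuous[OF test_functionD(2)[OF F(1)], of R "e / (3 * \<mu>)"] R(2) e \<mu> by auto
  note sF = sq_integrable_test_function[OF F(1)]
  have w: "norm (blinfun_apply (shift w) (L2_of F) - L2_of F) < e/3" if w: "norm w < d" for w
  proof -
    have "blinfun_apply (shift w) (L2_of F) - L2_of F = L2_of (\<lambda>x. F (x - w) - F x)"
      by (simp add: shift_L2_of sF L2_of_diff sq_integrable_translation)
    also have "norm \<dots> \<le> e / (3 * \<mu>) * sqrt (measure lebesgue (cball (0::'a) (R + 1)))"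
    proof (rule norm_L2_of_le_sup(2))
      show "(\<lambda>x. F (x - w) - F x) \<in> borel_measurable lebesgue"
        by (intro continuous_borel_lebesgue continuous_on_diff test_functionD(2)[OF F(1)] test_functionD(2)[OF test_function_translation[OF F(1)]])
      show "norm (F (x - w) - F x) \<le> e / (3 * \<mu>)" for x
        using d(3)[of "x - w" x] w by (simp add: less_imp_le)
      show "F (x - w) - F x = 0" if "x \<notin> cball 0 (R + 1)" for x
        using that w d(2) norm_triangle_sub[of x w] by (simp add: R(2))
    qed
    also have "\<dots> < e / (3 * \<mu>) * \<mu>" using e \<mu> by (intro mult_strict_left_mono) (auto simp: \<mu>_def)
    finally show ?thesis using \<mu> by simp
  qed
  have "norm (blinfun_apply (shift y) f - blinfun_apply (shift z) f) < e" if yz: "norm (y - z) < d" for y z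
  proof -
    let ?u = "blinfun_apply (shift (y - z)) f"
    have "blinfun_apply (shift y) f - blinfun_apply (shift z) f = blinfun_apply (shift z) (?u - f)"
      by (simp add: blinfun.bilinear_simps shift_shift_apply)
    then have "norm (blinfun_apply (shift y) f - blinfun_apply (shift z) f) = norm (?u - f)" by simp
    also have "?u - f = blinfun_apply (shift (y - z)) (f - L2_of F) + (blinfun_apply (shift (y - z)) (L2_of F) - L2_of F) - (f - L2_of F)"
      by (simp add: blinfun.bilinear_simps)
    also have "norm \<dots> \<le> norm (f - L2_of F) + norm (blinfun_apply (shift (y - z)) (L2_of F) - L2_of F) + norm (f - L2_of F)"
      by (intro order_trans[OF norm_triangle_ineq4] add_right_mono order_trans[OF norm_triangle_ineq]) simp
    also have "\<dots> < e" using w[OF yz] F(2) by simp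
    finally show ?thesis .
  qed
  with d(1) show ?thesis by blast
qed

lemma continuous_on_shift: "continuous_on UNIV (\<lambda>y. blinfun_apply (shift y) f)"
  unfolding continuous_on_iff
proof (intro ballI allI impI)
  fix y :: 'a and e :: real assume "e > 0"
  from shift_uniformly_continuous[OF this, of f] show "\<exists>d>0. \<forall>z\<in>UNIV. dist z y < d \<longrightarrow> dist (blinfun_apply (shift z) f) (blinfun_apply (shift y) f) < e"
    unfolding dist_norm by blast
qed

section \<open>The discrete resolvent\<close>

definition shift_sum :: "real \<Rightarrow> 'a::euclidean_space op" where
  "shift_sum h = (\<Sum>b\<in>Basis. shift (h *\<^sub>R b) + shift (- (h *\<^sub>R b)))"

text \<open>The bounded operator \<open>a\<close> minus the discrete Laplacian of step \<open>h\<close>.\<close>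

definition discrete_op :: "real \<Rightarrow> real \<Rightarrow> 'a::euclidean_space op" where
  "discrete_op a h = (a + 2 * DIM('a) / h\<^sup>2) *\<^sub>R id_blinfun - (1 / h\<^sup>2) *\<^sub>R shift_sum h"

lemma blinfun_apply_sum: "blinfun_apply (\<Sum>i\<in>I. A i) f = (\<Sum>i\<in>I. blinfun_apply (A i) f)"
  by (induction I rule: infinite_finite_induct) (auto simp: blinfun.bilinear_simps)

lemma norm_shift_sum_apply: "norm (blinfun_apply (shift_sum h) f) \<le> 2 * DIM('a) * norm f"
  for f :: "'a::euclidean_space L2"
proof -
  have "norm (blinfun_apply (shift_sum h) f) \<le> (\<Sum>b\<in>(Basis::'a set). norm f + norm f)"
    unfolding shift_sum_def blinfun_apply_sum
    by (rule sum_norm_le) (simp add: blinfun.bilinear_simps norm_triangle_le)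
  then show ?thesis by simp
qed

text \<open>
  In dimension \<open>d\<close> the \<open>2 d\<close> translations with weight \<open>1 / h\<^sup>2\<close> have norm at most \<open>2 d / h\<^sup>2\<close>, and the
  diagonal term exceeds this by \<open>a\<close>.
\<close>

lemma discrete_op_lower_bound:
  assumes "a > 0" "h > 0"
  shows "a * norm f \<le> norm (blinfun_apply (discrete_op a h) f)"
proof -
  let ?s = "2 * DIM('a) / h\<^sup>2"
  have "(a + ?s) * norm f = norm ((a + ?s) *\<^sub>R f)" using assms by simp
  also have "(a + ?s) *\<^sub>R f = blinfun_apply (discrete_op a h) f + (1 / h\<^sup>2) *\<^sub>R blinfun_apply (shift_sum h) f"
    by (simp add: discrete_op_def blinfun.bilinear_simps)
  also have "norm \<dots> \<le> norm (blinfun_apply (discrete_op a h) f) + (1 / h\<^sup>2) * (2 * DIM('a) * norm f)"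
    by (intro order_trans[OF norm_triangle_ineq] add_left_mono)
      (use divide_right_mono[OF norm_shift_sum_apply[of h f], of "h\<^sup>2"] in simp)
  also have "(1 / h\<^sup>2) * (2 * DIM('a) * norm f) = ?s * norm f" by simp
  finally show ?thesis by (simp add: distrib_right)
qed

text \<open>
  Since translations are isometric, \<open>h\<^sup>2 (f \<bullet> discrete_op a h f)\<close> equals \<open>h\<^sup>2 a \<parallel>f\<parallel>\<^sup>2\<close> plus the sum over all
  coordinate directions of the squared norms of the differences of \<open>f\<close>; the lemma keeps one of these
  terms. It replaces the bound of the gradient by the quadratic form of the Laplacian.
\<close>

lemma discrete_op_energy:
  assumes "h > 0" "b \<in> Basis" "a \<ge> 0"
  shows "(norm (blinfun_apply (shift (h *\<^sub>R b)) f - f))\<^sup>2 \<le> h\<^sup>2 * (f \<bullet> blinfun_apply (discrete_op a h) f)"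
proof -
  let ?N = "\<lambda>b. (norm (blinfun_apply (shift (h *\<^sub>R b)) f - f))\<^sup>2"
  have s: "f \<bullet> blinfun_apply (shift (- y)) f = f \<bullet> blinfun_apply (shift y) f" for y
    using inner_shift[of y f "blinfun_apply (shift (- y)) f"] by (simp add: shift_shift_apply inner_commute)
  have N: "?N b = 2 * (f \<bullet> f) - 2 * (f \<bullet> blinfun_apply (shift (h *\<^sub>R b)) f)" for b
    by (simp add: power2_norm_eq_inner inner_diff_left inner_diff_right inner_shift inner_commute)
  have "(\<Sum>b\<in>(Basis::'a set). ?N b) = 2 * DIM('a) * (f \<bullet> f) - f \<bullet> blinfun_apply (shift_sum h) f"
    unfolding N shift_sum_def blinfun_apply_sum
    by (simp add: sum_subtractf blinfun.bilinear_simps inner_sum_right inner_add_right s)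
  moreover have "h\<^sup>2 * (f \<bullet> blinfun_apply (discrete_op a h) f)
      = (h\<^sup>2 * (a + 2 * DIM('a) / h\<^sup>2)) * (f \<bullet> f) - (h\<^sup>2 * (1 / h\<^sup>2)) * (f \<bullet> blinfun_apply (shift_sum h) f)"
    unfolding discrete_op_def by (simp add: blinfun.bilinear_simps inner_diff_right right_diff_distrib)
  moreover have "h\<^sup>2 * (a + 2 * DIM('a) / h\<^sup>2) = h\<^sup>2 * a + 2 * DIM('a)" "h\<^sup>2 * (1 / h\<^sup>2) = 1"
    using assms(1) by (simp_all add: distrib_left)
  ultimately have "h\<^sup>2 * (f \<bullet> blinfun_apply (discrete_op a h) f) = h\<^sup>2 * a * (f \<bullet> f) + (\<Sum>b\<in>(Basis::'a set). ?N b)"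
    by (simp add: distrib_right)
  moreover have "?N b \<le> (\<Sum>b\<in>(Basis::'a set). ?N b)"
    by (rule member_le_sum) (use assms in auto)
  moreover have "0 \<le> h\<^sup>2 * a * (f \<bullet> f)" using assms by simp
  ultimately show ?thesis by simp
qed

definition discrete_resolvent :: "real \<Rightarrow> real \<Rightarrow> 'a::euclidean_space op" where
  "discrete_resolvent a h =
    (SOME R. R o\<^sub>L discrete_op a h = id_blinfun \<and> discrete_op a h o\<^sub>L R = id_blinfun)"

lemma closed_subalgebra_UNIV: "closed_subalgebra UNIV"
  by (simp add: closed_subalgebra_def)

lemma closed_subalgebra_sum:
  "closed_subalgebra C \<Longrightarrow> (\<And>i. i \<in> I \<Longrightarrow> A i \<in> C) \<Longrightarrow> (\<Sum>i\<in>I. A i) \<in> C"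
  by (auto simp: closed_subalgebra_def intro: subspace_sum)

text \<open>
  The operator is a positive multiple of \<open>1 - E\<close>, where \<open>E\<close> is a multiple of a sum of translations
  with norm less than one.
\<close>

lemma discrete_op_inverse_in:
  assumes C: "closed_subalgebra C" "\<And>y. shift y \<in> C" and ah: "a > 0" "h > 0"
  shows "\<exists>R\<in>C. R o\<^sub>L discrete_op a h = id_blinfun \<and> discrete_op a h o\<^sub>L R = id_blinfun"
proof -
  note alg = closed_subalgebraD[OF C(1)]
  define k where "k = a + 2 * DIM('a) / h\<^sup>2"
  have k: "k > 0" using ah by (simp add: k_def add_pos_nonneg)
  define E where "E = (1 / (k * h\<^sup>2)) *\<^sub>R (shift_sum h :: 'a op)"
  have "discrete_op a h = k *\<^sub>R id_blinfun - (1 / h\<^sup>2) *\<^sub>R (shift_sum h :: 'a op)"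
    by (simp add: discrete_op_def k_def)
  then have op: "discrete_op a h = k *\<^sub>R (id_blinfun - E)"
    using k by (simp add: E_def scaleR_diff_right)
  have "shift_sum h \<in> C" unfolding shift_sum_def by (intro closed_subalgebra_sum[OF C(1)] alg C(2))
  then have EC: "E \<in> C" unfolding E_def by (intro alg)
  have "norm E \<le> 2 * DIM('a) / (k * h\<^sup>2)"
  proof (rule norm_blinfun_bound)
    show "norm (blinfun_apply E f) \<le> 2 * DIM('a) / (k * h\<^sup>2) * norm f" for f
      using divide_right_mono[OF norm_shift_sum_apply[of h f], of "k * h\<^sup>2"] k
      by (simp add: E_def blinfun.bilinear_simps)
  qed (use k in simp)
  also have "k * h\<^sup>2 = a * h\<^sup>2 + 2 * DIM('a)" using ah by (simp add: k_def distrib_right)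
  also have "2 * DIM('a) / (a * h\<^sup>2 + 2 * DIM('a)) < 1" using ah by (simp add: add_pos_nonneg)
  finally obtain D where D: "D \<in> C" "D o\<^sub>L (id_blinfun - E) = id_blinfun" "(id_blinfun - E) o\<^sub>L D = id_blinfun"
    using Neumann_inverse[OF C(1) EC] by blast
  have "(1/k) *\<^sub>R D \<in> C" by (intro alg D)
  moreover have "((1/k) *\<^sub>R D) o\<^sub>L discrete_op a h = id_blinfun" "discrete_op a h o\<^sub>L ((1/k) *\<^sub>R D) = id_blinfun"
    unfolding op blinfun_compose_scaleR_left blinfun_compose_scaleR_right D using k by simp_all
  ultimately show ?thesis by blast
qed

lemma discrete_resolvent_inverse:
  assumes "a > 0" "h > 0"
  shows "discrete_resolvent a h o\<^sub>L discrete_op a h = (id_blinfun :: 'a::euclidean_space op)"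
    and "discrete_op a h o\<^sub>L discrete_resolvent a h = (id_blinfun :: 'a op)"
proof -
  have "\<exists>R. R o\<^sub>L discrete_op a h = id_blinfun \<and> discrete_op a h o\<^sub>L R = (id_blinfun :: 'a op)"
    using discrete_op_inverse_in[OF closed_subalgebra_UNIV UNIV_I assms] by blast
  from someI_ex[OF this]
  show "discrete_resolvent a h o\<^sub>L discrete_op a h = (id_blinfun :: 'a op)" "discrete_op a h o\<^sub>L discrete_resolvent a h = (id_blinfun :: 'a op)"
    unfolding discrete_resolvent_def by auto
qed

lemma discrete_resolvent_apply:
  assumes "a > 0" "h > 0"
  shows "blinfun_apply (discrete_resolvent a h) (blinfun_apply (discrete_op a h) f) = f"
    "blinfun_apply (discrete_op a h) (blinfun_apply (discrete_resolvent a h) f) = f"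
  using discrete_resolvent_inverse[OF assms, THEN arg_cong[where f = "\<lambda>A. blinfun_apply A f"]] by simp_all

lemma discrete_resolvent_in:
  assumes C: "closed_subalgebra C" "\<And>y. shift y \<in> C" and ah: "a > 0" "h > 0"
  shows "discrete_resolvent a h \<in> C"
proof -
  obtain R where R: "R \<in> C" "R o\<^sub>L discrete_op a h = id_blinfun"
    using discrete_op_inverse_in[OF assms] by blast
  have "R = (R o\<^sub>L discrete_op a h) o\<^sub>L discrete_resolvent a h"
    by (simp add: blinfun_compose_assoc discrete_resolvent_inverse[OF ah])
  with R show ?thesis by simp
qed

lemma norm_discrete_resolvent_apply:
  assumes "a > 0" "h > 0"
  shows "norm (blinfun_apply (discrete_resolvent a h) f) \<le> norm f / a"
  using discrete_op_lower_bound[OF assms, of "blinfun_apply (discrete_resolvent a h) f"] assms(1)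
  by (simp add: discrete_resolvent_apply[OF assms] field_simps)

text \<open>
  Commutation with an operator and invariance of a closed subspace define closed subalgebras, so
  the discrete resolvents inherit these properties from the translations.
\<close>

lemma closed_subalgebra_centralizer: "closed_subalgebra {B. B o\<^sub>L T = T o\<^sub>L B}"
  unfolding closed_subalgebra_def
proof (intro conjI)
  show "closed {B. B o\<^sub>L T = T o\<^sub>L B}"
    by (intro closed_Collect_eq
        bounded_linear.continuous_on[OF bounded_bilinear.bounded_linear_left[OF bounded_bilinear_blinfun_compose]]
        bounded_linear.continuous_on[OF bounded_bilinear.bounded_linear_right[OF bounded_bilinear_blinfun_compose]] continuous_on_id)
  show "subspace {B. B o\<^sub>L T = T o\<^sub>L B}" by (auto simp: subspace_def compose_distribs)
  show "\<forall>A\<in>{B. B o\<^sub>L T = T o\<^sub>L B}. \<forall>B\<in>{B. B o\<^sub>L T = T o\<^sub>L B}. (A o\<^sub>L B) \<in> {B. B o\<^sub>L T = T o\<^sub>L B}"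
  proof (intro ballI, unfold mem_Collect_eq)
    fix A B assume AB: "A o\<^sub>L T = T o\<^sub>L A" "B o\<^sub>L T = T o\<^sub>L B"
    have "(A o\<^sub>L B) o\<^sub>L T = (A o\<^sub>L T) o\<^sub>L B" by (simp add: AB(2) blinfun_compose_assoc)
    then show "(A o\<^sub>L B) o\<^sub>L T = T o\<^sub>L (A o\<^sub>L B)" by (simp add: AB(1) blinfun_compose_assoc)
  qed
qed simp

lemma closed_subalgebra_invariant:
  assumes M: "subspace M" "closed M"
  shows "closed_subalgebra {B. \<forall>f\<in>M. blinfun_apply B f \<in> M}"
  unfolding closed_subalgebra_def
proof (intro conjI)
  have "closed {B. blinfun_apply B f \<in> M}" for f
  proof -
    have "closed ((\<lambda>B. blinfun_apply B f) -` M)"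
      by (rule continuous_closed_vimage[OF M(2)]) (rule linear_continuous_at[OF blinfun.bounded_linear_left])
    then show ?thesis by (simp add: vimage_def)
  qed
  moreover have "{B. \<forall>f\<in>M. blinfun_apply B f \<in> M} = (\<Inter>f\<in>M. {B. blinfun_apply B f \<in> M})" by auto
  ultimately show "closed {B. \<forall>f\<in>M. blinfun_apply B f \<in> M}" by (simp only: ) (intro closed_INT ballI)
  show "subspace {B. \<forall>f\<in>M. blinfun_apply B f \<in> M}"
    using M(1) by (auto simp: subspace_def blinfun.bilinear_simps)
qed auto

lemma shift_commute: "shift y o\<^sub>L shift z = shift z o\<^sub>L shift y"
  by (simp add: shift_compose add.commute)

lemma discrete_op_commute_shift: "discrete_op a h o\<^sub>L shift y = shift y o\<^sub>L discrete_op a h"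
proof -
  note C = closed_subalgebra_centralizer[of "shift y"]
  have "shift z \<in> {B. B o\<^sub>L shift y = shift y o\<^sub>L B}" for z by (simp add: shift_commute)
  then have "discrete_op a h \<in> {B. B o\<^sub>L shift y = shift y o\<^sub>L B}"
    unfolding discrete_op_def shift_sum_def by (intro closed_subalgebraD[OF C] closed_subalgebra_sum[OF C])
  then show ?thesis by simp
qed

lemma discrete_op_commute: "discrete_op a h o\<^sub>L discrete_op a h' = discrete_op a h' o\<^sub>L discrete_op a h"
proof -
  note C = closed_subalgebra_centralizer[of "discrete_op a h'"]
  have "shift z \<in> {B. B o\<^sub>L discrete_op a h' = discrete_op a h' o\<^sub>L B}" for z by (simp add: discrete_op_commute_shift)
  then have "discrete_op a h \<in> {B. B o\<^sub>L discrete_op a h' = discrete_op a h' o\<^sub>L B}"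
    unfolding discrete_op_def[of a h] shift_sum_def by (intro closed_subalgebraD[OF C] closed_subalgebra_sum[OF C])
  then show ?thesis by simp
qed

lemma discrete_resolvent_commute_shift:
  assumes "a > 0" "h > 0"
  shows "discrete_resolvent a h o\<^sub>L shift y = shift y o\<^sub>L discrete_resolvent a h"
proof -
  have "discrete_resolvent a h \<in> {B. B o\<^sub>L shift y = shift y o\<^sub>L B}"
    by (rule discrete_resolvent_in[OF closed_subalgebra_centralizer _ assms]) (simp add: shift_commute)
  then show ?thesis by simp
qed

lemma discrete_op_L2_of:
  assumes F: "sq_integrable F" and h: "h > 0"
  shows "sq_integrable (discrete_laplacian h F)"
    "blinfun_apply (discrete_op a h) (L2_of F) = L2_of (\<lambda>x. of_real a * F x - discrete_laplacian h F x)"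
proof -
  have sd: "sq_integrable (\<lambda>x. (F (x - h *\<^sub>R b) + F (x + h *\<^sub>R b) - 2 * F x) / of_real (h\<^sup>2))" for b
    using sq_integrable_scaleC[OF sq_integrable_diff[OF sq_integrable_add[OF sq_integrable_translation[OF F, of "h *\<^sub>R b"]
            sq_integrable_translation[OF F, of "- (h *\<^sub>R b)"]] sq_integrable_scaleC[OF F, of 2]], of "1 / of_real (h\<^sup>2)"]
    by simp
  then show s: "sq_integrable (discrete_laplacian h F)"
    unfolding discrete_laplacian_def[abs_def] by (intro sq_integrable_sum)
  have L: "L2_of (\<lambda>x. (F (x - h *\<^sub>R b) + F (x + h *\<^sub>R b) - 2 * F x) / of_real (h\<^sup>2))
      = (1 / h\<^sup>2) *\<^sub>R (blinfun_apply (shift (h *\<^sub>R b) + shift (- (h *\<^sub>R b))) (L2_of F) - 2 *\<^sub>R L2_of F)" for b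
  proof -
    let ?f = "\<lambda>x. F (x - h *\<^sub>R b)" and ?g = "\<lambda>x. F (x - - (h *\<^sub>R b))"
    have s: "sq_integrable ?f" "sq_integrable ?g" by (intro sq_integrable_translation F)+
    have "L2_of (\<lambda>x. (1 / of_real (h\<^sup>2)) * ((?f x + ?g x) - 2 * F x))
      = (1 / of_real (h\<^sup>2)) *\<^sub>C ((L2_of ?f + L2_of ?g) - 2 *\<^sub>C L2_of F)"
      by (simp only: L2_of_scaleC L2_of_diff L2_of_add s F sq_integrable_diff sq_integrable_add sq_integrable_scaleC)
    then show ?thesis
      using scaleC_of_real[of "1 / h\<^sup>2"] scaleC_of_real[of 2 "L2_of F"]
      by (simp add: shift_L2_of F blinfun.bilinear_simps)
  qed
  have "L2_of (discrete_laplacian h F) = (\<Sum>b\<in>Basis. (1 / h\<^sup>2) *\<^sub>R (blinfun_apply (shift (h *\<^sub>R b) + shift (- (h *\<^sub>R b))) (L2_of F) - 2 *\<^sub>R L2_of F))"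
    unfolding discrete_laplacian_def[abs_def] by (subst L2_of_sum[OF sd]) (simp only: L)
  also have "\<dots> = (1 / h\<^sup>2) *\<^sub>R (blinfun_apply (shift_sum h) (L2_of F) - (2 * DIM('a)) *\<^sub>R L2_of F)"
    unfolding shift_sum_def blinfun_apply_sum
    by (simp add: scaleR_sum_right[symmetric] sum_subtractf sum_constant_scaleR mult.commute del: blinfun.sum_left)
  finally have "L2_of (discrete_laplacian h F) = (1 / h\<^sup>2) *\<^sub>R (blinfun_apply (shift_sum h) (L2_of F) - (2 * DIM('a)) *\<^sub>R L2_of F)" .
  then show "blinfun_apply (discrete_op a h) (L2_of F) = L2_of (\<lambda>x. of_real a * F x - discrete_laplacian h F x)"
    by (simp add: L2_of_diff L2_of_scaleC F s sq_integrable_scaleC discrete_op_def blinfun.bilinear_simps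
        scaleC_of_real scaleR_diff_right scaleR_add_left)
qed

section \<open>The free resolvent\<close>

definition free_symbol :: "real \<Rightarrow> ('a::euclidean_space \<Rightarrow> complex) \<Rightarrow> 'a \<Rightarrow> complex" where
  "free_symbol a F x = of_real a * F x - laplacian F x"

lemma test_function_free_symbol: "test_function F \<Longrightarrow> test_function (free_symbol a F)"
  using test_function_add[OF test_function_cmult[of F "of_real a"] test_function_cmult[OF test_function_laplacian[of F], of "-1"]]
  by (simp add: free_symbol_def[abs_def])

lemma discrete_op_tendsto:
  assumes F: "test_function F" and h: "\<And>n::nat. h n > 0" "h \<longlonglongrightarrow> 0"
  shows "(\<lambda>n. blinfun_apply (discrete_op a (h n)) (L2_of F)) \<longlonglongrightarrow> L2_of (free_symbol a F)"
proof (rule LIMSEQ_I)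
  fix e :: real assume e: "e > 0"
  obtain R where R: "R > 0" "\<And>x. norm x > R \<Longrightarrow> F x = 0" using F by (rule test_functionE) blast
  define \<mu> where "\<mu> = sqrt (measure lebesgue (cball (0::'a) (R + 1))) + 1"
  have \<mu>: "\<mu> > 0" by (simp add: \<mu>_def add_nonneg_pos)
  obtain d where d: "d > 0" "\<And>h x. 0 < h \<Longrightarrow> h < d \<Longrightarrow> norm (discrete_laplacian h F x - laplacian F x) \<le> e / (2 * \<mu>)"
    using discrete_laplacian_uniform[OF F, of "e / (2 * \<mu>)"] e \<mu> by auto
  note sF = sq_integrable_test_function[OF F] and sL = sq_integrable_test_function[OF test_function_laplacian[OF F]]
  have "norm (blinfun_apply (discrete_op a h) (L2_of F) - L2_of (free_symbol a F)) < e" if h: "0 < h" "h < min d 1" for h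
  proof -
    note sD = discrete_op_L2_of(1)[OF sF h(1)]
    have "blinfun_apply (discrete_op a h) (L2_of F) - L2_of (free_symbol a F) = L2_of (\<lambda>x. laplacian F x - discrete_laplacian h F x)"
      unfolding discrete_op_L2_of(2)[OF sF h(1)] free_symbol_def[abs_def]
      by (simp add: L2_of_diff sF sL sD sq_integrable_scaleC)
    also have "norm \<dots> \<le> e / (2 * \<mu>) * sqrt (measure lebesgue (cball (0::'a) (R + 1)))"
    proof (rule norm_L2_of_le_sup(2))
      show "(\<lambda>x. laplacian F x - discrete_laplacian h F x) \<in> borel_measurable lebesgue"
        using sL sD by (intro borel_measurable_diff) (auto simp: sq_integrable_def)
      show "norm (laplacian F x - discrete_laplacian h F x) \<le> e / (2 * \<mu>)" for x
        using d(2)[of h x] h by (simp add: norm_minus_commute)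
      show "laplacian F x - discrete_laplacian h F x = 0" if "x \<notin> cball 0 (R + 1)" for x
        using that h discrete_laplacian_support[of R F x h, OF R(2)] laplacian_support[of R F x, OF R(2)] by simp
    qed
    also have "\<dots> < e / (2 * \<mu>) * (2 * \<mu>)" using e \<mu> by (intro mult_strict_left_mono) (auto simp: \<mu>_def)
    finally show ?thesis using \<mu> by simp
  qed
  moreover have "\<forall>\<^sub>F n in sequentially. h n < min d 1"
    using h(2) by (rule order_tendstoD) (use d in simp)
  ultimately show "\<exists>N. \<forall>n\<ge>N. norm (blinfun_apply (discrete_op a (h n)) (L2_of F) - L2_of (free_symbol a F)) < e"
    using h(1) unfolding eventually_sequentially by blast
qed

definition free_range :: "real \<Rightarrow> 'a::euclidean_space L2 set" where
  "free_range a = {L2_of (free_symbol a F) |F. test_function F}"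

lemma subspace_free_range: "subspace (free_range a)"
  unfolding subspace_def free_range_def
proof (intro conjI ballI allI)
  have z: "test_function (\<lambda>x::'a. 0)" by (auto simp: test_function_iff C_k_const intro: exI[of _ 1])
  have "free_symbol a (\<lambda>x::'a. 0) = (\<lambda>x. 0)"
    using laplacian_cmult[OF z, of 0] by (auto simp: free_symbol_def fun_eq_iff)
  with z show "0 \<in> {L2_of (free_symbol a F) |F. test_function (F :: 'a \<Rightarrow> complex)}"
    by (auto intro!: exI[of _ "\<lambda>x. 0"] simp: L2_of_zero)
  fix f g :: "'a L2" assume "f \<in> {L2_of (free_symbol a F) |F. test_function F}" "g \<in> {L2_of (free_symbol a F) |F. test_function F}"
  then obtain F G where FG: "test_function F" "test_function G" "f = L2_of (free_symbol a F)" "g = L2_of (free_symbol a G)" by auto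
  have "free_symbol a (\<lambda>x. F x + G x) = (\<lambda>x. free_symbol a F x + free_symbol a G x)"
    using FG by (simp add: free_symbol_def fun_eq_iff laplacian_add algebra_simps)
  then have "f + g = L2_of (free_symbol a (\<lambda>x. F x + G x))"
    using FG by (simp add: L2_of_add sq_integrable_test_function test_function_free_symbol)
  then show "f + g \<in> {L2_of (free_symbol a F) |F. test_function F}"
    using test_function_add[OF FG(1,2)] by blast
next
  fix r and f :: "'a L2" assume "f \<in> {L2_of (free_symbol a F) |F. test_function F}"
  then obtain F where F: "test_function F" "f = L2_of (free_symbol a F)" by auto
  have "free_symbol a (\<lambda>x. of_real r * F x) = (\<lambda>x. of_real r * free_symbol a F x)"
    using F by (simp add: free_symbol_def fun_eq_iff laplacian_cmult right_diff_distrib mult.left_commute)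
  then have "r *\<^sub>R f = L2_of (free_symbol a (\<lambda>x. of_real r * F x))"
    using F by (simp add: L2_of_scaleC sq_integrable_test_function test_function_free_symbol scaleC_of_real)
  then show "r *\<^sub>R f \<in> {L2_of (free_symbol a F) |F. test_function F}"
    using test_function_cmult[OF F(1)] by blast
qed

lemma free_symbol_translation: "test_function F \<Longrightarrow> free_symbol a (\<lambda>x. F (x - y)) = (\<lambda>x. free_symbol a F (x - y))"
  by (simp add: free_symbol_def fun_eq_iff laplacian_translation)

text \<open>
  The error is the discrete resolvent applied to \<open>(a - \<Delta>\<^sub>h) F - (a - \<Delta>) F\<close>, and the discrete
  resolvents are bounded by \<open>1 / a\<close> uniformly in the step.
\<close>

lemma discrete_resolvent_tendsto_test:
  assumes F: "test_function F" and a: "a > 0" and h: "\<And>n::nat. h n > 0" "h \<longlonglongrightarrow> 0"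
  shows "(\<lambda>n. blinfun_apply (discrete_resolvent a (h n)) (L2_of (free_symbol a F))) \<longlonglongrightarrow> L2_of F"
proof (rule LIM_zero_cancel, rule Lim_null_comparison[OF always_eventually])
  let ?r = "\<lambda>n. blinfun_apply (discrete_op a (h n)) (L2_of F) - L2_of (free_symbol a F)"
  show "(\<lambda>n. norm (?r n) / a) \<longlonglongrightarrow> 0"
    using tendsto_divide[OF tendsto_norm[OF LIM_zero[OF discrete_op_tendsto[OF F h]]] tendsto_const, of a] a by simp
  show "\<forall>n. norm (blinfun_apply (discrete_resolvent a (h n)) (L2_of (free_symbol a F)) - L2_of F) \<le> norm (?r n) / a"
  proof
    fix n
    have "blinfun_apply (discrete_resolvent a (h n)) (L2_of (free_symbol a F)) - L2_of F = - blinfun_apply (discrete_resolvent a (h n)) (?r n)"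
      by (simp add: blinfun.bilinear_simps discrete_resolvent_apply[OF a h(1)])
    then show "norm (blinfun_apply (discrete_resolvent a (h n)) (L2_of (free_symbol a F)) - L2_of F) \<le> norm (?r n) / a"
      using norm_discrete_resolvent_apply[OF a h(1), of n "?r n"] by (simp only: norm_minus_cancel)
  qed
qed

text \<open>
  The closed range of \<open>a - \<Delta>\<close> on test functions is translation invariant, hence invariant under the
  discrete resolvents. Applied to \<open>(a - \<Delta>) F\<close> these tend to \<open>F\<close>, so that the closed range contains
  every test function.
\<close>

lemma closure_free_range:
  assumes a: "a > 0"
  shows "closure (free_range a) = (UNIV :: 'a::euclidean_space L2 set)"
proof -
  let ?M = "closure (free_range a) :: 'a L2 set"
  let ?C = "{B. \<forall>f\<in>?M. blinfun_apply B f \<in> ?M}"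
  have M: "subspace ?M" "closed ?M" by (auto intro: subspace_closure subspace_free_range)
  have "shift y \<in> ?C" for y
  proof (intro CollectI ballI)
    fix f assume "f \<in> ?M"
    then show "blinfun_apply (shift y) f \<in> ?M"
    proof (rule closure_mapI[OF blinfun.bounded_linear_right, rotated])
      fix f :: "'a L2" assume "f \<in> free_range a"
      then obtain F where F: "test_function F" "f = L2_of (free_symbol a F)" by (auto simp: free_range_def)
      then have "blinfun_apply (shift y) f = L2_of (free_symbol a (\<lambda>x. F (x - y)))"
        by (simp add: shift_L2_of sq_integrable_test_function test_function_free_symbol free_symbol_translation)
      then show "blinfun_apply (shift y) f \<in> free_range a"
        using test_function_translation[OF F(1), of y] by (auto simp: free_range_def)
    qed
  qed
  then have R: "discrete_resolvent a h \<in> ?C" if "h > 0" for h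
    by (intro discrete_resolvent_in[OF closed_subalgebra_invariant[OF M] _ a that])
  have "test_space \<subseteq> ?M"
  proof
    fix f :: "'a L2" assume "f \<in> test_space"
    then obtain F where F: "test_function F" "f = L2_of F" by (auto simp: test_space_def)
    have "L2_of F \<in> ?M"
    proof (rule closed_sequentially[OF M(2)])
      show "(\<lambda>n. blinfun_apply (discrete_resolvent a (inverse (real (Suc n)))) (L2_of (free_symbol a F))) \<longlonglongrightarrow> L2_of F"
        by (rule discrete_resolvent_tendsto_test[OF F(1) a _ LIMSEQ_inverse_real_of_nat]) simp
      have "L2_of (free_symbol a F) \<in> ?M" using F(1) by (intro subsetD[OF closure_subset]) (auto simp: free_range_def)
      then show "blinfun_apply (discrete_resolvent a (inverse (real (Suc n)))) (L2_of (free_symbol a F)) \<in> ?M" for n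
        using R[of "inverse (real (Suc n))"] by simp
    qed
    then show "f \<in> ?M" by (simp add: F(2))
  qed
  then have "closure test_space \<subseteq> ?M" by (rule closure_minimal) (rule M(2))
  then show ?thesis unfolding closure_test_space by blast
qed

lemma free_symbol_lower_bound:
  assumes F: "test_function F" and a: "a > 0"
  shows "norm (L2_of F) \<le> norm (L2_of (free_symbol a F)) / a"
proof (rule LIMSEQ_le_const2)
  show "(\<lambda>n. norm (blinfun_apply (discrete_resolvent a (inverse (real (Suc n)))) (L2_of (free_symbol a F)))) \<longlonglongrightarrow> norm (L2_of F)"
    by (intro tendsto_norm discrete_resolvent_tendsto_test[OF F a _ LIMSEQ_inverse_real_of_nat]) simp
  show "\<exists>N. \<forall>n\<ge>N. norm (blinfun_apply (discrete_resolvent a (inverse (real (Suc n)))) (L2_of (free_symbol a F))) \<le> norm (L2_of (free_symbol a F)) / a"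
    by (intro exI allI impI norm_discrete_resolvent_apply[OF a]) simp
qed

text \<open>
  The bound passes to the closure and makes it single valued. It also turns a sequence of arguments
  that converges to a given vector into a Cauchy sequence of values.
\<close>

lemma closure_graph_bounded:
  fixes G :: "('a::euclidean_space L2 \<times> 'a L2) set"
  assumes sub: "subspace G" and sC: "\<And>k g f. (g, f) \<in> G \<Longrightarrow> (k *\<^sub>C g, k *\<^sub>C f) \<in> G"
    and C: "C \<ge> 0" "\<And>g f. (g, f) \<in> G \<Longrightarrow> norm f \<le> C * norm g"
    and dense: "closure (fst ` G) = UNIV"
  shows "\<exists>T\<in>bounded_ops. closure G = op_graph T \<and> norm T \<le> C"
proof -
  have subc: "subspace (closure G)" by (rule subspace_closure[OF sub])
  have bnd: "norm f \<le> C * norm g" if "(g, f) \<in> closure G" for g f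
  proof -
    have "closure G \<subseteq> {p. norm (snd p) \<le> C * norm (fst p)}"
      by (intro closure_minimal closed_Collect_le continuous_intros) (use C(2) in auto)
    with that show ?thesis by auto
  qed
  have uniq: "f = f'" if "(g, f) \<in> closure G" "(g, f') \<in> closure G" for g f f'
    using bnd[of 0 "f - f'"] subspace_diff[OF subc that] by simp
  have total: "\<exists>f. (g, f) \<in> closure G" for g
  proof -
    have "g \<in> closure (fst ` G)" by (simp add: dense)
    then obtain X where X: "\<And>n. X n \<in> fst ` G" "X \<longlonglongrightarrow> g" by (auto simp: closure_sequential)
    have "\<exists>y. (X n, y) \<in> G" for n using X(1)[of n] by auto
    then obtain Y where Y: "\<And>n. (X n, Y n) \<in> G" by metis
    have "Cauchy Y"
    proof (rule CauchyI)
      fix e :: real assume e: "e > 0"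
      then have "e / (C + 1) > 0" using C(1) by simp
      then obtain N where N: "\<And>m n. m \<ge> N \<Longrightarrow> n \<ge> N \<Longrightarrow> norm (X m - X n) < e / (C + 1)"
        using CauchyD[OF LIMSEQ_imp_Cauchy[OF X(2)], of "e / (C + 1)"] by blast
      have "norm (Y m - Y n) < e" if "m \<ge> N" "n \<ge> N" for m n
      proof -
        have "(X m - X n, Y m - Y n) \<in> G" using subspace_diff[OF sub Y[of m] Y[of n]] by simp
        then have "norm (Y m - Y n) \<le> C * norm (X m - X n)" by (rule C(2))
        also have "\<dots> \<le> C * (e / (C + 1))" using N[OF that] C(1) by (intro mult_left_mono) auto
        also have "\<dots> < e" using e C(1) by (simp add: field_simps)
        finally show ?thesis .
      qed
      then show "\<exists>N. \<forall>m\<ge>N. \<forall>n\<ge>N. norm (Y m - Y n) < e" by blast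
    qed
    then obtain f where "Y \<longlonglongrightarrow> f" using Cauchy_convergent convergent_def by blast
    with X(2) have "(\<lambda>n. (X n, Y n)) \<longlonglongrightarrow> (g, f)" by (rule tendsto_Pair)
    then have "(g, f) \<in> closure G"
      using Y unfolding closure_sequential by (intro exI[of _ "\<lambda>n. (X n, Y n)"]) simp
    then show ?thesis ..
  qed
  have ex1: "\<exists>!f. (g, f) \<in> closure G" for g using total[of g] uniq by blast
  define t where "t g = (THE f. (g, f) \<in> closure G)" for g
  have "(g, t g) \<in> closure G" for g unfolding t_def by (rule theI'[OF ex1])
  then have t: "(g, f) \<in> closure G \<longleftrightarrow> f = t g" for g f using uniq by blast
  have lin: "bounded_linear t"
  proof (rule bounded_linear_intro[where K = C])
    show "t (f + g) = t f + t g" for f g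
      using subspace_add[OF subc, of "(f, t f)" "(g, t g)"] t by simp
    show "t (r *\<^sub>R f) = r *\<^sub>R t f" for r f
      using subspace_scale[OF subc, of "(f, t f)" r] t by simp
    show "norm (t f) \<le> norm f * C" for f using bnd[of f "t f"] t by (simp add: mult.commute)
  qed
  have app: "blinfun_apply (Blinfun t) = t" by (rule bounded_linear_Blinfun_apply[OF lin])
  have "Blinfun t \<in> bounded_ops"
  proof (rule bounded_opsI)
    fix k f
    have bl: "bounded_linear (\<lambda>p. (k *\<^sub>C fst p, k *\<^sub>C snd p))"
      by (intro bounded_linear_Pair bounded_linear_compose[OF bounded_bilinear.bounded_linear_right[OF bounded_bilinear_scaleC]]
          bounded_linear_fst bounded_linear_snd)
    have "(k *\<^sub>C f, k *\<^sub>C t f) \<in> closure G"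
      using closure_mapI[OF bl, of G G "(f, t f)"] sC t by auto
    then show "blinfun_apply (Blinfun t) (k *\<^sub>C f) = k *\<^sub>C blinfun_apply (Blinfun t) f" using t by (simp add: app)
  qed
  moreover have "closure G = op_graph (Blinfun t)"
    using t by (auto simp: op_graph_def app)
  moreover have "norm (Blinfun t) \<le> C"
    by (rule norm_blinfun_bound[OF C(1)]) (use bnd t in \<open>simp add: app\<close>)
  ultimately show ?thesis by blast
qed

lemma op_uminus_op_uminus [simp]: "op_uminus (op_uminus T) = T"
  by (force simp: op_uminus_def)

lemma op_uminus_iff: "(f, h) \<in> op_uminus T \<longleftrightarrow> (f, - h) \<in> T"
  by (force simp: op_uminus_def)

text \<open>
  A linear homeomorphism of the product space maps the graph of \<open>\<Delta>\<close> on test functions to the graph of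
  the inverse of \<open>a - \<Delta>\<close>, so it also maps the closure of the first to the closure of the second.
  The latter is the graph of a bounded operator by the lower bound for \<open>a - \<Delta>\<close> and the density of its
  range, both of which come from the discrete resolvents.
\<close>

lemma free_resolvent:
  assumes a: "a > 0"
  shows "free_resolvent a \<in> (bounded_ops :: 'a::euclidean_space op set)"
    and "(f :: 'a L2, h) \<in> free_hamiltonian \<longleftrightarrow> f = blinfun_apply (free_resolvent a) (of_real a *\<^sub>C f + h)"
    and "test_function (F :: 'a \<Rightarrow> complex) \<Longrightarrow> blinfun_apply (free_resolvent a) (L2_of (free_symbol a F)) = L2_of F"
    and "norm (free_resolvent a :: 'a op) \<le> 1 / a"
proof -
  define K :: "('a L2 \<times> 'a L2) set" where "K = {(L2_of F, L2_of (laplacian F)) |F. test_function F}"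
  define G where "G = (\<lambda>p. (a *\<^sub>R fst p - snd p, fst p)) ` K"
  have subK: "subspace K"
    unfolding subspace_def
  proof (intro conjI ballI allI)
    have z: "test_function (\<lambda>x::'a. 0)" by (auto simp: test_function_iff C_k_const intro: exI[of _ 1])
    have "laplacian (\<lambda>x::'a. 0) = (\<lambda>x. 0)" using laplacian_cmult[OF z, of 0] by simp
    with z show "0 \<in> K" by (auto simp: K_def zero_prod_def L2_of_zero intro!: exI[of _ "\<lambda>x. 0"])
    fix p q assume "p \<in> K" "q \<in> K"
    then obtain F H where FH: "test_function F" "test_function H" "p = (L2_of F, L2_of (laplacian F))" "q = (L2_of H, L2_of (laplacian H))"
      by (auto simp: K_def)
    then have "p + q = (L2_of (\<lambda>x. F x + H x), L2_of (laplacian (\<lambda>x. F x + H x)))"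
      by (simp add: laplacian_add L2_of_add sq_integrable_test_function test_function_laplacian)
    with test_function_add[OF FH(1,2)] show "p + q \<in> K" by (auto simp: K_def)
  next
    fix r p assume "p \<in> K"
    then obtain F where F: "test_function F" "p = (L2_of F, L2_of (laplacian F))" by (auto simp: K_def)
    then have "r *\<^sub>R p = (L2_of (\<lambda>x. of_real r * F x), L2_of (laplacian (\<lambda>x. of_real r * F x)))"
      by (simp add: laplacian_cmult L2_of_scaleC sq_integrable_test_function test_function_laplacian scaleC_of_real)
    with test_function_cmult[OF F(1)] show "r *\<^sub>R p \<in> K" by (auto simp: K_def)
  qed
  have bl: "bounded_linear (\<lambda>p :: 'a L2 \<times> 'a L2. (a *\<^sub>R fst p - snd p, fst p))"
    "bounded_linear (\<lambda>p :: 'a L2 \<times> 'a L2. (snd p, a *\<^sub>R snd p - fst p))"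
    by (intro bounded_linear_Pair bounded_linear_sub bounded_linear_compose[OF bounded_linear_scaleR_right]
        bounded_linear_fst bounded_linear_snd)+
  have sym: "L2_of (free_symbol a F) = a *\<^sub>R L2_of F - L2_of (laplacian F)" if "test_function F" for F :: "'a \<Rightarrow> complex"
    using that by (simp add: free_symbol_def[abs_def] L2_of_diff L2_of_scaleC sq_integrable_scaleC
        sq_integrable_test_function test_function_laplacian scaleC_of_real)
  have "G = {(a *\<^sub>R L2_of F - L2_of (laplacian F), L2_of F) |F. test_function F}"
    by (force simp: G_def K_def)
  also have "\<dots> = {(L2_of (free_symbol a F), L2_of F) |F. test_function F}"
    by (intro Collect_cong iffI; elim exE conjE; metis sym)
  finally have G_eq: "G = {(L2_of (free_symbol a F), L2_of F) |F. test_function F}" .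
  then have G_mem: "(L2_of (free_symbol a F), L2_of F) \<in> G" if "test_function F" for F
    using that by blast
  have "\<exists>T\<in>bounded_ops. closure G = op_graph T \<and> norm T \<le> 1 / a"
  proof (rule closure_graph_bounded)
    show "subspace G"
      unfolding G_def by (rule linear_subspace_image[OF bounded_linear.linear[OF bl(1)] subK])
    show "(k *\<^sub>C g, k *\<^sub>C f) \<in> G" if gf: "(g, f) \<in> G" for k g f
    proof -
      obtain F where F: "test_function F" "g = L2_of (free_symbol a F)" "f = L2_of F" using gf by (auto simp: G_eq)
      have "free_symbol a (\<lambda>x. k * F x) = (\<lambda>x. k * free_symbol a F x)"
        using F(1) by (simp add: free_symbol_def fun_eq_iff laplacian_cmult right_diff_distrib mult.left_commute)
      then show ?thesis
        using G_mem[OF test_function_cmult[OF F(1), of k]] F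
        by (simp add: L2_of_scaleC sq_integrable_test_function test_function_free_symbol)
    qed
    show "norm f \<le> 1 / a * norm g" if "(g, f) \<in> G" for g f
      using that free_symbol_lower_bound[OF _ a] by (auto simp: G_eq)
    have "fst ` G = free_range a" by (force simp: G_eq free_range_def)
    then show "closure (fst ` G) = UNIV" by (simp add: closure_free_range[OF a])
  qed (use a in simp)
  then obtain T where T: "T \<in> bounded_ops" "closure G = op_graph T" "norm T \<le> 1 / a" by blast
  have KT: "(f, k) \<in> closure K \<longleftrightarrow> f = blinfun_apply T (a *\<^sub>R f - k)" for f k
  proof
    assume "(f, k) \<in> closure K"
    then have "(\<lambda>p. (a *\<^sub>R fst p - snd p, fst p)) (f, k) \<in> closure G"
      by (rule closure_mapI[OF bl(1), rotated]) (auto simp: G_def)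
    then show "f = blinfun_apply T (a *\<^sub>R f - k)" unfolding T(2) by (auto simp: op_graph_def)
  next
    assume f: "f = blinfun_apply T (a *\<^sub>R f - k)"
    then have "(a *\<^sub>R f - k, f) \<in> closure G" unfolding T(2) by (auto simp: op_graph_def)
    then have "(\<lambda>p. (snd p, a *\<^sub>R snd p - fst p)) (a *\<^sub>R f - k, f) \<in> closure K"
      by (rule closure_mapI[OF bl(2), rotated]) (auto simp: G_def)
    then show "(f, k) \<in> closure K" by simp
  qed
  have H: "free_hamiltonian = op_uminus (closure K)" by (simp add: free_hamiltonian_def K_def)
  have "is_resolvent (of_real a) (op_uminus free_hamiltonian) T"
    using T(1) KT by (simp add: is_resolvent_def H scaleC_of_real)
  then have "is_bounded_inverse (op_plus (op_graph (scalar_op (of_real a))) free_hamiltonian) T"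
    using is_bounded_inverse_iff[of "of_real a" "op_uminus free_hamiltonian" T] by simp
  then have fr: "free_resolvent a = T" unfolding free_resolvent_def by (rule bounded_inverse_eq)
  show "free_resolvent a \<in> (bounded_ops :: 'a op set)" "norm (free_resolvent a :: 'a op) \<le> 1 / a" using T by (simp_all add: fr)
  show "(f, h) \<in> free_hamiltonian \<longleftrightarrow> f = blinfun_apply (free_resolvent a) (of_real a *\<^sub>C f + h)"
    by (simp add: H op_uminus_iff KT fr scaleC_of_real)
  show "blinfun_apply (free_resolvent a) (L2_of (free_symbol a F)) = L2_of F" if "test_function F"
  proof -
    have "(L2_of (free_symbol a F), L2_of F) \<in> closure G" using G_mem[OF that] closure_subset by blast
    then show ?thesis unfolding T(2) by (auto simp: op_graph_def fr)
  qed
qed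

lemma norm_free_resolvent_apply:
  assumes "a > 0"
  shows "norm (blinfun_apply (free_resolvent a) f) \<le> norm f / a"
  using order_trans[OF norm_blinfun mult_right_mono[OF free_resolvent(4)[OF assms] norm_ge_zero[of f]]]
  by simp

text \<open>
  The operators are uniformly bounded and converge on the dense range of \<open>a - \<Delta>\<close>.
\<close>

lemma discrete_resolvent_tendsto:
  assumes a: "a > 0" and h: "\<And>n::nat. h n > 0" "h \<longlonglongrightarrow> 0"
  shows "(\<lambda>n. blinfun_apply (discrete_resolvent a (h n)) f) \<longlonglongrightarrow> blinfun_apply (free_resolvent a) f"
proof (rule LIMSEQ_I)
  fix e :: real assume e: "e > 0"
  have "f \<in> closure (free_range a)" by (simp add: closure_free_range[OF a])
  moreover have "e * a / 4 > 0" using e a by simp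
  ultimately obtain g where g: "g \<in> free_range a" "dist g f < e * a / 4"
    unfolding closure_approachable by blast
  then obtain F where F: "test_function F" "g = L2_of (free_symbol a F)" by (auto simp: free_range_def)
  have "(\<lambda>n. blinfun_apply (discrete_resolvent a (h n)) g) \<longlonglongrightarrow> blinfun_apply (free_resolvent a) g"
    using discrete_resolvent_tendsto_test[OF F(1) a h] by (simp add: F(2) free_resolvent(3)[OF a F(1)])
  then obtain N where N: "\<And>n. n \<ge> N \<Longrightarrow> norm (blinfun_apply (discrete_resolvent a (h n)) g - blinfun_apply (free_resolvent a) g) < e/2"
    using LIMSEQ_D[of _ _ "e/2"] e by (metis half_gt_zero)
  have "norm (blinfun_apply (discrete_resolvent a (h n)) f - blinfun_apply (free_resolvent a) f) < e" if "n \<ge> N" for n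
  proof -
    let ?R = "blinfun_apply (discrete_resolvent a (h n))" and ?F = "blinfun_apply (free_resolvent a)"
    have "?R f - ?F f = (?R (f - g) - ?F (f - g)) + (?R g - ?F g)"
      by (simp add: blinfun.bilinear_simps)
    also have "norm \<dots> \<le> (norm (f - g) / a + norm (f - g) / a) + norm (?R g - ?F g)"
      by (intro order_trans[OF norm_triangle_ineq] add_right_mono order_trans[OF norm_triangle_ineq4]
          add_mono norm_discrete_resolvent_apply[OF a h(1)] norm_free_resolvent_apply[OF a])
    finally have "norm (?R f - ?F f) \<le> (norm (f - g) / a + norm (f - g) / a) + norm (?R g - ?F g)" .
    moreover have "norm (f - g) / a < e/4"
      using g(2) a by (simp add: dist_norm norm_minus_commute field_simps)
    ultimately show ?thesis using N[OF that] by linarith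
  qed
  then show "\<exists>N. \<forall>n\<ge>N. norm (blinfun_apply (discrete_resolvent a (h n)) f - blinfun_apply (free_resolvent a) f) < e" by blast
qed

lemma free_resolvent_commute_shift:
  assumes a: "a > 0"
  shows "blinfun_apply (free_resolvent a) (blinfun_apply (shift y) f) = blinfun_apply (shift y) (blinfun_apply (free_resolvent a) f)"
proof (rule LIMSEQ_unique)
  let ?h = "\<lambda>n. inverse (real (Suc n))"
  show "(\<lambda>n. blinfun_apply (discrete_resolvent a (?h n)) (blinfun_apply (shift y) f)) \<longlonglongrightarrow> blinfun_apply (free_resolvent a) (blinfun_apply (shift y) f)"
    by (rule discrete_resolvent_tendsto[OF a _ LIMSEQ_inverse_real_of_nat]) simp
  have "(\<lambda>n. blinfun_apply (shift y) (blinfun_apply (discrete_resolvent a (?h n)) f)) \<longlonglongrightarrow> blinfun_apply (shift y) (blinfun_apply (free_resolvent a) f)"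
    by (intro blinfun.tendsto tendsto_const discrete_resolvent_tendsto[OF a _ LIMSEQ_inverse_real_of_nat]) simp
  moreover have "blinfun_apply (discrete_resolvent a (?h n)) (blinfun_apply (shift y) f) = blinfun_apply (shift y) (blinfun_apply (discrete_resolvent a (?h n)) f)" for n
    using arg_cong[OF discrete_resolvent_commute_shift[OF a, of "?h n" y], of "\<lambda>A. blinfun_apply A f"] by simp
  ultimately show "(\<lambda>n. blinfun_apply (discrete_resolvent a (?h n)) (blinfun_apply (shift y) f)) \<longlonglongrightarrow> blinfun_apply (shift y) (blinfun_apply (free_resolvent a) f)"
    by simp
qed

lemma norm_shift_multiple: "norm (blinfun_apply (shift (real n *\<^sub>R u)) f - f) \<le> real n * norm (blinfun_apply (shift u) f - f)"
proof (induction n)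
  case (Suc n)
  have "blinfun_apply (shift (real (Suc n) *\<^sub>R u)) f - f = blinfun_apply (shift u) (blinfun_apply (shift (real n *\<^sub>R u)) f - f) + (blinfun_apply (shift u) f - f)"
    by (simp add: blinfun.bilinear_simps shift_shift_apply algebra_simps)
  also have "norm \<dots> \<le> norm (blinfun_apply (shift (real n *\<^sub>R u)) f - f) + norm (blinfun_apply (shift u) f - f)"
    by (rule order_trans[OF norm_triangle_ineq]) simp
  finally show ?case using Suc by (simp add: algebra_simps)
qed simp

text \<open>
  The energy estimate bounds one step of size \<open>h\<close> in the direction \<open>b\<close>, after the discrete resolvent
  of step \<open>h\<close>, by a multiple of \<open>h\<close>. A displacement by \<open>t\<close> consists of \<open>t / h\<close> such steps, so that the
  bound does not depend on \<open>h\<close> and passes to the limit.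
\<close>

lemma free_resolvent_Lipschitz_direction:
  assumes a: "a > 0" and b: "b \<in> Basis" and t: "t > 0"
  shows "norm (blinfun_apply (shift (t *\<^sub>R b)) (blinfun_apply (free_resolvent a) f) - blinfun_apply (free_resolvent a) f) \<le> t * (norm f / sqrt a)"
proof (rule LIMSEQ_le_const2)
  define h where "h n = t * inverse (real (Suc n))" for n
  have h: "h n > 0" for n using t by (simp add: h_def)
  have h0: "h \<longlonglongrightarrow> 0" unfolding h_def using tendsto_mult[OF tendsto_const LIMSEQ_inverse_real_of_nat, of t] by simp
  define R where "R n = blinfun_apply (discrete_resolvent a (h n)) f" for n
  show "(\<lambda>n. norm (blinfun_apply (shift (t *\<^sub>R b)) (R n) - R n)) \<longlonglongrightarrow> norm (blinfun_apply (shift (t *\<^sub>R b)) (blinfun_apply (free_resolvent a) f) - blinfun_apply (free_resolvent a) f)"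
    unfolding R_def by (intro tendsto_norm tendsto_diff blinfun.tendsto tendsto_const discrete_resolvent_tendsto[OF a h h0])
  have "norm (blinfun_apply (shift (t *\<^sub>R b)) (R n) - R n) \<le> t * (norm f / sqrt a)" for n
  proof -
    have "(norm (blinfun_apply (shift (h n *\<^sub>R b)) (R n) - R n))\<^sup>2 \<le> (h n)\<^sup>2 * (R n \<bullet> f)"
      using discrete_op_energy[OF h b, of a n "R n"] a by (simp add: R_def discrete_resolvent_apply[OF a h])
    also have "\<dots> \<le> (h n)\<^sup>2 * (norm f / a * norm f)"
    proof (rule mult_left_mono)
      have "R n \<bullet> f \<le> norm (R n) * norm f" by (rule norm_cauchy_schwarz)
      also have "\<dots> \<le> norm f / a * norm f"
        unfolding R_def by (intro mult_right_mono norm_discrete_resolvent_apply[OF a h]) auto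
      finally show "R n \<bullet> f \<le> norm f / a * norm f" .
    qed simp
    also have "(h n)\<^sup>2 * (norm f / a * norm f) = (h n * (norm f / sqrt a))\<^sup>2"
      using a by (simp add: power_mult_distrib power_divide power2_eq_square)
    finally have "norm (blinfun_apply (shift (h n *\<^sub>R b)) (R n) - R n) \<le> h n * (norm f / sqrt a)"
      by (rule power2_le_imp_le) (use h[of n] a in simp_all)
    note step = this
    have "real (Suc n) *\<^sub>R (h n *\<^sub>R b) = t *\<^sub>R b" by (simp add: h_def)
    then have "norm (blinfun_apply (shift (t *\<^sub>R b)) (R n) - R n) \<le> real (Suc n) * norm (blinfun_apply (shift (h n *\<^sub>R b)) (R n) - R n)"
      using norm_shift_multiple[of "Suc n" "h n *\<^sub>R b" "R n"] by (simp only:)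
    also have "\<dots> \<le> real (Suc n) * (h n * (norm f / sqrt a))" by (intro mult_left_mono step) auto
    also have "\<dots> = t * (norm f / sqrt a)" by (simp add: h_def del: of_nat_Suc)
    finally show ?thesis .
  qed
  then show "\<exists>N. \<forall>n\<ge>N. norm (blinfun_apply (shift (t *\<^sub>R b)) (R n) - R n) \<le> t * (norm f / sqrt a)" by blast
qed

lemma free_resolvent_Lipschitz:
  fixes y :: "'a::euclidean_space"
  assumes a: "a > 0"
  shows "norm (blinfun_apply (shift y) (blinfun_apply (free_resolvent a) f) - blinfun_apply (free_resolvent a) f) \<le> (\<Sum>b\<in>Basis. \<bar>y \<bullet> b\<bar>) * (norm f / sqrt a)"
proof -
  let ?g = "blinfun_apply (free_resolvent a) f"
  have dir: "norm (blinfun_apply (shift (t *\<^sub>R b)) ?g - ?g) \<le> \<bar>t\<bar> * (norm f / sqrt a)" if "b \<in> Basis" for t and b :: 'a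
  proof (cases t "0::real" rule: linorder_cases)
    case less
    have "blinfun_apply (shift (t *\<^sub>R b)) ?g - ?g = - blinfun_apply (shift (t *\<^sub>R b)) (blinfun_apply (shift ((- t) *\<^sub>R b)) ?g - ?g)"
      by (simp add: blinfun.bilinear_simps shift_shift_apply)
    then have "norm (blinfun_apply (shift (t *\<^sub>R b)) ?g - ?g) = norm (blinfun_apply (shift ((- t) *\<^sub>R b)) ?g - ?g)"
      by (simp only: norm_minus_cancel norm_shift_apply)
    then show ?thesis using free_resolvent_Lipschitz_direction[OF a that, of "- t" f] less by simp
  qed (use free_resolvent_Lipschitz_direction[OF a that, of t f] in auto)
  have "norm (blinfun_apply (shift (\<Sum>b\<in>B. (y \<bullet> b) *\<^sub>R b)) ?g - ?g) \<le> (\<Sum>b\<in>B. \<bar>y \<bullet> b\<bar>) * (norm f / sqrt a)"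
    if "finite B" "B \<subseteq> Basis" for B :: "'a set"
    using that
  proof (induction B rule: finite_induct)
    case (insert b B)
    let ?u = "(y \<bullet> b) *\<^sub>R b" and ?v = "\<Sum>b\<in>B. (y \<bullet> b) *\<^sub>R b"
    have "blinfun_apply (shift (?u + ?v)) ?g - ?g = blinfun_apply (shift ?u) (blinfun_apply (shift ?v) ?g - ?g) + (blinfun_apply (shift ?u) ?g - ?g)"
      by (simp add: blinfun.bilinear_simps shift_shift_apply)
    also have "norm \<dots> \<le> norm (blinfun_apply (shift ?v) ?g - ?g) + norm (blinfun_apply (shift ?u) ?g - ?g)"
      by (rule order_trans[OF norm_triangle_ineq]) simp
    also have "\<dots> \<le> (\<Sum>b\<in>B. \<bar>y \<bullet> b\<bar>) * (norm f / sqrt a) + \<bar>y \<bullet> b\<bar> * (norm f / sqrt a)"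
      using insert by (intro add_mono dir) auto
    finally show ?case using insert by (simp add: algebra_simps)
  qed simp
  from this[of Basis] show ?thesis by (simp add: euclidean_representation)
qed

section \<open>Convolution operators and the range of the free resolvent\<close>

text \<open>
  An integral of translates with values in the Hilbert space, for which it is immediate that bounded
  operators commuting with translations commute with convolutions.
\<close>

definition convolve :: "('a::euclidean_space \<Rightarrow> complex) \<Rightarrow> 'a L2 \<Rightarrow> 'a L2" where
  "convolve q f = integral UNIV (\<lambda>y. q y *\<^sub>C blinfun_apply (shift y) f)"

lemma norm_gt_of_not_in_cbox: "x \<notin> cbox (- (r *\<^sub>R One)) (r *\<^sub>R One) \<Longrightarrow> norm x > r"
  for x :: "'a::euclidean_space"
proof -
  assume "x \<notin> cbox (- (r *\<^sub>R One)) (r *\<^sub>R One)"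
  then obtain b where b: "b \<in> Basis" "\<not> (- r \<le> x \<bullet> b \<and> x \<bullet> b \<le> r)" by (auto simp: mem_box)
  then have "r < \<bar>x \<bullet> b\<bar>" by linarith
  with Basis_le_norm[OF b(1), of x] show "norm x > r" by linarith
qed

lemma convolve_has_integral_cbox:
  assumes q: "test_function q" and r: "\<And>x. norm x > r \<Longrightarrow> q x = 0"
  shows "((\<lambda>y. q y *\<^sub>C blinfun_apply (shift y) f) has_integral convolve q f) (cbox (- (r *\<^sub>R One)) (r *\<^sub>R One))"
    and "((\<lambda>y. q y *\<^sub>C blinfun_apply (shift y) f) has_integral convolve q f) UNIV"
proof -
  let ?g = "\<lambda>y. q y *\<^sub>C blinfun_apply (shift y) f" and ?K = "cbox (- (r *\<^sub>R One)) (r *\<^sub>R One) :: 'a set"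
  have "continuous_on UNIV ?g"
    by (rule bounded_bilinear.continuous_on[OF bounded_bilinear_scaleC test_functionD(2)[OF q] continuous_on_shift])
  then have "?g integrable_on ?K" by (rule integrable_continuous[OF continuous_on_subset[OF _ subset_UNIV]])
  then have 1: "(?g has_integral integral ?K ?g) ?K" by (rule integrable_integral)
  have 2: "(?g has_integral integral ?K ?g) UNIV"
    by (rule has_integral_on_superset[OF 1]) (simp_all add: r[OF norm_gt_of_not_in_cbox])
  then have "convolve q f = integral ?K ?g" unfolding convolve_def by (rule integral_unique)
  with 1 2 show "(?g has_integral convolve q f) ?K" "(?g has_integral convolve q f) UNIV" by simp_all
qed

lemma convolve_has_integral:
  assumes "test_function q"
  shows "((\<lambda>y. q y *\<^sub>C blinfun_apply (shift y) f) has_integral convolve q f) UNIV"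
proof -
  obtain r where "r > 0" "\<And>x. norm x > r \<Longrightarrow> q x = 0" using assms by (rule test_functionE) blast
  then show ?thesis using convolve_has_integral_cbox(2)[OF assms] by blast
qed

lemma convolve_eqI:
  assumes "((\<lambda>y. q y *\<^sub>C blinfun_apply (shift y) f) has_integral g) UNIV"
  shows "convolve q f = g"
  unfolding convolve_def by (rule integral_unique[OF assms])

lemma convolve_add:
  assumes "test_function p" "test_function q"
  shows "convolve (\<lambda>x. p x + q x) f = convolve p f + convolve q f"
  by (rule convolve_eqI)
    (use has_integral_add[OF convolve_has_integral[OF assms(1), of f] convolve_has_integral[OF assms(2), of f]] in \<open>simp add: scaleC_add_left\<close>)

lemma convolve_cmult:
  assumes "test_function q"
  shows "convolve (\<lambda>x. k * q x) f = k *\<^sub>C convolve q f"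
  by (rule convolve_eqI)
    (use has_integral_linear[OF convolve_has_integral[OF assms, of f] bounded_bilinear.bounded_linear_right[OF bounded_bilinear_scaleC, of k]]
      in \<open>simp add: o_def scaleC_scaleC\<close>)

lemma convolve_sum:
  assumes "\<And>i. i \<in> I \<Longrightarrow> test_function (q i)"
  shows "convolve (\<lambda>x. \<Sum>i\<in>I. q i x) f = (\<Sum>i\<in>I. convolve (q i) f)"
  using assms
proof (induction I rule: infinite_finite_induct)
  case (insert i I)
  then show ?case using convolve_add[of "q i" "\<lambda>x. \<Sum>i\<in>I. q i x" f] by (simp add: test_function_sum)
qed (simp_all add: convolve_def)

lemma commute_convolve:
  assumes q: "test_function q" and T: "T \<in> bounded_ops"
    and comm: "\<And>y. blinfun_apply T (blinfun_apply (shift y) f) = blinfun_apply (shift y) (blinfun_apply T f)"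
  shows "blinfun_apply T (convolve q f) = convolve q (blinfun_apply T f)"
  using has_integral_linear[OF convolve_has_integral[OF q, of f] blinfun.bounded_linear_right, of T]
  by (intro convolve_eqI[symmetric]) (simp add: o_def bounded_opsD[OF T] comm)

lemma norm_convolve_le:
  assumes q: "test_function q" and r: "\<And>x. norm x > r \<Longrightarrow> q x = 0" and \<eta>: "\<And>x. norm (q x) \<le> \<eta>"
  shows "norm (convolve q f) \<le> \<eta> * measure lborel (cbox (- (r *\<^sub>R One)) (r *\<^sub>R One) :: 'a::euclidean_space set) * norm (f :: 'a L2)"
proof -
  have e: "\<eta> \<ge> 0" using \<eta>[of 0] norm_ge_zero order_trans by blast
  have "norm (convolve q f) \<le> (\<eta> * norm f) * measure lborel (cbox (- (r *\<^sub>R One)) (r *\<^sub>R One) :: 'a set)"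
    by (rule has_integral_bound[OF _ convolve_has_integral_cbox(1)[OF q r]])
      (auto simp: norm_scaleC_L2 e \<eta> intro: mult_right_mono)
  then show ?thesis by (simp add: mult_ac)
qed

definition convolution :: "('a::euclidean_space \<Rightarrow> complex) \<Rightarrow> 'a op" where
  "convolution q = Blinfun (convolve q)"

lemma convolution_apply:
  assumes q: "test_function q"
  shows "blinfun_apply (convolution q) f = convolve q f"
proof -
  obtain r where r: "r > 0" "\<And>x. norm x > r \<Longrightarrow> q x = 0" using q by (rule test_functionE) blast
  obtain \<eta> where \<eta>: "\<And>x. norm (q x) \<le> \<eta>"
    using compact_support_bounded[OF test_functionD(2)[OF q] r(2)] by blast
  have "bounded_linear (convolve q)"
  proof (rule bounded_linear_intro)
    show "convolve q (f + g) = convolve q f + convolve q g" for f g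
      by (rule convolve_eqI)
        (use has_integral_add[OF convolve_has_integral[OF q, of f] convolve_has_integral[OF q, of g]] in \<open>simp add: blinfun.bilinear_simps scaleC_add_right\<close>)
    show "convolve q (c *\<^sub>R f) = c *\<^sub>R convolve q f" for c f
      using commute_convolve[OF q bounded_ops_intros(3)[of "of_real c"], of f]
      by (simp add: scaleC_of_real blinfun.bilinear_simps)
    show "norm (convolve q f) \<le> norm f * (\<eta> * measure lborel (cbox (- (r *\<^sub>R One)) (r *\<^sub>R One) :: 'a set))" for f
      using norm_convolve_le[where f = f, OF q r(2) \<eta>] by (simp add: mult_ac)
  qed
  then show ?thesis by (simp add: convolution_def bounded_linear_Blinfun_apply)
qed

lemma convolution_bounded_ops:
  fixes q :: "'a::euclidean_space \<Rightarrow> complex"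
  shows "test_function q \<Longrightarrow> convolution q \<in> bounded_ops"
proof (rule bounded_opsI)
  fix k and f :: "'a L2" assume q: "test_function q"
  have "blinfun_apply (shift y) (k *\<^sub>C f) = k *\<^sub>C blinfun_apply (shift y) f" for y
    by (rule bounded_opsD[OF shift_bounded_ops])
  then show "blinfun_apply (convolution q) (k *\<^sub>C f) = k *\<^sub>C blinfun_apply (convolution q) f"
    using commute_convolve[OF q bounded_ops_intros(3)[of k], of f] by (simp add: convolution_apply[OF q])
qed

lemma finite_range_convolution:
  assumes q: "test_function q" and r: "\<And>x. norm x > r \<Longrightarrow> q x = 0"
  shows "convolution q \<in> finite_range_ops r"
proof (rule finite_range_opsI[OF convolution_bounded_ops[OF q]])
  fix a b :: 'a and s t :: real assume st: "s > 0" "t > 0" and far: "dist a b > s + t + r"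
  have z: "q y *\<^sub>C blinfun_apply (proj (ball a s)) (blinfun_apply (shift y) (blinfun_apply (proj (ball b t)) f)) = 0" for y f
  proof (cases "norm y > r")
    case False
    have "proj (ball a s) o\<^sub>L (shift y o\<^sub>L proj (ball b t)) = 0"
      by (rule finite_range_opsD(2)[OF finite_range_shift st]) (use far False in auto)
    from arg_cong[OF this, of "\<lambda>A. blinfun_apply A f"] show ?thesis by simp
  qed (simp add: r)
  show "proj (ball a s) o\<^sub>L (convolution q o\<^sub>L proj (ball b t)) = 0"
  proof (rule blinfun_eqI)
    fix f
    let ?f = "blinfun_apply (proj (ball b t)) f"
    have "((\<lambda>y. blinfun_apply (proj (ball a s)) (q y *\<^sub>C blinfun_apply (shift y) ?f)) has_integral blinfun_apply (proj (ball a s)) (convolve q ?f)) UNIV"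
      using has_integral_linear[OF convolve_has_integral[OF q, of ?f] blinfun.bounded_linear_right] by (simp add: o_def)
    then have "((\<lambda>y. 0) has_integral blinfun_apply (proj (ball a s)) (convolve q ?f)) UNIV"
      by (simp add: bounded_opsD[OF proj_bounded_ops] z)
    then have "blinfun_apply (proj (ball a s)) (convolve q ?f) = 0" by (simp add: has_integral_0_eq)
    then show "blinfun_apply (proj (ball a s) o\<^sub>L (convolution q o\<^sub>L proj (ball b t))) f = blinfun_apply 0 f"
      by (simp add: convolution_apply[OF q])
  qed
qed

lemma shift_convolve:
  assumes q: "test_function q"
  shows "blinfun_apply (shift z) (convolve q f) = convolve (\<lambda>y. q (y - z)) f"
proof -
  obtain r where r: "r > 0" "\<And>x. norm x > r \<Longrightarrow> q x = 0" using q by (rule test_functionE) blast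
  let ?K = "cbox (- (r *\<^sub>R One)) (r *\<^sub>R One) :: 'a set"
  let ?G = "\<lambda>y. q y *\<^sub>C blinfun_apply (shift (z + y)) f"
  have c: "((\<lambda>y. q y *\<^sub>C blinfun_apply (shift y) f) has_integral convolve q f) ?K"
    by (rule convolve_has_integral_cbox(1)[OF q r(2)])
  have "(?G has_integral blinfun_apply (shift z) (convolve q f)) ?K"
    using has_integral_linear[OF c blinfun.bounded_linear_right[of "shift z"]]
    by (simp add: o_def bounded_opsD[OF shift_bounded_ops] shift_shift_apply)
  from has_integral_affinity[OF this, of 1 "- z"]
  have "((\<lambda>y. q (y - z) *\<^sub>C blinfun_apply (shift y) f) has_integral blinfun_apply (shift z) (convolve q f)) ((\<lambda>x. x + z) ` ?K)"
    by simp
  then have "((\<lambda>y. q (y - z) *\<^sub>C blinfun_apply (shift y) f) has_integral blinfun_apply (shift z) (convolve q f)) UNIV"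
  proof (rule has_integral_on_superset)
    fix x assume "x \<notin> (\<lambda>x. x + z) ` ?K"
    then have "x - z \<notin> ?K" by (metis diff_add_cancel image_eqI)
    then show "q (x - z) *\<^sub>C blinfun_apply (shift x) f = 0" by (simp add: r(2)[OF norm_gt_of_not_in_cbox])
  qed simp
  then show ?thesis by (rule convolve_eqI[symmetric])
qed

lemma test_function_discrete_laplacian:
  assumes "test_function q"
  shows "test_function (discrete_laplacian h q)"
proof -
  have "test_function (\<lambda>x. (1 / of_real (h\<^sup>2)) * ((q (x - h *\<^sub>R b) + q (x - - (h *\<^sub>R b))) + (- 2) * q x))" for b
    by (intro test_function_cmult test_function_add test_function_translation assms)
  then show ?thesis
    unfolding discrete_laplacian_def[abs_def] by (intro test_function_sum) simp
qed

lemma discrete_op_convolve: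
  assumes q: "test_function q" and h: "h > 0"
  shows "blinfun_apply (discrete_op a h) (convolve q f) = of_real a *\<^sub>C convolve q f - convolve (discrete_laplacian h q) f"
proof -
  have "convolve (discrete_laplacian h q) f
      = (\<Sum>b\<in>Basis. convolve (\<lambda>x. (1 / of_real (h\<^sup>2)) * ((q (x - h *\<^sub>R b) + q (x - - (h *\<^sub>R b))) + (- 2) * q x)) f)"
  proof -
    have "discrete_laplacian h q = (\<lambda>x. \<Sum>b\<in>Basis. (1 / of_real (h\<^sup>2)) * ((q (x - h *\<^sub>R b) + q (x - - (h *\<^sub>R b))) + (- 2) * q x))"
      by (simp add: discrete_laplacian_def[abs_def])
    then show ?thesis
      by (simp only:) (intro convolve_sum test_function_cmult test_function_add test_function_translation q)
  qed
  also have "\<dots> = (\<Sum>b\<in>Basis. (1 / h\<^sup>2) *\<^sub>R (blinfun_apply (shift (h *\<^sub>R b) + shift (- (h *\<^sub>R b))) (convolve q f) - 2 *\<^sub>R convolve q f))"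
  proof (rule sum.cong[OF refl])
    fix b :: 'a
    let ?p = "\<lambda>x. q (x - h *\<^sub>R b)" and ?p' = "\<lambda>x. q (x - - (h *\<^sub>R b))"
    have t: "test_function ?p" "test_function ?p'" by (intro test_function_translation q)+
    have "convolve (\<lambda>x. (1 / of_real (h\<^sup>2)) * ((?p x + ?p' x) + (- 2) * q x)) f
        = (1 / of_real (h\<^sup>2)) *\<^sub>C ((convolve ?p f + convolve ?p' f) + (- 2) *\<^sub>C convolve q f)"
      by (simp only: convolve_cmult convolve_add t q test_function_add test_function_cmult)
    also have "convolve ?p f = blinfun_apply (shift (h *\<^sub>R b)) (convolve q f)" by (rule shift_convolve[OF q, symmetric])
    also have "convolve ?p' f = blinfun_apply (shift (- (h *\<^sub>R b))) (convolve q f)" by (rule shift_convolve[OF q, symmetric])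
    finally show "convolve (\<lambda>x. (1 / of_real (h\<^sup>2)) * ((?p x + ?p' x) + (- 2) * q x)) f
        = (1 / h\<^sup>2) *\<^sub>R (blinfun_apply (shift (h *\<^sub>R b) + shift (- (h *\<^sub>R b))) (convolve q f) - 2 *\<^sub>R convolve q f)"
      using scaleC_of_real[of "1 / h\<^sup>2"] scaleC_of_real[of "-2" "convolve q f"]
      by (simp add: blinfun.bilinear_simps)
  qed
  also have "\<dots> = (1 / h\<^sup>2) *\<^sub>R (blinfun_apply (shift_sum h) (convolve q f) - (2 * DIM('a)) *\<^sub>R convolve q f)"
    unfolding shift_sum_def blinfun_apply_sum
    by (simp add: scaleR_sum_right[symmetric] sum_subtractf sum_constant_scaleR mult.commute del: blinfun.sum_left)
  finally show ?thesis
    by (simp add: discrete_op_def blinfun.bilinear_simps scaleC_of_real scaleR_diff_right scaleR_add_left)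
qed

text \<open>
  After a convolution with a test function the discrete resolvents converge in norm, by the
  resolvent identity and since the discrete Laplacians of the kernel converge uniformly.
\<close>

lemma discrete_resolvent_convolution_estimate:
  fixes q :: "'a::euclidean_space \<Rightarrow> complex"
  assumes q: "test_function q" and r: "\<And>x. norm x > r \<Longrightarrow> q x = 0" and a: "a > 0"
    and h: "0 < h" "h \<le> 1" and h': "0 < h'" "h' \<le> 1"
    and e: "\<And>x. norm (discrete_laplacian h q x - laplacian q x) \<le> e" "\<And>x. norm (discrete_laplacian h' q x - laplacian q x) \<le> e"
  shows "norm ((discrete_resolvent a h o\<^sub>L convolution q) - (discrete_resolvent a h' o\<^sub>L convolution q))
    \<le> 2 * e * measure lborel (cbox (- ((r + 1) *\<^sub>R One)) ((r + 1) *\<^sub>R One) :: 'a set) / (a * a)"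
proof (rule norm_blinfun_bound)
  let ?c = "measure lborel (cbox (- ((r + 1) *\<^sub>R One)) ((r + 1) *\<^sub>R One) :: 'a set)"
  have e0: "e \<ge> 0" using e(1)[of 0] norm_ge_zero order_trans by blast
  then show "0 \<le> 2 * e * ?c / (a * a)" using a by simp
  fix f
  let ?R = "discrete_resolvent a h :: 'a op" and ?S = "discrete_resolvent a h' :: 'a op"
  let ?X = "discrete_op a h :: 'a op" and ?Y = "discrete_op a h' :: 'a op"
  have RS: "?R - ?S = (?R o\<^sub>L ?S) o\<^sub>L (?Y - ?X)"
  proof -
    have "(?R o\<^sub>L ?S) o\<^sub>L ?Y = ?R"
      by (simp add: blinfun_compose_assoc discrete_resolvent_inverse[OF a h'(1)])
    moreover have "(?R o\<^sub>L ?S) o\<^sub>L ?X = ?S"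
    proof -
      have "?S o\<^sub>L ?X = (?S o\<^sub>L ?X) o\<^sub>L (?Y o\<^sub>L ?S)" by (simp add: discrete_resolvent_inverse[OF a h'(1)])
      also have "\<dots> = ?S o\<^sub>L ((?X o\<^sub>L ?Y) o\<^sub>L ?S)" by (simp add: blinfun_compose_assoc)
      also have "\<dots> = (?S o\<^sub>L ?Y) o\<^sub>L (?X o\<^sub>L ?S)" by (simp add: discrete_op_commute[of a h h'] blinfun_compose_assoc)
      also have "\<dots> = ?X o\<^sub>L ?S" by (simp add: discrete_resolvent_inverse[OF a h'(1)])
      finally have "?R o\<^sub>L (?S o\<^sub>L ?X) = ?R o\<^sub>L (?X o\<^sub>L ?S)" by (rule arg_cong)
      also have "\<dots> = (?R o\<^sub>L ?X) o\<^sub>L ?S" by (simp only: blinfun_compose_assoc)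
      finally show ?thesis by (simp add: blinfun_compose_assoc[of ?R ?S ?X] discrete_resolvent_inverse[OF a h(1)])
    qed
    ultimately show ?thesis by (simp add: compose_distribs)
  qed
  define p where "p x = discrete_laplacian h q x + (-1) * discrete_laplacian h' q x" for x
  have p: "test_function p"
    unfolding p_def[abs_def] by (intro test_function_add test_function_cmult test_function_discrete_laplacian q)
  have "blinfun_apply (?Y - ?X) (convolve q f) = convolve (discrete_laplacian h q) f - convolve (discrete_laplacian h' q) f"
    by (simp add: blinfun.bilinear_simps discrete_op_convolve[OF q] h h')
  also have "\<dots> = convolve p f"
    unfolding p_def[abs_def]
    by (simp only: convolve_add convolve_cmult test_function_cmult test_function_discrete_laplacian[OF q])
      (simp add: scaleC_uminus_left)
  finally have YX: "blinfun_apply (?Y - ?X) (convolve q f) = convolve p f" .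
  have "norm (convolve p f) \<le> 2 * e * ?c * norm f"
  proof (rule norm_convolve_le[OF p])
    show "p x = 0" if "norm x > r + 1" for x
      using discrete_laplacian_support[of r q x h, OF r] discrete_laplacian_support[of r q x h', OF r] that h h'
      by (simp add: p_def)
    show "norm (p x) \<le> 2 * e" for x
    proof -
      have "p x = (discrete_laplacian h q x - laplacian q x) - (discrete_laplacian h' q x - laplacian q x)" by (simp add: p_def)
      also have "norm \<dots> \<le> e + e" by (rule order_trans[OF norm_triangle_ineq4 add_mono[OF e(1) e(2)]])
      finally show ?thesis by simp
    qed
  qed
  have "norm (blinfun_apply ((?R o\<^sub>L convolution q) - (?S o\<^sub>L convolution q)) f) = norm (blinfun_apply (?R - ?S) (convolve q f))"
    by (simp add: blinfun.bilinear_simps convolution_apply[OF q])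
  also have "\<dots> = norm (blinfun_apply ?R (blinfun_apply ?S (convolve p f)))" by (simp add: RS YX)
  also have "\<dots> \<le> norm (blinfun_apply ?S (convolve p f)) / a" by (rule norm_discrete_resolvent_apply[OF a h(1)])
  also have "\<dots> \<le> (norm (convolve p f) / a) / a"
    using a by (intro divide_right_mono norm_discrete_resolvent_apply[OF a h'(1)]) auto
  also have "\<dots> \<le> (2 * e * ?c * norm f / a) / a"
    using a \<open>norm (convolve p f) \<le> 2 * e * ?c * norm f\<close> by (intro divide_right_mono) auto
  finally show "norm (blinfun_apply ((?R o\<^sub>L convolution q) - (?S o\<^sub>L convolution q)) f) \<le> 2 * e * ?c / (a * a) * norm f"
    by (simp add: mult_ac)
qed

lemma discrete_resolvent_std_algebra: "a > 0 \<Longrightarrow> h > 0 \<Longrightarrow> discrete_resolvent a h \<in> std_algebra"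
  by (rule discrete_resolvent_in[OF closed_subalgebra_std_algebra])
    (auto intro: finite_range_subset_std_algebra[OF finite_range_shift])

lemma free_resolvent_convolution_std_algebra:
  assumes q: "test_function q" and a: "a > 0"
  shows "free_resolvent a o\<^sub>L convolution q \<in> (std_algebra :: 'a::euclidean_space op set)"
proof -
  obtain r where r: "r > 0" "\<And>x. norm x > r \<Longrightarrow> q x = 0" using q by (rule test_functionE) blast
  let ?c = "measure lborel (cbox (- ((r + 1) *\<^sub>R One)) ((r + 1) *\<^sub>R One) :: 'a set)"
  define h where "h n = inverse (real (Suc n))" for n
  have h: "0 < h n" "h n \<le> 1" for n by (auto simp: h_def field_simps)
  have h0: "h \<longlonglongrightarrow> 0" unfolding h_def by (rule LIMSEQ_inverse_real_of_nat)
  define A where "A n = discrete_resolvent a (h n) o\<^sub>L convolution q" for n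
  have "Cauchy A"
  proof (rule CauchyI)
    fix e :: real assume e: "e > 0"
    define \<delta> where "\<delta> = e * (a * a) / (2 * (?c + 1))"
    have \<delta>: "\<delta> > 0" using e a by (simp add: \<delta>_def add_nonneg_pos)
    obtain d where d: "d > 0" "\<And>h x. 0 < h \<Longrightarrow> h < d \<Longrightarrow> norm (discrete_laplacian h q x - laplacian q x) \<le> \<delta>"
      using discrete_laplacian_uniform[OF q \<delta>] by blast
    have "\<forall>\<^sub>F n in sequentially. h n < d" using h0 d(1) by (rule order_tendstoD)
    then obtain N where N: "\<And>n. n \<ge> N \<Longrightarrow> h n < d" by (auto simp: eventually_sequentially)
    have "norm (A m - A n) < e" if "m \<ge> N" "n \<ge> N" for m n
    proof -
      have "norm (A m - A n) \<le> 2 * \<delta> * ?c / (a * a)"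
        unfolding A_def
        by (rule discrete_resolvent_convolution_estimate[OF q r(2) a h h d(2)[OF h(1) N[OF that(1)]] d(2)[OF h(1) N[OF that(2)]]])
      also have "\<dots> = e * (?c / (?c + 1))" using a by (simp add: \<delta>_def divide_simps)
      also have "\<dots> < e * 1" using e by (intro mult_strict_left_mono) (auto simp: add_nonneg_pos)
      finally show ?thesis by simp
    qed
    then show "\<exists>N. \<forall>m\<ge>N. \<forall>n\<ge>N. norm (A m - A n) < e" by blast
  qed
  then obtain L where L: "A \<longlonglongrightarrow> L" using Cauchy_convergent convergent_def by blast
  have "A n \<in> std_algebra" for n
    unfolding A_def
    by (intro std_algebraD(4) discrete_resolvent_std_algebra a h finite_range_subset_std_algebra[OF finite_range_convolution[OF q r(2)]])
  then have LA: "L \<in> std_algebra" using closed_sequentially[OF std_algebraD(1) _ L] by blast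
  have "L = free_resolvent a o\<^sub>L convolution q"
  proof (rule blinfun_eqI)
    fix f
    have "(\<lambda>n. blinfun_apply (A n) f) \<longlonglongrightarrow> blinfun_apply L f" by (intro blinfun.tendsto L tendsto_const)
    moreover have "(\<lambda>n. blinfun_apply (A n) f) \<longlonglongrightarrow> blinfun_apply (free_resolvent a) (blinfun_apply (convolution q) f)"
      unfolding A_def using discrete_resolvent_tendsto[OF a h(1) h0] by simp
    ultimately show "blinfun_apply L f = blinfun_apply (free_resolvent a o\<^sub>L convolution q) f"
      using LIMSEQ_unique by fastforce
  qed
  with LA show ?thesis by simp
qed

text \<open>
  A box bump divided by its integral, which is positive because the bump is continuous and positive
  at the origin.
\<close>

lemma exists_mollifier:
  assumes d: "\<delta> > 0"
  obtains q :: "'a::euclidean_space \<Rightarrow> real" where "test_function (\<lambda>x. complex_of_real (q x))" "\<And>x. q x \<ge> 0"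
    "\<And>x. x \<notin> cbox (- (\<delta> *\<^sub>R One)) (\<delta> *\<^sub>R One) \<Longrightarrow> q x = 0" "(q has_integral 1) (cbox (- (\<delta> *\<^sub>R One)) (\<delta> *\<^sub>R One))"
proof -
  let ?l = "- (\<delta> *\<^sub>R One) :: 'a" and ?u = "\<delta> *\<^sub>R One :: 'a"
  let ?b = "box_bump 1 ?l ?u"
  have t: "test_function (\<lambda>x. complex_of_real (?b x))" by (rule test_function_box_bump) simp
  have c: "continuous_on UNIV ?b"
    using continuous_on_Re[OF test_functionD(2)[OF t]] by simp
  then have i: "(?b has_integral integral (cbox ?l ?u) ?b) (cbox ?l ?u)"
    by (intro integrable_integral integrable_continuous continuous_on_subset[OF c]) auto
  have in_box: "(0::'a) \<in> box ?l ?u" using d by (simp add: mem_box)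
  define I where "I = integral (cbox ?l ?u) ?b"
  have "I \<ge> 0" unfolding I_def by (rule integral_nonneg) (use i box_bump_range in auto)
  moreover have "I \<noteq> 0"
  proof
    assume "I = 0"
    then have "(?b has_integral 0) (cbox ?l ?u)" using i by (simp add: I_def)
    then have "?b 0 = 0"
      by (rule has_integral_0_cbox_imp_0[rotated 2])
        (use in_box box_subset_cbox box_bump_range in \<open>auto intro: continuous_on_subset[OF c]\<close>)
    moreover have "?b 0 > 0" using in_box by (subst box_bump_pos_iff) auto
    ultimately show False by simp
  qed
  ultimately have I: "I > 0" by simp
  show thesis
  proof (rule that[of "\<lambda>x. (1/I) * ?b x"])
    show "test_function (\<lambda>x. complex_of_real ((1/I) * ?b x))"
      using test_function_cmult[OF t, of "of_real (1/I)"] by simp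
    show "(1/I) * ?b x \<ge> 0" for x using I box_bump_range(1)[of 1 ?l ?u x] by simp
    show "(1/I) * ?b x = 0" if "x \<notin> cbox ?l ?u" for x
      using that box_subset_cbox by (subst box_bump_0) auto
    show "((\<lambda>x. (1/I) * ?b x) has_integral 1) (cbox ?l ?u)"
      using has_integral_mult_right[OF i, of "1/I"] I by (simp add: I_def)
  qed
qed

text \<open>
  Translations are Lipschitz continuous after the free resolvent, so convolving with a mollifier
  changes the free resolvent little in norm, which puts the latter into the closed algebra.
\<close>

lemma free_resolvent_std_algebra:
  assumes a: "a > 0"
  shows "free_resolvent a \<in> (std_algebra :: 'a::euclidean_space op set)"
proof -
  have "\<exists>A\<in>std_algebra. dist A (free_resolvent a :: 'a op) < e" if e: "e > 0" for e
  proof -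
    let ?D = "real DIM('a)"
    define \<delta> where "\<delta> = e * sqrt a / (2 * ?D)"
    have \<delta>: "\<delta> > 0" using e a by (simp add: \<delta>_def)
    obtain q :: "'a \<Rightarrow> real" where q: "test_function (\<lambda>x. complex_of_real (q x))" "\<And>x. q x \<ge> 0"
      "\<And>x. x \<notin> cbox (- (\<delta> *\<^sub>R One)) (\<delta> *\<^sub>R One) \<Longrightarrow> q x = 0" "(q has_integral 1) (cbox (- (\<delta> *\<^sub>R One)) (\<delta> *\<^sub>R One))"
      using exists_mollifier[OF \<delta>] by blast
    let ?K = "cbox (- (\<delta> *\<^sub>R One)) (\<delta> *\<^sub>R One) :: 'a set"
    let ?q = "\<lambda>x. complex_of_real (q x)"
    let ?A = "free_resolvent a o\<^sub>L convolution ?q"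
    have "norm (?A - free_resolvent a) \<le> e / 2"
    proof (rule norm_blinfun_bound)
      fix f :: "'a L2"
      let ?g = "blinfun_apply (free_resolvent a) f"
      have "blinfun_apply ?A f = convolve ?q ?g"
        unfolding blinfun_apply_blinfun_compose convolution_apply[OF q(1)]
        by (rule commute_convolve[OF q(1) free_resolvent(1)[OF a] free_resolvent_commute_shift[OF a]])
      have U: "((\<lambda>y. q y *\<^sub>R blinfun_apply (shift y) ?g) has_integral convolve ?q ?g) UNIV"
        using convolve_has_integral[OF q(1), of ?g] by (simp add: scaleC_of_real)
      have zero: "(if y \<in> ?K then q y *\<^sub>R blinfun_apply (shift y) ?g else 0) = q y *\<^sub>R blinfun_apply (shift y) ?g" for y
        using q(3)[of y] by auto
      have 1: "((\<lambda>y. q y *\<^sub>R blinfun_apply (shift y) ?g) has_integral convolve ?q ?g) ?K"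
        using has_integral_restrict_UNIV[of ?K "\<lambda>y. q y *\<^sub>R blinfun_apply (shift y) ?g" "convolve ?q ?g"] U by (simp only: zero)
      have 2: "((\<lambda>y. q y *\<^sub>R ?g) has_integral 1 *\<^sub>R ?g) ?K"
        using has_integral_linear[OF q(4) bounded_linear_scaleR_left[of ?g]] by (simp add: o_def)
      have 3: "((\<lambda>y. q y *\<^sub>R (blinfun_apply (shift y) ?g - ?g)) has_integral (convolve ?q ?g - ?g)) ?K"
        using has_integral_diff[OF 1 2] by (simp add: scaleR_diff_right)
      have 4: "((\<lambda>y. q y * (e / 2 * norm f)) has_integral (1 * (e / 2 * norm f))) ?K"
        by (rule has_integral_mult_left[OF q(4)])
      have "norm (integral ?K (\<lambda>y. q y *\<^sub>R (blinfun_apply (shift y) ?g - ?g))) \<le> integral ?K (\<lambda>y. q y * (e / 2 * norm f))"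
      proof (rule integral_norm_bound_integral)
        fix y assume y: "y \<in> ?K"
        have "(\<Sum>b\<in>Basis. \<bar>y \<bullet> b\<bar>) \<le> (\<Sum>b\<in>(Basis::'a set). \<delta>)"
          using y by (intro sum_mono) (auto simp: mem_box abs_le_iff)
        also have "\<dots> = ?D * \<delta>" by simp
        finally have "(\<Sum>b\<in>Basis. \<bar>y \<bullet> b\<bar>) * (norm f / sqrt a) \<le> ?D * \<delta> * (norm f / sqrt a)"
          using a by (intro mult_right_mono) auto
        also have "\<dots> = e / 2 * norm f" using a by (simp add: \<delta>_def)
        finally have "norm (blinfun_apply (shift y) ?g - ?g) \<le> e / 2 * norm f"
          using free_resolvent_Lipschitz[OF a, of y f] by linarith
        from mult_left_mono[OF this q(2)[of y]]
        show "norm (q y *\<^sub>R (blinfun_apply (shift y) ?g - ?g)) \<le> q y * (e / 2 * norm f)"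
          using q(2)[of y] by simp
      qed (use 3 4 in \<open>auto simp: integrable_on_def\<close>)
      then have "norm (convolve ?q ?g - ?g) \<le> e / 2 * norm f"
        by (simp only: integral_unique[OF 3] integral_unique[OF 4] mult_1)
      then show "norm (blinfun_apply (?A - free_resolvent a) f) \<le> e / 2 * norm f"
        using \<open>blinfun_apply ?A f = convolve ?q ?g\<close> by (simp add: blinfun.diff_left)
    qed (use e in simp)
    then have "dist ?A (free_resolvent a) < e" using e by (simp add: dist_norm)
    with free_resolvent_convolution_std_algebra[OF q(1) a] show ?thesis by blast
  qed
  then have "free_resolvent a \<in> closure (std_algebra :: 'a op set)" unfolding closure_approachable by blast
  then show ?thesis by (simp add: std_algebraD(1))
qed

section \<open>Potentials\<close>

lemma mult_op_iff: "(f, k) \<in> mult_op V \<longleftrightarrow> (AE x in lebesgue. rep_L2 k x = V x * rep_L2 f x)"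
  by (simp add: mult_op_def)

lemma mult_op_unique:
  assumes "(f, k) \<in> mult_op V" "(f, k') \<in> mult_op V"
  shows "k = k'"
proof (rule L2_eqI)
  show "AE x in lebesgue. rep_L2 k x = rep_L2 k' x"
    using assms unfolding mult_op_iff by eventually_elim simp
qed

lemma mult_op_add:
  assumes "(f, k) \<in> mult_op V" "(f', k') \<in> mult_op V"
  shows "(f + f', k + k') \<in> mult_op V"
  using assms rep_add[of f f'] rep_add[of k k'] unfolding mult_op_iff
  by eventually_elim (simp add: distrib_left)

lemma mult_op_scaleC:
  assumes "(f, k) \<in> mult_op V"
  shows "(c *\<^sub>C f, c *\<^sub>C k) \<in> mult_op V"
  using assms rep_scaleC[of c f] rep_scaleC[of c k] unfolding mult_op_iff
  by eventually_elim simp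

lemma mult_op_potential_diff:
  assumes "(f, k) \<in> mult_op V" "(f, k') \<in> mult_op W"
  shows "(f, k - k') \<in> mult_op (\<lambda>x. V x - W x)"
  using assms rep_diff[of k k'] unfolding mult_op_iff
  by eventually_elim (simp add: left_diff_distrib)

lemma mult_op_proj:
  assumes fk: "(f, k) \<in> mult_op V" and E: "E \<in> sets lebesgue"
  shows "(blinfun_apply (proj E) f, blinfun_apply (proj E) k) \<in> mult_op V"
  using fk rep_proj[OF E, of f] rep_proj[OF E, of k] unfolding mult_op_iff
  by eventually_elim simp

lemma mult_op_of_sq_integrable:
  "sq_integrable (\<lambda>x. V x * rep_L2 f x) \<Longrightarrow> (f, L2_of (\<lambda>x. V x * rep_L2 f x)) \<in> mult_op V"
  unfolding mult_op_iff by (rule rep_L2_of)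

text \<open>
  A finite norm makes the product of \<open>V\<close> with \<open>A f\<close> square integrable for \<open>f\<close> in the unit ball, and
  homogeneity extends this to all \<open>f\<close>. Linearity and complex homogeneity follow since a product with
  \<open>V\<close> is unique almost everywhere.
\<close>

lemma potential_operator:
  assumes A: "A \<in> bounded_ops" and c: "c \<ge> 0" "pot_norm A V \<le> ennreal c"
  obtains T where "T \<in> bounded_ops" "norm T \<le> c" "\<And>f. (blinfun_apply A f, blinfun_apply T f) \<in> mult_op V"
proof -
  have unit: "\<exists>k. (blinfun_apply A f, k) \<in> mult_op V \<and> norm k \<le> c" if f: "norm f \<le> 1" for f
  proof -
    let ?k = "\<lambda>x. V x * rep_L2 (blinfun_apply A f) x"
    have "L2_enorm ?k \<le> pot_norm A V" unfolding pot_norm_def by (rule SUP_upper) (use f in simp)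
    then have le: "L2_enorm ?k \<le> ennreal c" using c(2) by (rule order_trans)
    have sq: "sq_integrable ?k"
    proof (rule ccontr)
      assume "\<not> sq_integrable ?k"
      then have "L2_enorm ?k = \<infinity>" by (simp add: L2_enorm_def)
      with le show False by (simp add: top_unique)
    qed
    with le have "norm (L2_of ?k) \<le> c" using c(1) by (simp add: L2_enorm_def)
    with mult_op_of_sq_integrable[OF sq] show ?thesis by blast
  qed
  have "\<exists>k. (blinfun_apply A f, k) \<in> mult_op V \<and> norm k \<le> norm f * c" for f
  proof (cases "f = 0")
    case True
    have "(0, 0) \<in> mult_op V" unfolding mult_op_iff using rep_zero by eventually_elim simp
    with True show ?thesis by auto
  next
    case False
    define u where "u = (1 / norm f) *\<^sub>R f"
    have "norm u \<le> 1" using False by (simp add: u_def)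
    then obtain k where k: "(blinfun_apply A u, k) \<in> mult_op V" "norm k \<le> c" using unit by blast
    have "of_real (norm f) *\<^sub>C u = f" using False by (simp add: u_def scaleC_of_real)
    then have "(blinfun_apply A f, of_real (norm f) *\<^sub>C k) \<in> mult_op V"
      using mult_op_scaleC[OF k(1), of "of_real (norm f)"] bounded_opsD[OF A, of "of_real (norm f)" u] by simp
    moreover have "norm (of_real (norm f) *\<^sub>C k) \<le> norm f * c"
      using k(2) by (simp add: norm_scaleC_L2 mult_left_mono)
    ultimately show ?thesis by blast
  qed
  then obtain t where t: "\<And>f. (blinfun_apply A f, t f) \<in> mult_op V" "\<And>f. norm (t f) \<le> norm f * c" by metis
  have tC: "t (k *\<^sub>C f) = k *\<^sub>C t f" for k f
    by (rule mult_op_unique[OF t(1)]) (simp add: bounded_opsD[OF A] mult_op_scaleC t(1))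
  have "bounded_linear t"
  proof (rule bounded_linear_intro[OF _ _ t(2)])
    show "t (f + g) = t f + t g" for f g
      by (rule mult_op_unique[OF t(1)]) (simp add: blinfun.add_right mult_op_add t(1))
    show "t (r *\<^sub>R f) = r *\<^sub>R t f" for r f
      using tC[of "of_real r" f] by (simp add: scaleC_of_real)
  qed
  then have app: "blinfun_apply (Blinfun t) = t" by (rule bounded_linear_Blinfun_apply)
  show thesis
  proof (rule that[of "Blinfun t"])
    show "Blinfun t \<in> bounded_ops" by (rule bounded_opsI) (simp add: app tC)
    show "norm (Blinfun t) \<le> c" by (rule norm_blinfun_bound[OF c(1)]) (use t(2) in \<open>simp add: app mult.commute\<close>)
    show "(blinfun_apply A f, blinfun_apply (Blinfun t) f) \<in> mult_op V" for f by (simp add: app t(1))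
  qed
qed

text \<open>
  A multiplication commutes with all spatial projections, which is why it has range zero.
\<close>

lemma bounded_multiplication:
  assumes B: "ess_bounded B"
  obtains M where "M \<in> finite_range_ops 0" "\<And>f. (f, blinfun_apply M f) \<in> mult_op B"
proof -
  obtain K where K: "AE x in lebesgue. norm (B x) \<le> K" and Bm: "B \<in> borel_measurable lebesgue"
    using B by (auto simp: ess_bounded_def)
  define c where "c = max K 0"
  have c: "c \<ge> 0" by (simp add: c_def)
  have "L2_enorm (\<lambda>x. B x * rep_L2 f x) \<le> ennreal c" if f: "norm f \<le> 1" for f
  proof -
    have le: "AE x in lebesgue. norm (B x * rep_L2 f x) \<le> norm (of_real c * rep_L2 f x)"
      using K
    proof eventually_elim
      case (elim x)
      then have "norm (B x) \<le> c" by (simp add: c_def)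
      then show ?case using c by (simp add: norm_mult mult_right_mono)
    qed
    have m: "(\<lambda>x. B x * rep_L2 f x) \<in> borel_measurable lebesgue"
      by (intro borel_measurable_times Bm rep_L2_measurable)
    have sc: "sq_integrable (\<lambda>x. of_real c * rep_L2 f x)" by (rule sq_integrable_scaleC[OF sq_integrable_rep_L2])
    have sq: "sq_integrable (\<lambda>x. B x * rep_L2 f x)"
      unfolding sq_integrable_def
    proof
      show "integrable lebesgue (\<lambda>x. (norm (B x * rep_L2 f x))\<^sup>2)"
      proof (rule Bochner_Integration.integrable_bound)
        show "integrable lebesgue (\<lambda>x. (norm (of_real c * rep_L2 f x))\<^sup>2)" using sc by (simp add: sq_integrable_def)
        show "AE x in lebesgue. norm ((norm (B x * rep_L2 f x))\<^sup>2) \<le> norm ((norm (of_real c * rep_L2 f x))\<^sup>2)"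
          using le by eventually_elim (simp add: power_mono del: norm_of_real norm_mult)
      qed (use m in measurable)
    qed (rule m)
    have "norm (L2_of (\<lambda>x. B x * rep_L2 f x)) \<le> norm (L2_of (\<lambda>x. of_real c * rep_L2 f x))"
      by (rule norm_L2_of_mono[OF sq sc le])
    also have "\<dots> = c * norm f"
      using c by (simp add: L2_of_scaleC sq_integrable_rep_L2 L2_of_rep_L2 norm_scaleC_L2)
    also have "\<dots> \<le> c" using mult_left_mono[OF f c] by simp
    finally show ?thesis using sq c by (simp add: L2_enorm_def ennreal_leI)
  qed
  then have "pot_norm id_blinfun B \<le> ennreal c" unfolding pot_norm_def by (intro SUP_least) simp
  from potential_operator[OF bounded_ops_intros(2) c this]
  obtain M where M: "M \<in> bounded_ops" "\<And>f. (f, blinfun_apply M f) \<in> mult_op B" by auto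
  have comm: "M o\<^sub>L proj E = proj E o\<^sub>L M" if "E \<in> sets lebesgue" for E
    by (rule blinfun_eqI) (simp add: mult_op_unique[OF M(2) mult_op_proj[OF M(2) that]])
  have "M \<in> finite_range_ops 0"
  proof (rule finite_range_opsI[OF M(1)])
    fix a b :: 'a and r s :: real assume rs: "r > 0" "s > 0" and far: "dist a b > r + s + 0"
    have "proj (ball a r) o\<^sub>L (M o\<^sub>L proj (ball b s)) = (proj (ball a r) o\<^sub>L (id_blinfun o\<^sub>L proj (ball b s))) o\<^sub>L M"
      by (simp add: comm blinfun_compose_assoc)
    then show "proj (ball a r) o\<^sub>L (M o\<^sub>L proj (ball b s)) = 0"
      unfolding finite_range_opsD(2)[OF finite_range_id rs far] by simp
  qed
  with M(2) show thesis by (intro that)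
qed

text \<open>
  If \<open>B\<close> is bounded and close to \<open>V\<close> in the potential norm, then the product of \<open>V\<close> and \<open>R\<close> is close in
  norm to that of \<open>B\<close> and \<open>R\<close>, whose factors both belong to the algebra.
\<close>

lemma potential_operator_std_algebra:
  assumes R: "R \<in> std_algebra" and V: "V \<in> pot_space_closure R"
    and T: "\<And>f. (blinfun_apply R f, blinfun_apply T f) \<in> mult_op V"
  shows "T \<in> std_algebra"
proof -
  have "\<exists>A\<in>std_algebra. dist A T < e" if e: "e > 0" for e
  proof -
    from V e obtain B where B: "ess_bounded B" "pot_norm R (\<lambda>x. V x - B x) < ennreal (e/2)"
      by (auto simp: pot_space_closure_def dest: spec[of _ "e/2"])
    obtain M where M: "M \<in> finite_range_ops 0" "\<And>f. (f, blinfun_apply M f) \<in> mult_op B"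
      using bounded_multiplication[OF B(1)] by blast
    obtain D where D: "norm D \<le> e/2" "\<And>f. (blinfun_apply R f, blinfun_apply D f) \<in> mult_op (\<lambda>x. V x - B x)"
      using potential_operator[OF std_algebra_bounded[OF R] _ less_imp_le[OF B(2)]] e by (metis half_gt_zero less_imp_le)
    have "D = T - (M o\<^sub>L R)"
      by (rule blinfun_eqI)
        (simp add: blinfun.bilinear_simps mult_op_unique[OF D(2) mult_op_potential_diff[OF T M(2)]])
    then have "dist (M o\<^sub>L R) T < e" using D(1) e by (simp add: dist_norm norm_minus_commute)
    moreover have "M o\<^sub>L R \<in> std_algebra" by (intro std_algebraD(4) finite_range_subset_std_algebra[OF M(1)] R)
    ultimately show ?thesis by blast
  qed
  then have "T \<in> closure std_algebra" unfolding closure_approachable by blast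
  then show ?thesis by (simp add: std_algebraD(1))
qed

section \<open>Resolvents of the perturbed operators\<close>

text \<open>
  With \<open>B = V R\<^sub>0\<close> one has \<open>a + H = (1 + B) (a + H\<^sub>0)\<close> and \<open>\<parallel>B\<parallel> < 1\<close>, so the Neumann series gives the
  inverse \<open>R\<^sub>0 (1 + B)\<^sup>-\<^sup>1\<close>. The sign in the conclusion is that of \<open>(z - H)\<^sup>-\<^sup>1\<close> at \<open>z = - a\<close>.
\<close>

lemma perturbed_resolvent:
  assumes a: "a > 0" and V: "V \<in> pot_space_closure (free_resolvent a)" and V1: "pot_norm (free_resolvent a) V < 1"
  obtains B D where "B \<in> std_algebra" "D \<in> std_algebra" "D o\<^sub>L (id_blinfun + B) = id_blinfun" "(id_blinfun + B) o\<^sub>L D = id_blinfun"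
    "\<And>f. (blinfun_apply (free_resolvent a) f, blinfun_apply B f) \<in> mult_op V"
    "is_resolvent (- of_real a) (op_plus free_hamiltonian (mult_op V)) (- (free_resolvent a o\<^sub>L D))"
proof -
  let ?R = "free_resolvent a :: 'a op"
  have RA: "?R \<in> std_algebra" by (rule free_resolvent_std_algebra[OF a])
  define c where "c = enn2real (pot_norm ?R V)"
  have fin: "pot_norm ?R V < top_class.top" using V1 by (rule less_trans) simp
  have c: "pot_norm ?R V = ennreal c" unfolding c_def by (rule ennreal_enn2real[OF fin, symmetric])
  have c0: "c \<ge> 0" by (simp add: c_def)
  have c1: "c < 1" using V1 unfolding c using c0 by (simp add: ennreal_less_one_iff)
  obtain B where B: "B \<in> bounded_ops" "norm B \<le> c" "\<And>f. (blinfun_apply ?R f, blinfun_apply B f) \<in> mult_op V"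
    using potential_operator[OF free_resolvent(1)[OF a] c0] c by (metis order_refl)
  have BA: "B \<in> std_algebra" by (rule potential_operator_std_algebra[OF RA V B(3)])
  obtain D where D: "D \<in> std_algebra" "D o\<^sub>L (id_blinfun - (- B)) = id_blinfun" "(id_blinfun - (- B)) o\<^sub>L D = id_blinfun"
    using Neumann_inverse[OF closed_subalgebra_std_algebra std_algebraD(8)[OF BA]] B(2) c1 by auto
  then have D': "D o\<^sub>L (id_blinfun + B) = id_blinfun" "(id_blinfun + B) o\<^sub>L D = id_blinfun" by simp_all
  have D1: "blinfun_apply D (\<phi> + blinfun_apply B \<phi>) = \<phi>" and D2: "blinfun_apply D \<phi> + blinfun_apply B (blinfun_apply D \<phi>) = \<phi>" for \<phi>
    using D'[THEN arg_cong[where f = "\<lambda>A. blinfun_apply A \<phi>"]] by (simp_all add: blinfun.add_left)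
  have "is_resolvent (- of_real a) (op_plus free_hamiltonian (mult_op V)) (- (?R o\<^sub>L D))"
    unfolding is_resolvent_def
  proof (intro conjI allI)
    show "- (?R o\<^sub>L D) \<in> bounded_ops" using free_resolvent(1)[OF a] std_algebra_bounded[OF D(1)] by auto
    fix f h
    have rhs: "blinfun_apply (- (?R o\<^sub>L D)) (- of_real a *\<^sub>C f - h) = blinfun_apply ?R (blinfun_apply D (of_real a *\<^sub>C f + h))"
    proof -
      have "- of_real a *\<^sub>C f - h = - (of_real a *\<^sub>C f + h)" by (simp add: scaleC_uminus_left)
      then show ?thesis by (simp only: blinfun.minus_left blinfun.minus_right minus_minus blinfun_apply_blinfun_compose)
    qed
    show "(f, h) \<in> op_plus free_hamiltonian (mult_op V) \<longleftrightarrow> f = blinfun_apply (- (?R o\<^sub>L D)) (- of_real a *\<^sub>C f - h)"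
      unfolding rhs
    proof
      assume "(f, h) \<in> op_plus free_hamiltonian (mult_op V)"
      then obtain g k where gk: "(f, g) \<in> free_hamiltonian" "(f, k) \<in> mult_op V" "h = g + k" by (auto simp: op_plus_def)
      define \<phi> where "\<phi> = of_real a *\<^sub>C f + g"
      have f: "f = blinfun_apply ?R \<phi>" using gk(1) by (simp add: free_resolvent(2)[OF a] \<phi>_def)
      have "k = blinfun_apply B \<phi>" using gk(2) B(3)[of \<phi>] by (intro mult_op_unique[of f k V]) (simp_all add: f[symmetric])
      then have "of_real a *\<^sub>C f + h = \<phi> + blinfun_apply B \<phi>" by (simp add: gk(3) \<phi>_def)
      then show "f = blinfun_apply ?R (blinfun_apply D (of_real a *\<^sub>C f + h))" using D1 f by simp
    next
      assume f: "f = blinfun_apply ?R (blinfun_apply D (of_real a *\<^sub>C f + h))"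
      define \<phi> where "\<phi> = blinfun_apply D (of_real a *\<^sub>C f + h)"
      have f': "f = blinfun_apply ?R \<phi>" using f by (simp add: \<phi>_def)
      have "(f, \<phi> - of_real a *\<^sub>C f) \<in> free_hamiltonian" using f' by (simp add: free_resolvent(2)[OF a])
      moreover have "(f, blinfun_apply B \<phi>) \<in> mult_op V" using B(3)[of \<phi>] f' by simp
      moreover have "\<phi> + blinfun_apply B \<phi> = of_real a *\<^sub>C f + h"
        unfolding \<phi>_def by (rule D2)
      then have "h = (\<phi> - of_real a *\<^sub>C f) + blinfun_apply B \<phi>"
        by (metis add_diff_cancel_left' add_diff_eq add.commute diff_add_eq)
      ultimately show "(f, h) \<in> op_plus free_hamiltonian (mult_op V)" unfolding op_plus_def by blast
    qed
  qed
  with BA D(1) D' B(3) show thesis by (intro that)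
qed

lemma resolvent_commute_shift:
  assumes R: "is_resolvent z T R"
    and T: "\<And>f h. (f, h) \<in> T \<Longrightarrow> (blinfun_apply (shift y) f, blinfun_apply (shift y) h) \<in> T"
  shows "R o\<^sub>L shift y = shift y o\<^sub>L R"
proof (rule blinfun_eqI)
  fix g
  let ?f = "blinfun_apply R g" and ?U = "blinfun_apply (shift y)"
  have "(?f, z *\<^sub>C ?f - g) \<in> T" by (subst is_resolventD(2)[OF R]) simp
  then have "(?U ?f, ?U (z *\<^sub>C ?f - g)) \<in> T" by (rule T)
  then have "?U ?f = blinfun_apply R (z *\<^sub>C ?U ?f - ?U (z *\<^sub>C ?f - g))" by (simp only: is_resolventD(2)[OF R])
  then show "blinfun_apply (R o\<^sub>L shift y) g = blinfun_apply (shift y o\<^sub>L R) g"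
    by (simp add: blinfun.diff_right bounded_opsD[OF shift_bounded_ops])
qed

lemma free_hamiltonian_shift:
  assumes "(f, h) \<in> free_hamiltonian"
  shows "(blinfun_apply (shift y) f, blinfun_apply (shift y) h) \<in> free_hamiltonian"
proof -
  have f: "f = blinfun_apply (free_resolvent 1) (of_real 1 *\<^sub>C f + h)"
    using assms by (simp only: free_resolvent(2)[OF zero_less_one])
  have "blinfun_apply (shift y) f = blinfun_apply (free_resolvent 1) (blinfun_apply (shift y) (of_real 1 *\<^sub>C f + h))"
    unfolding free_resolvent_commute_shift[OF zero_less_one] using f by simp
  then show ?thesis
    by (simp only: free_resolvent(2)[OF zero_less_one] blinfun.add_right bounded_opsD[OF shift_bounded_ops])
qed

lemma mult_op_shift:
  assumes fk: "(f, k) \<in> mult_op W" and per: "AE x in lebesgue. W (x + y) = W x"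
  shows "(blinfun_apply (shift y) f, blinfun_apply (shift y) k) \<in> mult_op W"
proof -
  have 1: "AE x in lebesgue. rep_L2 k (x - y) = W (x - y) * rep_L2 f (x - y)"
    using AE_translation[of "\<lambda>x. rep_L2 k x = W x * rep_L2 f x" y] fk by (simp add: mult_op_iff)
  have 2: "AE x in lebesgue. W x = W (x - y)"
    using AE_translation[OF per, of y] by simp
  show ?thesis
    unfolding mult_op_iff using 1 2 rep_shift[of y f] rep_shift[of y k] by eventually_elim simp
qed

lemma op_plus_shift:
  assumes "(f, h) \<in> op_plus free_hamiltonian (mult_op W)" "AE x in lebesgue. W (x + y) = W x"
  shows "(blinfun_apply (shift y) f, blinfun_apply (shift y) h) \<in> op_plus free_hamiltonian (mult_op W)"
proof -
  obtain g k where "(f, g) \<in> free_hamiltonian" "(f, k) \<in> mult_op W" "h = g + k" using assms(1) by (auto simp: op_plus_def)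
  then show ?thesis
    using free_hamiltonian_shift[of f g y] mult_op_shift[OF _ assms(2), of f k]
    unfolding op_plus_def by (auto simp: blinfun.add_right)
qed

lemma slab_nbhd_bound:
  fixes i :: "'d::finite"
  assumes x: "x \<in> nbhd {x::real^'d. \<bar>x $ i\<bar> < 1} r"
  shows "\<bar>x $ i\<bar> < r + 1"
proof -
  let ?S = "{x::real^'d. \<bar>x $ i\<bar> < 1}"
  have ne: "?S \<noteq> {}" by (auto intro: exI[of _ 0])
  have "(INF s\<in>?S. dist x s) < r" using x by (simp add: nbhd_def infdist_notempty[OF ne])
  then obtain s where s: "\<bar>s $ i\<bar> < 1" "dist x s < r" using cInf_lessD[of "dist x ` ?S" r] ne by auto
  have "\<bar>(x - s) $ i\<bar> \<le> dist x s" unfolding dist_norm by (rule component_le_norm_cart)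
  with s show ?thesis by simp
qed

lemma eventually_leaves_slab_nbhd:
  fixes i :: "'d::finite" and x :: "real^'d"
  assumes k: "k > 0"
  shows "\<forall>\<^sub>F n in sequentially. x + real n *\<^sub>R (k *\<^sub>R axis i 1) \<notin> nbhd {x. \<bar>x $ i\<bar> < 1} r"
proof -
  obtain N :: nat where N: "(r + 1 - x $ i) / k < real N" using reals_Archimedean2 by blast
  have "x + real n *\<^sub>R (k *\<^sub>R axis i 1) \<notin> nbhd {x. \<bar>x $ i\<bar> < 1} r" if n: "n \<ge> N" for n
  proof
    assume "x + real n *\<^sub>R (k *\<^sub>R axis i 1) \<in> nbhd {x. \<bar>x $ i\<bar> < 1} r"
    from slab_nbhd_bound[OF this] have "x $ i + real n * k < r + 1" by (simp add: axis_def)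
    moreover have "(r + 1 - x $ i) / k < real n" using N n by linarith
    then have "r + 1 - x $ i < real n * k" using k by (simp add: pos_divide_less_eq)
    ultimately show False by simp
  qed
  then show ?thesis by (auto simp: eventually_sequentially)
qed

section \<open>The spectra of the periodic operator and of its local perturbation\<close>

theorem theorem41:
  fixes V W X :: "real ^ 'd \<Rightarrow> complex"
    and i :: 'd
    and a c :: real
    and R0 :: "(real ^ 'd) op"
    and S :: "(real ^ 'd) set"
    and H0 HW H :: "(real ^ 'd) unbounded_op"
  assumes H0: "H0 = free_hamiltonian"
    and a: "a > 0"
    and R0: "R0 = free_resolvent a"
    and V: "V = (\<lambda>x. W x + X x)"
    and X_meas: "X \<in> borel_measurable lebesgue"
    and V_pot: "V \<in> pot_space_closure R0" and V_norm: "pot_norm R0 V < 1"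
    and W_pot: "W \<in> pot_space_closure R0" and W_norm: "pot_norm R0 W < 1"
    and W_periodic: "periodic_along (axis i 1) W"
    and S: "S = {x. \<bar>x $ i\<bar> < 1}"
    and c: "c \<ge> 1"
    and X_supp: "AE x in lebesgue. x \<notin> nbhd S c \<longrightarrow> X x = 0"
    and HW: "HW = op_plus H0 (mult_op W)"
    and H: "H = op_plus H0 (mult_op V)"
  shows "spectrum HW = ess_spectrum HW \<and>
         ess_spectrum HW = S_spectrum S HW \<and>
         S_spectrum S HW = S_spectrum S H \<and>
         S_spectrum S H \<subseteq> ess_spectrum H \<and>
         ess_spectrum H \<subseteq> spectrum H"
proof -
  have R0_A: "R0 \<in> std_algebra" unfolding R0 by (rule free_resolvent_std_algebra[OF a])
  obtain BV DV where BV: "BV \<in> std_algebra" "DV \<in> std_algebra"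
      "DV o\<^sub>L (id_blinfun + BV) = id_blinfun" "(id_blinfun + BV) o\<^sub>L DV = id_blinfun"
      "\<And>f. (blinfun_apply R0 f, blinfun_apply BV f) \<in> mult_op V"
    and RV: "is_resolvent (- of_real a) H (- (R0 o\<^sub>L DV))"
    using perturbed_resolvent[OF a V_pot[unfolded R0] V_norm[unfolded R0]] unfolding R0 H H0 by blast
  obtain BW DW where BW: "BW \<in> std_algebra" "DW \<in> std_algebra"
      "DW o\<^sub>L (id_blinfun + BW) = id_blinfun" "(id_blinfun + BW) o\<^sub>L DW = id_blinfun"
      "\<And>f. (blinfun_apply R0 f, blinfun_apply BW f) \<in> mult_op W"
    and RW: "is_resolvent (- of_real a) HW (- (R0 o\<^sub>L DW))"
    using perturbed_resolvent[OF a W_pot[unfolded R0] W_norm[unfolded R0]] unfolding R0 HW H0 by blast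
  have RV_A: "- (R0 o\<^sub>L DV) \<in> std_algebra" by (intro std_algebraD R0_A BV)
  have RW_A: "- (R0 o\<^sub>L DW) \<in> std_algebra" by (intro std_algebraD R0_A BW)
  have S0: "0 \<in> S" by (simp add: S)

  \<comment> \<open>\<open>BV - BW\<close> is the product of \<open>X\<close> and \<open>R0\<close>, whose values are supported near \<open>S\<close>\<close>
  have "BV - BW \<in> std_ideal S"
  proof (rule one_sided_support_std_ideal)
    show "BV - BW \<in> std_algebra" by (intro std_algebraD BV BW)
    show "proj (nbhd S c) o\<^sub>L (BV - BW) = BV - BW"
    proof (rule blinfun_eqI)
      fix f
      let ?k = "blinfun_apply (BV - BW) f"
      have "(blinfun_apply R0 f, ?k) \<in> mult_op (\<lambda>x. V x - W x)"
        using mult_op_potential_diff[OF BV(5) BW(5), of f] by (simp add: blinfun.diff_left)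
      then have "AE x in lebesgue. rep_L2 ?k x = X x * rep_L2 (blinfun_apply R0 f) x" by (simp add: mult_op_iff V)
      then have "AE x in lebesgue. rep_L2 (blinfun_apply (proj (nbhd S c)) ?k) x = rep_L2 ?k x"
        using X_supp rep_proj[OF nbhd_measurable, of S c ?k] by eventually_elim (auto simp: indicator_def)
      then show "blinfun_apply (proj (nbhd S c) o\<^sub>L (BV - BW)) f = blinfun_apply (BV - BW) f"
        by (simp add: L2_eqI)
    qed
  qed
  moreover have "- (R0 o\<^sub>L DW) - (- (R0 o\<^sub>L DV)) = R0 o\<^sub>L (DV - DW)" by (simp add: compose_distribs)
  moreover have "DV - DW = - (DV o\<^sub>L ((BV - BW) o\<^sub>L DW))"
  proof -
    \<comment> \<open>the second resolvent identity for the inverses of \<open>1 + BV\<close> and \<open>1 + BW\<close>\<close>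
    have "DV - DW = (DV o\<^sub>L ((id_blinfun + BW) o\<^sub>L DW)) - ((DV o\<^sub>L (id_blinfun + BV)) o\<^sub>L DW)"
      by (simp only: BV(3) BW(4) blinfun_compose_id)
    then show ?thesis by (simp add: compose_distribs blinfun_compose_assoc)
  qed
  ultimately have diff: "- (R0 o\<^sub>L DW) - (- (R0 o\<^sub>L DV)) \<in> std_ideal S"
    using subspace_neg[OF subspace_std_ideal[of S]] std_ideal_left[OF BV(2) std_ideal_right[OF BW(2)]]
    by (metis R0_A std_ideal_left)

  \<comment> \<open>translation by the period commutes with the resolvent and leaves every \<open>S(r)\<close>\<close>
  obtain k where k: "k > 0" "AE x in lebesgue. W (x + k *\<^sub>R axis i 1) = W x"
    using W_periodic by (auto simp: periodic_along_def)
  have comm: "- (R0 o\<^sub>L DW) o\<^sub>L shift (k *\<^sub>R axis i 1) = shift (k *\<^sub>R axis i 1) o\<^sub>L - (R0 o\<^sub>L DW)"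
    by (rule resolvent_commute_shift[OF RW]) (simp add: HW H0 op_plus_shift k(2))
  have "spectrum HW \<subseteq> S_spectrum S HW"
    by (rule spectrum_subset_S_spectrum[OF _ RW RW_A comm]) (simp only: S eventually_leaves_slab_nbhd[OF k(1)])
  moreover have "S_spectrum S HW \<subseteq> ess_spectrum HW" by (rule S_spectrum_subset_ess_spectrum[OF RW RW_A S0])
  moreover have "ess_spectrum HW \<subseteq> spectrum HW" by (rule ess_spectrum_subset_spectrum)
  moreover have "S_spectrum S HW = S_spectrum S H" by (rule S_spectrum_cong[OF RW RW_A RV RV_A diff])
  moreover have "S_spectrum S H \<subseteq> ess_spectrum H" by (rule S_spectrum_subset_ess_spectrum[OF RV RV_A S0])
  moreover have "ess_spectrum H \<subseteq> spectrum H" by (rule ess_spectrum_subset_spectrum)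
  ultimately show ?thesis by blast
qed

end
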